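(* There exists a del Pezzo surface $X$ of degree $4$ (a smooth complete intersection of two quadrics in $\mathbb{P}^4_k$) over a field $k$ of characteristic $0$ such that $X$ has index $4$.
   Context: The index of a variety over $k$ is the greatest common divisor of the degrees $[\mathbf{k}(x):k]$ of its closed points $x$. *)

theory Defs
  imports "HOL-Algebra.Algebra" Complex_Main
begin

text \<open>
  Fields are the library's ring records, with arbitrary operations on a carrier set, so a statement
  about the existence of a field has to fix the type of which the carrier is a subset; it is used
  below with the type \<^typ>\<open>complex\<close>, which serves only as a set of the cardinality of the continuum.
  This loses nothing: if a del Pezzo surface of degree 4 has index 4 over some field of characteristic
  0, then so does its model over the countable subfield generated by the coefficients of its equations,
  since the index over the subfield is a multiple of 4 and, by intersecting with two hyperplanes,
  divides 4.
\<close>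

definition char_zero :: "('a, 'b) ring_scheme \<Rightarrow> bool" where
  "char_zero k \<longleftrightarrow> (\<forall>n::nat. n > 0 \<longrightarrow> add_pow k n \<one>\<^bsub>k\<^esub> \<noteq> \<zero>\<^bsub>k\<^esub>)"

section \<open>The homogeneous coordinate ring of projective space\<close>

text \<open>
  As in \<^theory>\<open>HOL-Algebra.Indexed_Polynomials\<close>, a polynomial is its coefficient function, and a
  monomial is the multiset of its variables. The variables of \<open>hcoord_ring k n\<close> are indexed by
  \<open>0, \<dots>, n\<close>.
\<close>

type_synonym 'a mpolynomial = "nat multiset \<Rightarrow> 'a"

definition hcoord_ring :: "('a, 'b) ring_scheme \<Rightarrow> nat \<Rightarrow> 'a mpolynomial ring" where
  "hcoord_ring k n =
    \<lparr>carrier = {f. (\<forall>m. f m \<in> carrier k) \<and> finite {m. f m \<noteq> \<zero>\<^bsub>k\<^esub>} \<and>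
                   (\<forall>m. f m \<noteq> \<zero>\<^bsub>k\<^esub> \<longrightarrow> set_mset m \<subseteq> {..n})},
     monoid.mult = (\<lambda>f g m. \<Oplus>\<^bsub>k\<^esub>a\<in>{a. a \<subseteq># m}. f a \<otimes>\<^bsub>k\<^esub> g (m - a)),
     one = (\<lambda>m. if m = {#} then \<one>\<^bsub>k\<^esub> else \<zero>\<^bsub>k\<^esub>),
     ring.zero = (\<lambda>m. \<zero>\<^bsub>k\<^esub>),
     ring.add = (\<lambda>f g m. f m \<oplus>\<^bsub>k\<^esub> g m)\<rparr>"

definition const_poly :: "('a, 'b) ring_scheme \<Rightarrow> 'a \<Rightarrow> 'a mpolynomial" where
  "const_poly k c = (\<lambda>m. if m = {#} then c else \<zero>\<^bsub>k\<^esub>)"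

definition partial_deriv ::
  "('a, 'b) ring_scheme \<Rightarrow> nat \<Rightarrow> 'a mpolynomial \<Rightarrow> 'a mpolynomial" where
  "partial_deriv k i f = (\<lambda>m. add_pow k (count m i + 1) (f (add_mset i m)))"

text \<open>The zero polynomial is homogeneous of every degree.\<close>

definition homogeneous_poly ::
  "('a, 'b) ring_scheme \<Rightarrow> nat \<Rightarrow> 'a mpolynomial \<Rightarrow> bool" where
  "homogeneous_poly k d f \<longleftrightarrow> (\<forall>m. f m \<noteq> \<zero>\<^bsub>k\<^esub> \<longrightarrow> size m = d)"

definition homogeneous_part ::
  "('a, 'b) ring_scheme \<Rightarrow> nat \<Rightarrow> 'a mpolynomial \<Rightarrow> 'a mpolynomial" where
  "homogeneous_part k d f = (\<lambda>m. if size m = d then f m else \<zero>\<^bsub>k\<^esub>)"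

section \<open>Closed subschemes of projective space and their closed points\<close>

definition irrelevant_ideal :: "('a, 'b) ring_scheme \<Rightarrow> nat \<Rightarrow> 'a mpolynomial set" where
  "irrelevant_ideal k n = {f \<in> carrier (hcoord_ring k n). f {#} = \<zero>\<^bsub>k\<^esub>}"

text \<open>The points of \<open>\<P>\<^sup>n\<close> over \<open>k\<close>, that is, of \<open>Proj k[x\<^sub>0, \<dots>, x\<^sub>n]\<close>.\<close>

definition proj_space :: "('a, 'b) ring_scheme \<Rightarrow> nat \<Rightarrow> 'a mpolynomial set set" where
  "proj_space k n = {P. primeideal P (hcoord_ring k n) \<and>
                        (\<forall>f\<in>P. \<forall>d. homogeneous_part k d f \<in> P) \<and>
                        \<not> irrelevant_ideal k n \<subseteq> P}"

definition zero_locus ::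
  "('a, 'b) ring_scheme \<Rightarrow> nat \<Rightarrow> 'a mpolynomial set \<Rightarrow> 'a mpolynomial set set" where
  "zero_locus k n F = {P \<in> proj_space k n. F \<subseteq> P}"

text \<open>
  The points of the subscheme cut out by \<open>F\<close> that are closed in the Zariski topology, whose closed
  sets are the sets \<open>zero_locus k n G\<close>. (Being closed in the subscheme or in \<open>\<P>\<^sup>n\<close> is the same.)
\<close>

definition closed_points ::
  "('a, 'b) ring_scheme \<Rightarrow> nat \<Rightarrow> 'a mpolynomial set \<Rightarrow> 'a mpolynomial set set" where
  "closed_points k n F = {P \<in> zero_locus k n F.
     \<exists>G \<subseteq> carrier (hcoord_ring k n). zero_locus k n G = {P}}"

section \<open>Residue fields\<close>

text \<open>
  The residue field at \<open>P\<close> is the degree zero part of the localisation of \<open>S/P\<close> at its nonzero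
  homogeneous elements, \<open>S\<close> being the homogeneous coordinate ring. Its elements are classes of pairs
  \<open>(f, g)\<close>, standing for \<open>f/g\<close>, with \<open>f\<close>, \<open>g\<close> homogeneous of equal degree and \<open>g \<notin> P\<close>; two such
  pairs are identified if \<open>f g' - f' g \<in> P\<close>. The residue field of a point is the same for \<open>\<P>\<^sup>n\<close>
  and for any closed subscheme containing the point.
\<close>

definition hom_fracs ::
  "('a, 'b) ring_scheme \<Rightarrow> nat \<Rightarrow> 'a mpolynomial set \<Rightarrow> ('a mpolynomial \<times> 'a mpolynomial) set" where
  "hom_fracs k n P = {(f, g). f \<in> carrier (hcoord_ring k n) \<and> g \<in> carrier (hcoord_ring k n) \<and> g \<notin> P \<and>
     (\<exists>d. homogeneous_poly k d f \<and> homogeneous_poly k d g)}"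

definition frac_class ::
  "('a, 'b) ring_scheme \<Rightarrow> nat \<Rightarrow> 'a mpolynomial set \<Rightarrow> 'a mpolynomial \<Rightarrow> 'a mpolynomial
    \<Rightarrow> ('a mpolynomial \<times> 'a mpolynomial) set" where
  "frac_class k n P f g = {(f', g') \<in> hom_fracs k n P.
     (f \<otimes>\<^bsub>hcoord_ring k n\<^esub> g') \<ominus>\<^bsub>hcoord_ring k n\<^esub> (f' \<otimes>\<^bsub>hcoord_ring k n\<^esub> g) \<in> P}"

text \<open>
  As in the library's quotient ring, operations on classes are unions over representatives; all the
  classes united here coincide.
\<close>

definition residue_field ::
  "('a, 'b) ring_scheme \<Rightarrow> nat \<Rightarrow> 'a mpolynomial set
    \<Rightarrow> ('a mpolynomial \<times> 'a mpolynomial) set ring" where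
  "residue_field k n P = (let S = hcoord_ring k n in
    \<lparr>carrier = {frac_class k n P f g |f g. (f, g) \<in> hom_fracs k n P},
     monoid.mult = (\<lambda>A B. \<Union>(f, g)\<in>A. \<Union>(f', g')\<in>B.
               frac_class k n P (f \<otimes>\<^bsub>S\<^esub> f') (g \<otimes>\<^bsub>S\<^esub> g')),
     one = frac_class k n P \<one>\<^bsub>S\<^esub> \<one>\<^bsub>S\<^esub>,
     ring.zero = frac_class k n P \<zero>\<^bsub>S\<^esub> \<one>\<^bsub>S\<^esub>,
     ring.add = (\<lambda>A B. \<Union>(f, g)\<in>A. \<Union>(f', g')\<in>B.
               frac_class k n P ((f \<otimes>\<^bsub>S\<^esub> g') \<oplus>\<^bsub>S\<^esub> (f' \<otimes>\<^bsub>S\<^esub> g)) (g \<otimes>\<^bsub>S\<^esub> g'))\<rparr>)"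

definition residue_scalars ::
  "('a, 'b) ring_scheme \<Rightarrow> nat \<Rightarrow> 'a mpolynomial set
    \<Rightarrow> ('a mpolynomial \<times> 'a mpolynomial) set set" where
  "residue_scalars k n P = (\<lambda>c. frac_class k n P (const_poly k c) \<one>\<^bsub>hcoord_ring k n\<^esub>) ` carrier k"

text \<open>
  \<open>residue_degree k n P d\<close> says that the residue field at \<open>P\<close> has finite degree \<open>d\<close> over \<open>k\<close>. Every
  closed point has such a \<open>d\<close>, by the Nullstellensatz.
\<close>

definition residue_degree ::
  "('a, 'b) ring_scheme \<Rightarrow> nat \<Rightarrow> 'a mpolynomial set \<Rightarrow> nat \<Rightarrow> bool" where
  "residue_degree k n P d \<longleftrightarrow>
     ring.dimension (residue_field k n P) d (residue_scalars k n P) (carrier (residue_field k n P))"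

text \<open>The index of the subscheme of \<open>\<P>\<^sup>n\<close> cut out by \<open>F\<close>.\<close>

definition proj_index ::
  "('a, 'b) ring_scheme \<Rightarrow> nat \<Rightarrow> 'a mpolynomial set \<Rightarrow> nat" where
  "proj_index k n F = Gcd {d. \<exists>P \<in> closed_points k n F. residue_degree k n P d}"

section \<open>Quartic del Pezzo surfaces\<close>

definition quadric_form ::
  "('a, 'b) ring_scheme \<Rightarrow> nat \<Rightarrow> 'a mpolynomial \<Rightarrow> bool" where
  "quadric_form k n q \<longleftrightarrow>
     q \<in> carrier (hcoord_ring k n) \<and> q \<noteq> \<zero>\<^bsub>hcoord_ring k n\<^esub> \<and> homogeneous_poly k 2 q"

text \<open>
  Two forms of positive degree define a complete intersection if they are a regular sequence: the
  first is not a zero divisor, and the second is not a zero divisor modulo the first.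
\<close>

definition complete_intersection2 ::
  "('a, 'b) ring_scheme \<Rightarrow> nat \<Rightarrow> 'a mpolynomial \<Rightarrow> 'a mpolynomial \<Rightarrow> bool" where
  "complete_intersection2 k n q1 q2 \<longleftrightarrow> (let S = hcoord_ring k n in
     (\<forall>f\<in>carrier S. f \<otimes>\<^bsub>S\<^esub> q1 = \<zero>\<^bsub>S\<^esub> \<longrightarrow> f = \<zero>\<^bsub>S\<^esub>) \<and>
     (\<forall>f\<in>carrier S. f \<otimes>\<^bsub>S\<^esub> q2 \<in> PIdl\<^bsub>S\<^esub> q1 \<longrightarrow> f \<in> PIdl\<^bsub>S\<^esub> q1))"

text \<open>
  Smoothness over \<open>k\<close> of the complete intersection of two hypersurfaces, in the form of the Jacobian
  criterion: at each point \<open>P\<close> of the scheme, the Jacobian matrix has rank 2 over the residue field,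
  that is, some 2-by-2 minor does not vanish at \<open>P\<close>. As \<open>P\<close> ranges over all scheme points, this covers
  the geometric points too. By Euler's formula, the homogeneous Jacobian matrix has on the subscheme
  the same rank as the Jacobian matrix in any standard affine chart.
\<close>

definition smooth_intersection2 ::
  "('a, 'b) ring_scheme \<Rightarrow> nat \<Rightarrow> 'a mpolynomial \<Rightarrow> 'a mpolynomial \<Rightarrow> bool" where
  "smooth_intersection2 k n q1 q2 \<longleftrightarrow> (let S = hcoord_ring k n in
     \<forall>P\<in>zero_locus k n {q1, q2}. \<exists>i\<le>n. \<exists>j\<le>n.
       (partial_deriv k i q1 \<otimes>\<^bsub>S\<^esub> partial_deriv k j q2) \<ominus>\<^bsub>S\<^esub>
       (partial_deriv k j q1 \<otimes>\<^bsub>S\<^esub> partial_deriv k i q2) \<notin> P)"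

text \<open>The surface itself is the subscheme of \<open>\<P>\<^sup>4\<close> cut out by \<open>{q1, q2}\<close>.\<close>

definition del_pezzo4 ::
  "('a, 'b) ring_scheme \<Rightarrow> 'a mpolynomial \<Rightarrow> 'a mpolynomial \<Rightarrow> bool" where
  "del_pezzo4 k q1 q2 \<longleftrightarrow> quadric_form k 4 q1 \<and> quadric_form k 4 q2 \<and>
     complete_intersection2 k 4 q1 q2 \<and> smooth_intersection2 k 4 q1 q2"

end

theory Submission
  imports Defs "HOL-Library.Countable_Set" "HOL-Library.Poly_Mapping" "HOL-Library.Multiset_Order"
    "HOL-Analysis.Abstract_Topology_2" "HOL-Computational_Algebra.Fundamental_Theorem_Algebra"
    "Jordan_Normal_Form.Char_Poly"
begin

text \<open>
  Let \<open>k\<close> be the field of complex series with left-finite support in the subgroup \<open>\<Gamma>\<close> of \<open>\<real>\<close> consisting of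
  the combinations of \<open>1\<close>, \<open>\<surd>2\<close>, \<open>\<surd>3\<close> whose coefficients are rationals with odd denominator, and choose
  monomials \<open>t\<^sub>0, \<dots>, t\<^sub>4\<close> whose exponents are pairwise distinct modulo \<open>2\<Gamma>\<close>. The surface is
  \<open>\<Sum> t\<^sub>i x\<^sub>i\<^sup>2 = \<Sum> i t\<^sub>i x\<^sub>i\<^sup>2 = 0\<close>.

  As \<open>\<Gamma>\<close> is divisible by odd numbers, Hensel's lemma shows that every polynomial of odd degree over \<open>k\<close>
  has a root. Over such a field, an extension whose degree is not a multiple of 4 is trivial or quadratic.
  A point of the surface over a quadratic extension spans with its conjugate a line on which both
  quadratic forms are proportional, so some member of the pencil vanishes on a line over \<open>k\<close>. But four of
  the five coefficients of a member have distinct valuations modulo \<open>2\<Gamma>\<close>, so it is anisotropic on a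
  hyperplane. Hence all degrees of closed points are multiples of 4. A point of degree 4 lies on the
  subspace \<open>x\<^sub>3 = x\<^sub>4 = 0\<close>.
\<close>

hide_const (open) Divisibility.prime Polynomials.degree

section \<open>Exponents and left-finite series\<close>

text \<open>Two demands shape the field. The odd divisibility of the exponents and the algebraically
  closed residue field of complex numbers give roots in odd degree; and the five variables use five
  classes of \<Gamma> modulo 2\<Gamma>. Two generators would give only four classes, three give
  eight. Left-finite supports suffice because a polynomial has finitely many coefficients, whose
  positive exponents stay above some \<epsilon>; constructions then run in steps of that \<epsilon>.

  That a degree not divisible by 4 is 1 or 2 reflects a pro-2 Galois group, but it is obtained by
  linear algebra: an operator on a space of odd dimension has an eigenvector, and in degree 2 modulo
  4 the alternating forms supply such a space. The factors i in the second equation make the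
  coefficients of a pencil member affine in i, so that their leading terms degenerate for at most
  one i.

  The point of degree 4 comes from the identities 1 - 2 + 1 = 0 and 0 - 2 + 2 = 0. Its degree is
  pinned down by four spanning elements from above and by the divisibility by 4 from below.\<close>

definition exps :: "real set" where
  "exps = {x. \<exists>(a::int) (b::int) (c::int) (m::int). odd m \<and> x * of_int m = of_int a + of_int b * sqrt 2 + of_int c * sqrt 3}"

lemma expsI: "odd m \<Longrightarrow> x * of_int m = of_int a + of_int b * sqrt 2 + of_int c * sqrt 3 \<Longrightarrow> x \<in> exps"
  unfolding exps_def by blast

lemma exps_0 [simp]: "0 \<in> exps"
  by (rule expsI[of 1 _ 0 0 0]) auto

lemma exps_uminus [simp]: "- x \<in> exps \<longleftrightarrow> x \<in> exps"
proof -
  have "x \<in> exps \<Longrightarrow> - x \<in> exps" for x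
  proof -
    assume "x \<in> exps"
    then obtain a b c m where "odd (m::int)" "x * of_int m = of_int a + of_int b * sqrt 2 + of_int c * sqrt 3"
      unfolding exps_def by blast
    then show ?thesis by (intro expsI[of m _ "-a" "-b" "-c"]) auto
  qed
  from this[of x] this[of "-x"] show ?thesis by auto
qed

lemma exps_add: "x \<in> exps \<Longrightarrow> y \<in> exps \<Longrightarrow> x + y \<in> exps"
proof -
  assume "x \<in> exps" "y \<in> exps"
  then obtain a b c m a' b' c' m' where "odd (m::int)" and x: "x * of_int m = of_int a + of_int b * sqrt 2 + of_int c * sqrt 3"
    and "odd (m'::int)" and y: "y * of_int m' = of_int a' + of_int b' * sqrt 2 + of_int c' * sqrt 3"
    unfolding exps_def by blast
  have "(x + y) * of_int (m * m') = (x * of_int m) * of_int m' + (y * of_int m') * of_int m"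
    by (simp add: algebra_simps)
  also have "\<dots> = of_int (a * m' + a' * m) + of_int (b * m' + b' * m) * sqrt 2 + of_int (c * m' + c' * m) * sqrt 3"
    unfolding x y by (simp add: algebra_simps)
  finally show ?thesis using \<open>odd m\<close> \<open>odd m'\<close>
    by (intro expsI[of "m * m'" _ "a * m' + a' * m" "b * m' + b' * m" "c * m' + c' * m"]) auto
qed

lemma exps_diff: "x \<in> exps \<Longrightarrow> y \<in> exps \<Longrightarrow> x - y \<in> exps"
  using exps_add[of x "-y"] by simp

lemma exps_of_int_mult: "x \<in> exps \<Longrightarrow> of_int n * x \<in> exps"
proof -
  assume "x \<in> exps"
  then obtain a b c m where m: "odd (m::int)" and x: "x * of_int m = of_int a + of_int b * sqrt 2 + of_int c * sqrt 3"
    unfolding exps_def by blast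
  have "(of_int n * x) * of_int m = of_int n * (x * of_int m)" by simp
  also have "\<dots> = of_int (n * a) + of_int (n * b) * sqrt 2 + of_int (n * c) * sqrt 3"
    unfolding x by (simp add: algebra_simps)
  finally show ?thesis using m by (intro expsI)
qed

text \<open>This is what the odd denominators are for: a balanced slope between an even and an odd
  index is a difference of exponents divided by an odd number, and it must stay in
  \<open>exps\<close>.\<close>

lemma exps_odd_divide: "of_int n * x \<in> exps \<Longrightarrow> odd n \<Longrightarrow> x \<in> exps"
proof -
  assume "of_int n * x \<in> exps" and n: "odd n"
  then obtain a b c m where "odd (m::int)" "(of_int n * x) * of_int m = of_int a + of_int b * sqrt 2 + of_int c * sqrt 3"
    unfolding exps_def by blast
  then show ?thesis using n by (intro expsI[of "n * m" _ a b c]) (auto simp: mult_ac)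
qed

lemma countable_exps: "countable exps"
proof -
  have "exps \<subseteq> range (\<lambda>(a::int, b::int, c::int, m::int). (of_int a + of_int b * sqrt 2 + of_int c * sqrt 3) / of_int m)"
  proof
    fix x assume "x \<in> exps"
    then obtain a b c m where m: "odd (m::int)" and x: "x * of_int m = of_int a + of_int b * sqrt 2 + of_int c * sqrt 3"
      unfolding exps_def by blast
    have "m \<noteq> 0" using m by auto
    then have "x = (of_int a + of_int b * sqrt 2 + of_int c * sqrt 3) / of_int m"
      using x by (simp add: field_simps)
    then show "x \<in> range (\<lambda>(a::int, b::int, c::int, m::int). (of_int a + of_int b * sqrt 2 + of_int c * sqrt 3) / of_int m)"
      by (intro image_eqI[of _ _ "(a, b, c, m)"]) auto
  qed
  then show ?thesis by (rule countable_subset) auto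
qed

text \<open>Infinite descent on the absolute value of \<open>b\<close>: the prime \<open>p\<close>
  divides \<open>a\<close>, and then also \<open>b\<close> because it does not divide
  \<open>k\<close>; cancelling leaves the same equation with \<open>b\<close> divided by
  \<open>p\<close>. The instances used are the irrationality of the square roots of 2, 3 and
  6.\<close>

lemma int_square_eq_prime_mult_square:
  fixes p k :: int
  assumes p: "prime p" and k: "\<not> p dvd k"
  shows "a\<^sup>2 = p * k * b\<^sup>2 \<Longrightarrow> b = 0"
proof (induction "nat \<bar>b\<bar>" arbitrary: a b rule: less_induct)
  case less
  have p1: "p > 1" using p by (simp add: prime_gt_1_int)
  have "p dvd a\<^sup>2" using less.prems by simp
  then have "p dvd a" using p prime_dvd_power by blast
  then obtain a' where a: "a = p * a'" by auto
  have "p * (p * a'\<^sup>2) = p * (k * b\<^sup>2)" using less.prems a by (simp add: power2_eq_square mult_ac)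
  then have b2: "p * a'\<^sup>2 = k * b\<^sup>2" using p1 by simp
  then have "p dvd k * b\<^sup>2" by (metis dvd_triv_left)
  then have "p dvd b\<^sup>2" using k p prime_dvd_mult_iff by blast
  then have "p dvd b" using p prime_dvd_power by blast
  then obtain b' where b: "b = p * b'" by auto
  have "p * a'\<^sup>2 = p * (p * k * b'\<^sup>2)" using b2 b by (simp add: power2_eq_square mult_ac)
  then have e: "a'\<^sup>2 = p * k * b'\<^sup>2" using p1 by simp
  show ?case
  proof (rule ccontr)
    assume "b \<noteq> 0"
    then have "b' \<noteq> 0" using b by simp
    then have "\<bar>b'\<bar> * 1 < \<bar>b'\<bar> * p" using p1 by (intro mult_strict_left_mono) auto
    then have "nat \<bar>b'\<bar> < nat \<bar>b\<bar>" using b p1 by (simp add: abs_mult mult_ac)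
    from less.hyps[OF this e] \<open>b' \<noteq> 0\<close> show False by simp
  qed
qed

lemma prime_2_3_int: "prime (2::int)" "prime (3::int)"
proof -
  show "prime (2::int)" by simp
  have "\<not> 2 dvd (3::nat)" by simp
  have "prime (3::nat)" unfolding prime_nat_iff
  proof (intro conjI allI impI)
    fix m :: nat assume m: "m dvd 3"
    then have "m \<le> 3" by (simp add: dvd_imp_le)
    moreover have "m \<noteq> 2" using m by auto
    moreover have "m > 0" using m by (rule dvd_pos_nat[rotated]) simp
    ultimately show "m = 1 \<or> m = 3" by linarith
  qed simp
  then show "prime (3::int)" by simp
qed

text \<open>Moving the term with \<open>sqrt 3\<close> across and squaring leaves a relation between
  1 and \<open>sqrt 2\<close>; squaring that one forces \<open>2 * a * b = 0\<close>. The case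
  \<open>b = 0\<close> is then the irrationality of the square root of 3, the case
  \<open>a = 0\<close> that of the square root of 6.\<close>

lemma lin_indep_sqrt2_sqrt3:
  assumes "of_int a + of_int b * sqrt 2 + of_int c * sqrt 3 = (0::real)"
  shows "a = 0 \<and> b = 0 \<and> c = 0"
proof -
  have "(of_int a + of_int b * sqrt 2)\<^sup>2 = (- (of_int c * sqrt 3))\<^sup>2"
    using assms by (simp add: add_eq_0_iff2)
  then have e: "of_int (a\<^sup>2 + 2 * b\<^sup>2 - 3 * c\<^sup>2) = - (of_int (2 * a * b) * sqrt 2)"
    by (simp add: power2_eq_square algebra_simps)
  then have "(of_int (a\<^sup>2 + 2 * b\<^sup>2 - 3 * c\<^sup>2) :: real)\<^sup>2 = (- (of_int (2 * a * b) * sqrt 2))\<^sup>2" by simp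
  also have "\<dots> = of_int (2 * (2 * a * b)\<^sup>2)" by (simp add: power_mult_distrib)
  finally have "(a\<^sup>2 + 2 * b\<^sup>2 - 3 * c\<^sup>2)\<^sup>2 = 2 * 1 * (2 * a * b)\<^sup>2"
    by (metis of_int_eq_iff of_int_power mult.right_neutral)
  then have ab: "2 * a * b = 0" by (rule int_square_eq_prime_mult_square[OF prime_2_3_int(1), rotated]) simp
  then have "real_of_int (a\<^sup>2 + 2 * b\<^sup>2 - 3 * c\<^sup>2) = 0" using e by (metis minus_zero mult_zero_left of_int_0)
  then have abc: "a\<^sup>2 + 2 * b\<^sup>2 = 3 * c\<^sup>2" by linarith
  show ?thesis
  proof (cases "b = 0")
    case True
    then have "a\<^sup>2 = 3 * 1 * c\<^sup>2" using abc by simp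
    then have "c = 0" by (rule int_square_eq_prime_mult_square[OF prime_2_3_int(2), rotated]) simp
    then show ?thesis using abc True by simp
  next
    case False
    then have a: "a = 0" using ab by simp
    then have e2: "(2 * b)\<^sup>2 = 2 * 3 * c\<^sup>2" using abc by (simp add: power2_eq_square)
    then have "c = 0" by (rule int_square_eq_prime_mult_square[OF prime_2_3_int(1), rotated]) simp
    then show ?thesis using e2 a by simp
  qed
qed

text \<open>These are the exponents of the five monomials. In the basis 1, \<open>sqrt 2\<close>,
  \<open>sqrt 3\<close> they represent 0, the three basis vectors and the sum of the first two: five
  distinct classes modulo 2.\<close>

definition wt :: "nat \<Rightarrow> real" where
  "wt i = (if i = 0 then 0 else if i = 1 then 1 else if i = 2 then sqrt 2 else if i = 3 then sqrt 3 else 1 + sqrt 2)"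

lemma wt_exps [simp]: "wt i \<in> exps"
proof -
  have "1 \<in> exps" by (rule expsI[of 1 _ 1 0 0]) auto
  moreover have "sqrt 2 \<in> exps" by (rule expsI[of 1 _ 0 1 0]) auto
  moreover have "sqrt 3 \<in> exps" by (rule expsI[of 1 _ 0 0 1]) auto
  moreover have "1 + sqrt 2 \<in> exps" by (rule expsI[of 1 _ 1 1 0]) auto
  ultimately show ?thesis unfolding wt_def by auto
qed

lemma half_exps_even:
  assumes "(of_int a + of_int b * sqrt 2 + of_int c * sqrt 3) / 2 \<in> exps"
  shows "even a \<and> even b \<and> even c"
proof -
  obtain a' b' c' m where m: "odd (m::int)" and
    e: "(of_int a + of_int b * sqrt 2 + of_int c * sqrt 3) / 2 * of_int m = of_int a' + of_int b' * sqrt 2 + of_int c' * sqrt 3"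
    using assms unfolding exps_def by blast
  \<comment> \<open>By linear independence the three integer coefficients vanish separately; as
    \<open>m\<close> is odd, each of \<open>a\<close>, \<open>b\<close>, \<open>c\<close> inherits
    the factor 2.\<close>
  have "of_int (a * m - 2 * a') + of_int (b * m - 2 * b') * sqrt 2 + of_int (c * m - 2 * c') * sqrt 3 = (0::real)"
  proof -
    have h: "x / 2 * n = y \<Longrightarrow> x * n - 2 * y = 0" for x y n :: real by linarith
    show ?thesis using h[OF e] by (simp only: of_int_diff of_int_mult of_int_numeral ring_distribs left_diff_distrib right_diff_distrib mult_ac)
  qed
  then have "a * m = 2 * a' \<and> b * m = 2 * b' \<and> c * m = 2 * c'"
    using lin_indep_sqrt2_sqrt3[of "a * m - 2 * a'" "b * m - 2 * b'" "c * m - 2 * c'"] by linarith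
  then show ?thesis using m by (metis dvd_triv_left even_mult_iff)
qed

lemma wt_distinct_mod_2:
  assumes "i \<le> 4" "j \<le> 4" "i \<noteq> j"
  shows "(wt i - wt j) / 2 \<notin> exps"
proof -
  define A B C :: "nat \<Rightarrow> int" where "A i = (if i = 1 \<or> i = 4 then 1 else 0)"
    and "B i = (if i = 2 \<or> i = 4 then 1 else 0)" and "C i = (if i = 3 then 1 else 0)" for i
  have w: "wt i = of_int (A i) + of_int (B i) * sqrt 2 + of_int (C i) * sqrt 3" if "i \<le> 4" for i
    using that unfolding wt_def A_def B_def C_def by auto
  have "wt i - wt j = of_int (A i - A j) + of_int (B i - B j) * sqrt 2 + of_int (C i - C j) * sqrt 3"
    using assms by (simp add: w algebra_simps)
  then have "(wt i - wt j) / 2 \<in> exps \<Longrightarrow> even (A i - A j) \<and> even (B i - B j) \<and> even (C i - C j)"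
    using half_exps_even by metis
  moreover have "\<not> (even (A i - A j) \<and> even (B i - B j) \<and> even (C i - C j))"
  proof -
    have "i \<in> {0,1,2,3,4}" "j \<in> {0,1,2,3,4}" using assms by auto
    then show ?thesis using assms(3) unfolding A_def B_def C_def by auto
  qed
  ultimately show ?thesis by blast
qed

text \<open>The finiteness below every bound gives supports a least element and makes convolutions
  finite sums, so the series form a field of Levi-Civita type; arguments about well-ordered sets of
  exponents are replaced by induction over bounded bands.\<close>

definition left_finite :: "(real \<Rightarrow> complex) \<Rightarrow> bool" where
  "left_finite f \<longleftrightarrow> (\<forall>x. f x \<noteq> 0 \<longrightarrow> x \<in> exps) \<and> (\<forall>b. finite {x. x \<le> b \<and> f x \<noteq> 0})"

typedef series = "{f. left_finite f}"
  morphisms nth Abs_series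
  by (rule exI[of _ "\<lambda>_. 0"]) (simp add: left_finite_def)

setup_lifting type_definition_series

lemma series_eqI: "(\<And>x. nth f x = nth g x) \<Longrightarrow> f = g"
  by transfer auto

lemma nth_exps: "nth f x \<noteq> 0 \<Longrightarrow> x \<in> exps"
  by transfer (auto simp: left_finite_def)

lemma nth_finite: "finite {x. x \<le> b \<and> nth f x \<noteq> 0}"
  by transfer (auto simp: left_finite_def)

lemma finite_lower_bound:
  assumes "\<And>b::real. finite {x. x \<le> b \<and> P x}"
  shows "\<exists>a. \<forall>x. P x \<longrightarrow> a \<le> x"
proof (cases "\<exists>b. P b")
  case True
  then obtain b where b: "P b" by blast
  show ?thesis
  proof (intro exI allI impI)
    fix x assume "P x"
    show "Min {x. x \<le> b \<and> P x} \<le> x"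
    proof (cases "x \<le> b")
      case True then show ?thesis using \<open>P x\<close> assms by (intro Min_le) auto
    next
      case False
      have "Min {x. x \<le> b \<and> P x} \<le> b" using b assms by (intro Min_le) auto
      then show ?thesis using False by linarith
    qed
  qed
qed auto

lemma nth_lower_bound: "\<exists>a. \<forall>x. nth f x \<noteq> 0 \<longrightarrow> a \<le> x"
  by (rule finite_lower_bound[OF nth_finite])

instantiation series :: comm_ring
begin

lift_definition zero_series :: series is "\<lambda>_. 0" by (simp add: left_finite_def)

lift_definition plus_series :: "series \<Rightarrow> series \<Rightarrow> series" is "\<lambda>f g x. f x + g x"
proof -
  fix f g :: "real \<Rightarrow> complex" assume f: "left_finite f" and g: "left_finite g"
  have "finite {x. x \<le> b \<and> f x + g x \<noteq> 0}" for b
    by (rule finite_subset[of _ "{x. x \<le> b \<and> f x \<noteq> 0} \<union> {x. x \<le> b \<and> g x \<noteq> 0}"])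
      (use f g in \<open>auto simp: left_finite_def\<close>)
  moreover have "x \<in> exps" if "f x + g x \<noteq> 0" for x
    using that f g unfolding left_finite_def by (metis add_0)
  ultimately show "left_finite (\<lambda>x. f x + g x)" unfolding left_finite_def by blast
qed

lift_definition uminus_series :: "series \<Rightarrow> series" is "\<lambda>f x. - f x"
  by (simp add: left_finite_def)

definition minus_series :: "series \<Rightarrow> series \<Rightarrow> series" where "minus_series f g = f + (- g)"

text \<open>The index set is cut down to the terms that matter, so it is finite for left-finite
  arguments; \<open>conv_eq\<close> enlarges it to any convenient finite set.\<close>

definition conv :: "(real \<Rightarrow> complex) \<Rightarrow> (real \<Rightarrow> complex) \<Rightarrow> real \<Rightarrow> complex" where
  "conv f g x = (\<Sum>y | f y \<noteq> 0 \<and> g (x - y) \<noteq> 0. f y * g (x - y))"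

lemma conv_eq:
  assumes "finite A" "\<And>y. f y \<noteq> 0 \<Longrightarrow> g (x - y) \<noteq> 0 \<Longrightarrow> y \<in> A"
  shows "conv f g x = (\<Sum>y\<in>A. f y * g (x - y))"
  unfolding conv_def using assms by (intro sum.mono_neutral_left) auto

lift_definition times_series :: "series \<Rightarrow> series \<Rightarrow> series" is conv
proof -
  fix f g :: "real \<Rightarrow> complex" assume f: "left_finite f" and g: "left_finite g"
  obtain af where af: "\<And>x. f x \<noteq> 0 \<Longrightarrow> af \<le> x"
    using finite_lower_bound[of "\<lambda>x. f x \<noteq> 0"] f unfolding left_finite_def by blast
  obtain ag where ag: "\<And>x. g x \<noteq> 0 \<Longrightarrow> ag \<le> x"
    using finite_lower_bound[of "\<lambda>x. g x \<noteq> 0"] g unfolding left_finite_def by blast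
  have ex: "\<exists>y. f y \<noteq> 0 \<and> g (x - y) \<noteq> 0" if "conv f g x \<noteq> 0" for x
    using that unfolding conv_def by (metis (mono_tags, lifting) empty_Collect_eq sum.empty)
  have "finite {x. x \<le> b \<and> conv f g x \<noteq> 0}" for b
  proof (rule finite_subset)
    show "finite ((\<lambda>(y, z). y + z) ` ({y. y \<le> b - ag \<and> f y \<noteq> 0} \<times> {z. z \<le> b - af \<and> g z \<noteq> 0}))"
      using f g by (auto simp: left_finite_def)
    show "{x. x \<le> b \<and> conv f g x \<noteq> 0} \<subseteq> (\<lambda>(y, z). y + z) ` ({y. y \<le> b - ag \<and> f y \<noteq> 0} \<times> {z. z \<le> b - af \<and> g z \<noteq> 0})"
    proof
      fix x assume "x \<in> {x. x \<le> b \<and> conv f g x \<noteq> 0}"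
      then obtain y where y: "x \<le> b" "f y \<noteq> 0" "g (x - y) \<noteq> 0" using ex by blast
      then show "x \<in> (\<lambda>(y, z). y + z) ` ({y. y \<le> b - ag \<and> f y \<noteq> 0} \<times> {z. z \<le> b - af \<and> g z \<noteq> 0})"
        using af[of y] ag[of "x - y"] by (intro image_eqI[of _ _ "(y, x - y)"]) auto
    qed
  qed
  moreover have "x \<in> exps" if nz: "conv f g x \<noteq> 0" for x
  proof -
    obtain y where "f y \<noteq> 0" "g (x - y) \<noteq> 0" using ex[OF nz] by blast
    then have "y \<in> exps" "x - y \<in> exps" using f g unfolding left_finite_def by blast+
    then show ?thesis using exps_add by fastforce
  qed
  ultimately show "left_finite (conv f g)" unfolding left_finite_def by blast
qed

lemma nth_times_eq:
  assumes "finite A" "\<And>y. nth f y \<noteq> 0 \<Longrightarrow> nth g (x - y) \<noteq> 0 \<Longrightarrow> y \<in> A"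
  shows "nth (f * g) x = (\<Sum>y\<in>A. nth f y * nth g (x - y))"
  unfolding times_series.rep_eq using assms by (rule conv_eq)

lemma nth_times_nonzero:
  assumes "nth (f * g) x \<noteq> 0"
  shows "\<exists>y. nth f y \<noteq> 0 \<and> nth g (x - y) \<noteq> 0"
  using assms unfolding times_series.rep_eq conv_def
  by (metis (mono_tags, lifting) empty_Collect_eq sum.empty)

instance
proof
  fix a b c :: series
  show "a + b + c = a + (b + c)" by transfer (simp add: add.assoc)
  show "a + b = b + a" by transfer (simp add: add.commute)
  show "0 + a = a" by transfer simp
  show "- a + a = 0" by transfer simp
  show "a - b = a + - b" by (simp add: minus_series_def)
  have comm: "a * b = b * a" for a b :: series
  proof (rule series_eqI)
    fix x
    show "nth (a * b) x = nth (b * a) x"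
      unfolding times_series.rep_eq conv_def
      by (rule sum.reindex_bij_witness[of _ "\<lambda>y. x - y" "\<lambda>y. x - y"]) (auto simp: mult.commute)
  qed
  show "a * b = b * a" by (rule comm)
  obtain la where la: "\<And>x. nth a x \<noteq> 0 \<Longrightarrow> la \<le> x" using nth_lower_bound by blast
  obtain lb where lb: "\<And>x. nth b x \<noteq> 0 \<Longrightarrow> lb \<le> x" using nth_lower_bound by blast
  obtain lc where lc: "\<And>x. nth c x \<noteq> 0 \<Longrightarrow> lc \<le> x" using nth_lower_bound by blast
  \<comment> \<open>The triple product becomes a double sum over a rectangle: by the lower bounds of
    the three supports, the range of \<open>z\<close> can be chosen independently of
    \<open>y\<close>. Hence the two sums may be swapped, which gives left commutativity and, with
    commutativity, associativity.\<close>
  have three: "nth (f * (h * g)) x = (\<Sum>y | y \<le> x - lg - lh \<and> nth f y \<noteq> 0. \<Sum>z | z \<le> x - lf - lg \<and> nth h z \<noteq> 0. nth f y * (nth h z * nth g (x - y - z)))"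
    if lf: "\<And>x. nth f x \<noteq> 0 \<Longrightarrow> lf \<le> x" and lg: "\<And>x. nth g x \<noteq> 0 \<Longrightarrow> lg \<le> x"
      and lh: "\<And>x. nth h x \<noteq> 0 \<Longrightarrow> lh \<le> x" for f g h lf lg lh x
  proof -
    have "nth (f * (h * g)) x = (\<Sum>y | y \<le> x - lg - lh \<and> nth f y \<noteq> 0. nth f y * nth (h * g) (x - y))"
    proof (rule nth_times_eq[OF nth_finite])
      fix y assume "nth f y \<noteq> 0" "nth (h * g) (x - y) \<noteq> 0"
      then obtain z where "nth h z \<noteq> 0" "nth g (x - y - z) \<noteq> 0" using nth_times_nonzero by blast
      then have "lh \<le> z" "lg \<le> x - y - z" using lh lg by auto
      then show "y \<in> {y. y \<le> x - lg - lh \<and> nth f y \<noteq> 0}" using \<open>nth f y \<noteq> 0\<close> by auto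
    qed
    also have "\<dots> = (\<Sum>y | y \<le> x - lg - lh \<and> nth f y \<noteq> 0. nth f y * (\<Sum>z | z \<le> x - lf - lg \<and> nth h z \<noteq> 0. nth h z * nth g (x - y - z)))"
    proof (rule sum.cong[OF refl])
      fix y assume "y \<in> {y. y \<le> x - lg - lh \<and> nth f y \<noteq> 0}"
      then have ly: "lf \<le> y" using lf by auto
      have "nth (h * g) (x - y) = (\<Sum>z | z \<le> x - lf - lg \<and> nth h z \<noteq> 0. nth h z * nth g (x - y - z))"
      proof (rule nth_times_eq[OF nth_finite])
        fix z assume "nth h z \<noteq> 0" "nth g (x - y - z) \<noteq> 0"
        then show "z \<in> {z. z \<le> x - lf - lg \<and> nth h z \<noteq> 0}" using lg[of "x - y - z"] ly by auto
      qed
      then show "nth f y * nth (h * g) (x - y) = nth f y * (\<Sum>z | z \<le> x - lf - lg \<and> nth h z \<noteq> 0. nth h z * nth g (x - y - z))"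
        by simp
    qed
    finally show ?thesis by (simp add: sum_distrib_left)
  qed
  have left_comm: "a * (c * b) = c * (a * b)"
  proof (rule series_eqI)
    fix x
    have e1: "nth (a * (c * b)) x = (\<Sum>y | y \<le> x - lb - lc \<and> nth a y \<noteq> 0. \<Sum>z | z \<le> x - la - lb \<and> nth c z \<noteq> 0. nth a y * (nth c z * nth b (x - y - z)))"
      by (rule three) (use la lb lc in auto)
    have e2: "nth (c * (a * b)) x = (\<Sum>y | y \<le> x - lb - la \<and> nth c y \<noteq> 0. \<Sum>z | z \<le> x - lc - lb \<and> nth a z \<noteq> 0. nth c y * (nth a z * nth b (x - y - z)))"
      by (rule three) (use la lb lc in auto)
    show "nth (a * (c * b)) x = nth (c * (a * b)) x"
      unfolding e1 e2
      by (subst sum.swap) (simp add: mult_ac diff_diff_eq add.commute add.left_commute algebra_simps)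
  qed
  show "a * b * c = a * (b * c)"
    using left_comm comm by metis
  show "(a + b) * c = a * c + b * c"
  proof (rule series_eqI)
    fix x
    define A where "A = {y. y \<le> x - lc \<and> nth a y \<noteq> 0} \<union> {y. y \<le> x - lc \<and> nth b y \<noteq> 0}"
    have "finite A" unfolding A_def by (simp add: nth_finite)
    have "nth ((a + b) * c) x = (\<Sum>y\<in>A. nth (a + b) y * nth c (x - y))"
      "nth (a * c) x = (\<Sum>y\<in>A. nth a y * nth c (x - y))"
      "nth (b * c) x = (\<Sum>y\<in>A. nth b y * nth c (x - y))"
      by (rule nth_times_eq[OF \<open>finite A\<close>]; use lc in \<open>fastforce simp: A_def plus_series.rep_eq\<close>)+
    then show "nth ((a + b) * c) x = nth (a * c + b * c) x"
      by (simp add: plus_series.rep_eq sum.distrib distrib_right)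
  qed
qed

end

section \<open>The field of series\<close>

text \<open>This is the monomial with coefficient \<open>c\<close> and exponent \<open>a\<close>; an
  exponent outside \<open>exps\<close> yields 0, which keeps the function total.\<close>

lift_definition single_series :: "real \<Rightarrow> complex \<Rightarrow> series" is
  "\<lambda>a c x. if x = a \<and> a \<in> exps then c else 0"
  by (auto simp: left_finite_def)

instantiation series :: comm_ring_1
begin

definition one_series :: series where "1 = single_series 0 1"

lemma nth_one: "nth 1 x = (if x = 0 then 1 else 0)"
  by (simp add: one_series_def single_series.rep_eq)

instance
proof
  fix a :: series
  show "1 * a = a"
  proof (rule series_eqI)
    fix x show "nth (1 * a) x = nth a x"
      by (subst nth_times_eq[of "{0}"]) (auto simp: nth_one split: if_splits)
  qed
  have "nth 0 0 \<noteq> nth 1 0" by (simp add: nth_one zero_series.rep_eq)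
  then show "(0::series) \<noteq> 1" by metis
qed

end

lemmas nth_simps [simp] = zero_series.rep_eq plus_series.rep_eq uminus_series.rep_eq nth_one

lemma nth_minus [simp]: "nth (f - g) x = nth f x - nth g x"
  unfolding minus_series_def plus_series.rep_eq uminus_series.rep_eq by simp

lemma nth_sum [simp]: "nth (sum f A) x = (\<Sum>i\<in>A. nth (f i) x)"
  by (induction A rule: infinite_finite_induct) auto

lemma nth_single [simp]: "a \<in> exps \<Longrightarrow> nth (single_series a c) x = (if x = a then c else 0)"
  by (simp add: single_series.rep_eq)

lemma nth_single_times [simp]:
  assumes "a \<in> exps"
  shows "nth (single_series a c * f) x = c * nth f (x - a)"
  by (subst nth_times_eq[of "{a}"]) (use assms in \<open>auto split: if_splits\<close>)

lemma single_mult: "a \<in> exps \<Longrightarrow> b \<in> exps \<Longrightarrow> single_series a c * single_series b d = single_series (a + b) (c * d)"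
  by (rule series_eqI) (auto simp: exps_add)

lemma series_nonzeroE: "f \<noteq> 0 \<Longrightarrow> \<exists>x. nth f x \<noteq> 0"
  using series_eqI[of f 0] by auto

section \<open>The valuation: least exponent of a nonzero series\<close>

definition val :: "series \<Rightarrow> real" where
  "val f = Inf {x. nth f x \<noteq> 0}"

lemma val_props:
  assumes "f \<noteq> 0"
  shows "nth f (val f) \<noteq> 0" "\<And>x. nth f x \<noteq> 0 \<Longrightarrow> val f \<le> x"
proof -
  obtain b where b: "nth f b \<noteq> 0" using series_nonzeroE[OF assms] by blast
  define m where "m = Min {x. x \<le> b \<and> nth f x \<noteq> 0}"
  have "m \<in> {x. x \<le> b \<and> nth f x \<noteq> 0}" unfolding m_def using b nth_finite by (intro Min_in) auto
  moreover have le: "m \<le> x" if "nth f x \<noteq> 0" for x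
  proof (cases "x \<le> b")
    case True then show ?thesis unfolding m_def using that nth_finite by (intro Min_le) auto
  next
    case False then show ?thesis using \<open>m \<in> _\<close> by simp
  qed
  ultimately have "val f = m" unfolding val_def by (intro cInf_eq_minimum) auto
  then show "nth f (val f) \<noteq> 0" "\<And>x. nth f x \<noteq> 0 \<Longrightarrow> val f \<le> x" using \<open>m \<in> _\<close> le by auto
qed

lemma nth_below_val: "f \<noteq> 0 \<Longrightarrow> x < val f \<Longrightarrow> nth f x = 0"
  using val_props(2)[of f x] by force

lemma val_exps: "f \<noteq> 0 \<Longrightarrow> val f \<in> exps"
  using val_props(1) nth_exps by blast

lemma val_eqI: "nth f a \<noteq> 0 \<Longrightarrow> (\<And>x. x < a \<Longrightarrow> nth f x = 0) \<Longrightarrow> val f = a"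
proof -
  assume a: "nth f a \<noteq> 0" and b: "\<And>x. x < a \<Longrightarrow> nth f x = 0"
  then have "f \<noteq> 0" by auto
  from val_props[OF this] have "val f \<le> a" "\<not> val f < a" using a b by blast+
  then show ?thesis by simp
qed

lemma nth_times_val:
  assumes "f \<noteq> 0" "g \<noteq> 0"
  shows "nth (f * g) (val f + val g) = nth f (val f) * nth g (val g)"
proof (subst nth_times_eq[of "{val f}"])
  fix y assume "nth f y \<noteq> 0" "nth g (val f + val g - y) \<noteq> 0"
  then have "val f \<le> y" "val g \<le> val f + val g - y" using val_props assms by auto
  then show "y \<in> {val f}" by auto
qed auto

lemma nth_times_below:
  assumes "f \<noteq> 0" "g \<noteq> 0" "x < val f + val g"
  shows "nth (f * g) x = 0"
proof (rule ccontr)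
  assume "nth (f * g) x \<noteq> 0"
  then obtain y where "nth f y \<noteq> 0" "nth g (x - y) \<noteq> 0" using nth_times_nonzero by blast
  then have "val f \<le> y" "val g \<le> x - y" using val_props assms by auto
  then show False using assms by linarith
qed

lemma val_mult: "f \<noteq> 0 \<Longrightarrow> g \<noteq> 0 \<Longrightarrow> val (f * g) = val f + val g"
  by (rule val_eqI) (auto simp: nth_times_val val_props nth_times_below)

lemma val_single [simp]: "a \<in> exps \<Longrightarrow> c \<noteq> 0 \<Longrightarrow> val (single_series a c) = a"
  by (rule val_eqI) auto

text \<open>
  Series are constructed by recursion along the exponents: a value at \<open>x\<close> may depend on the values up
  to \<open>x - \<epsilon>\<close>, and a left-finite support is enforced by requiring that new exponents are sums of
  old ones.
\<close>

lemma series_recursion: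
  fixes \<epsilon> :: real and \<Phi> :: "(real \<Rightarrow> 'b) \<Rightarrow> real \<Rightarrow> 'b" and z :: 'b
  assumes \<epsilon>: "\<epsilon> > 0"
    and loc: "\<And>u w x. (\<And>y. y \<le> x - \<epsilon> \<Longrightarrow> u y = w y) \<Longrightarrow> \<Phi> u x = \<Phi> w x"
    and neg: "\<And>u x. x < 0 \<Longrightarrow> \<Phi> u x = z"
    and supp: "\<And>u x. \<Phi> u x \<noteq> z \<Longrightarrow> x \<in> S \<or> (\<exists>y v. \<epsilon> \<le> y \<and> \<epsilon> \<le> v \<and> x = y + v \<and> (y \<in> S \<or> u y \<noteq> z) \<and> (v \<in> S \<or> u v \<noteq> z))"
    and S: "S \<subseteq> exps" "\<And>b. finite {x \<in> S. x \<le> b}" "\<And>x. x \<in> S \<Longrightarrow> 0 \<le> x"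
  shows "\<exists>u. (\<forall>x. u x = \<Phi> u x) \<and> (\<forall>x. u x \<noteq> z \<longrightarrow> x \<in> exps) \<and> (\<forall>b. finite {x. x \<le> b \<and> u x \<noteq> z})"
proof -
  \<comment> \<open>One step back loses at least \<epsilon>, so the floor of x/\<epsilon> drops by
    at least 1; negative arguments have no predecessors and are the base cases.\<close>
  define R where "R = {(y, x). 0 \<le> x \<and> y \<le> x - \<epsilon>}"
  have "wf R"
  proof (rule wf_subset[OF wf_measure])
    show "R \<subseteq> measure (\<lambda>x. nat (\<lfloor>x / \<epsilon>\<rfloor> + 1))"
    proof
      fix p assume "p \<in> R"
      then obtain y x where p: "p = (y, x)" and x: "0 \<le> x" "y \<le> x - \<epsilon>" unfolding R_def by auto
      have "y / \<epsilon> \<le> (x - \<epsilon>) / \<epsilon>" using x(2) \<epsilon> by (intro divide_right_mono) auto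
      also have "\<dots> = x / \<epsilon> - 1" using \<epsilon> by (simp add: field_simps)
      finally have "\<lfloor>y / \<epsilon>\<rfloor> \<le> \<lfloor>x / \<epsilon>\<rfloor> - 1"
        using floor_mono floor_diff_one by metis
      moreover have "\<lfloor>x / \<epsilon>\<rfloor> \<ge> 0" using x \<epsilon> by simp
      ultimately show "p \<in> measure (\<lambda>x. nat (\<lfloor>x / \<epsilon>\<rfloor> + 1))" using p by auto
    qed
  qed
  then have "\<exists>u. \<forall>x. u x = (if x < 0 then z else \<Phi> u x)"
  proof (rule dependent_wf_choice[of R "\<lambda>u x r. r = (if x < 0 then z else \<Phi> u x)"])
    fix f g :: "real \<Rightarrow> 'b" and x r
    assume "\<And>y. (y, x) \<in> R \<Longrightarrow> f y = g y"
    then show "(r = (if x < 0 then z else \<Phi> f x)) = (r = (if x < 0 then z else \<Phi> g x))"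
      using loc[of x f g] unfolding R_def by auto
  qed auto
  then obtain u where "\<And>x. u x = (if x < 0 then z else \<Phi> u x)" by blast
  then have u: "u x = \<Phi> u x" for x using neg[of x u] by (metis (full_types))
  have un: "x \<ge> 0" if "u x \<noteq> z" for x using that u[of x] neg[of x u] by force
  \<comment> \<open>The support is controlled in bands of width \<epsilon>. An exponent below (n +
    1)\<epsilon> outside \<open>S\<close> is a sum of two exponents, each at least \<epsilon> and
    hence each below n\<epsilon>, so band \<open>Suc n\<close> is covered by part of
    \<open>S\<close> and by sums from band \<open>n\<close>.\<close>
  define F where "F n = {x. x < real n * \<epsilon> \<and> (x \<in> S \<or> u x \<noteq> z)}" for n
  have "finite (F n) \<and> F n \<subseteq> exps" for n
  proof (induction n)
    case 0
    have "F 0 = {}" using un S(3) unfolding F_def by fastforce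
    then show ?case by simp
  next
    case (Suc n)
    have "F (Suc n) \<subseteq> {x \<in> S. x \<le> real (Suc n) * \<epsilon>} \<union> (\<lambda>(y, v). y + v) ` (F n \<times> F n)"
    proof
      fix x assume x: "x \<in> F (Suc n)"
      show "x \<in> {x \<in> S. x \<le> real (Suc n) * \<epsilon>} \<union> (\<lambda>(y, v). y + v) ` (F n \<times> F n)"
      proof (cases "x \<in> S")
        case True
        then show ?thesis using x unfolding F_def by auto
      next
        case False
        then have "\<Phi> u x \<noteq> z" using x u[of x] unfolding F_def by auto
        then obtain y v where yv: "\<epsilon> \<le> y" "\<epsilon> \<le> v" "x = y + v" "y \<in> S \<or> u y \<noteq> z" "v \<in> S \<or> u v \<noteq> z"
          using supp False by blast
        have "y < real n * \<epsilon>" "v < real n * \<epsilon>" using yv x unfolding F_def by (auto simp: distrib_right)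
        then have "(y, v) \<in> F n \<times> F n" using yv unfolding F_def by auto
        then show ?thesis using yv(3) by force
      qed
    qed
    moreover have "finite ({x \<in> S. x \<le> real (Suc n) * \<epsilon>} \<union> (\<lambda>(y, v). y + v) ` (F n \<times> F n))"
      using Suc S(2) by auto
    moreover have "{x \<in> S. x \<le> real (Suc n) * \<epsilon>} \<union> (\<lambda>(y, v). y + v) ` (F n \<times> F n) \<subseteq> exps"
      using Suc S(1) by (auto intro: exps_add)
    ultimately show ?case by (meson finite_subset subset_trans)
  qed
  note Fn = this
  have ex: "\<exists>n. {x. x \<le> b \<and> u x \<noteq> z} \<subseteq> F n" for b
  proof -
    obtain n :: nat where "b < real n * \<epsilon>" using \<epsilon> by (meson reals_Archimedean3)
    then show ?thesis unfolding F_def by (intro exI[of _ n]) auto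
  qed
  have "finite {x. x \<le> b \<and> u x \<noteq> z}" for b using ex[of b] Fn finite_subset by blast
  moreover have "x \<in> exps" if "u x \<noteq> z" for x using ex[of x] Fn that by blast
  ultimately show ?thesis using u by blast
qed

lemma finite_positive_gap:
  assumes "\<And>b::real. finite {x. x \<le> b \<and> P x}" "\<And>x. P x \<Longrightarrow> 0 < x"
  shows "\<exists>\<epsilon>>0. \<forall>x. P x \<longrightarrow> \<epsilon> \<le> x"
proof -
  define m where "m = Min (insert 1 {x. x \<le> 1 \<and> P x})"
  have fin: "finite (insert 1 {x. x \<le> 1 \<and> P x})" using assms(1) by simp
  have "m \<in> insert 1 {x. x \<le> 1 \<and> P x}" unfolding m_def using fin by (intro Min_in) auto
  then have "m > 0" using assms(2) by auto
  moreover have "m \<le> x" if "P x" for x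
  proof (cases "x \<le> 1")
    case True then show ?thesis unfolding m_def using fin that by (intro Min_le) auto
  next
    case False
    have "m \<le> 1" unfolding m_def using fin by (intro Min_le) auto
    then show ?thesis using False by simp
  qed
  ultimately show ?thesis by blast
qed

text \<open>The geometric series: the inverse is 1 + h where h = u + u h. Since the support of
  \<open>u\<close> starts at some positive \<epsilon>, the coefficient of h at x involves only
  coefficients up to x - \<epsilon>, and \<open>series_recursion\<close> solves the
  equation.\<close>

lemma one_minus_invertible:
  assumes "\<And>x. nth u x \<noteq> 0 \<Longrightarrow> x > 0"
  shows "\<exists>g. (1 - u) * g = 1"
proof -
  obtain \<epsilon> where \<epsilon>: "\<epsilon> > 0" "\<And>x. nth u x \<noteq> 0 \<Longrightarrow> \<epsilon> \<le> x"
    using finite_positive_gap[of "\<lambda>x. nth u x \<noteq> 0"] assms nth_finite by blast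
  define \<Phi> where "\<Phi> h x = nth u x + (\<Sum>y | \<epsilon> \<le> y \<and> y \<le> x - \<epsilon> \<and> nth u y \<noteq> 0. nth u y * h (x - y))" for h x
  have fin: "finite {y. \<epsilon> \<le> y \<and> y \<le> x - \<epsilon> \<and> nth u y \<noteq> 0}" for x
    by (rule finite_subset[OF _ nth_finite[of "x - \<epsilon>" u]]) auto
  have "\<exists>h. (\<forall>x. h x = \<Phi> h x) \<and> (\<forall>x. h x \<noteq> 0 \<longrightarrow> x \<in> exps) \<and> (\<forall>b. finite {x. x \<le> b \<and> h x \<noteq> 0})"
  proof (rule series_recursion[OF \<epsilon>(1), where S = "{x. nth u x \<noteq> 0}"])
    fix f g :: "real \<Rightarrow> complex" and x assume "\<And>y. y \<le> x - \<epsilon> \<Longrightarrow> f y = g y"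
    then show "\<Phi> f x = \<Phi> g x" unfolding \<Phi>_def by (intro arg_cong2[of _ _ _ _ "(+)"] refl sum.cong) auto
  next
    fix h :: "real \<Rightarrow> complex" and x :: real assume "x < 0"
    then have e: "nth u x = 0" "{y. \<epsilon> \<le> y \<and> y \<le> x - \<epsilon> \<and> nth u y \<noteq> 0} = {}" using \<epsilon>(1) assms[of x] by force+
    show "\<Phi> h x = 0" unfolding \<Phi>_def e by simp
  next
    fix h :: "real \<Rightarrow> complex" and x :: real assume nz: "\<Phi> h x \<noteq> 0"
    show "x \<in> {x. nth u x \<noteq> 0} \<or> (\<exists>y v. \<epsilon> \<le> y \<and> \<epsilon> \<le> v \<and> x = y + v \<and> (y \<in> {x. nth u x \<noteq> 0} \<or> h y \<noteq> 0) \<and> (v \<in> {x. nth u x \<noteq> 0} \<or> h v \<noteq> 0))"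
    proof (cases "nth u x = 0")
      case True
      then have "(\<Sum>y | \<epsilon> \<le> y \<and> y \<le> x - \<epsilon> \<and> nth u y \<noteq> 0. nth u y * h (x - y)) \<noteq> 0" using nz unfolding \<Phi>_def by simp
      then obtain y where "\<epsilon> \<le> y" "y \<le> x - \<epsilon>" "nth u y \<noteq> 0" "h (x - y) \<noteq> 0"
        by (metis (no_types, lifting) mem_Collect_eq mult_eq_0_iff sum.not_neutral_contains_not_neutral)
      then show ?thesis by (intro disjI2 exI[of _ y] exI[of _ "x - y"]) auto
    qed auto
  next
    show "{x. nth u x \<noteq> 0} \<subseteq> exps" using nth_exps by auto
    show "finite {x \<in> {x. nth u x \<noteq> 0}. x \<le> b}" for b
      using nth_finite[of b u] by (simp add: conj_commute)
    show "0 \<le> x" if "x \<in> {x. nth u x \<noteq> 0}" for x using that assms by (simp add: less_imp_le)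
  qed
  then obtain h where h: "\<And>x. h x = \<Phi> h x" and "left_finite h" unfolding left_finite_def by blast
  define H where "H = Abs_series h"
  have nH: "nth H = h" unfolding H_def using \<open>left_finite h\<close> by (simp add: Abs_series_inverse)
  have hpos: "\<epsilon> \<le> x" if "h x \<noteq> 0" for x
  proof (rule ccontr)
    assume "\<not> \<epsilon> \<le> x"
    then have "nth u x = 0" "{y. \<epsilon> \<le> y \<and> y \<le> x - \<epsilon> \<and> nth u y \<noteq> 0} = {}" using \<epsilon> by fastforce+
    then have "\<Phi> h x = 0" unfolding \<Phi>_def by simp
    then show False using that h[of x] by simp
  qed
  have "H = u + u * H"
  proof (rule series_eqI)
    fix x
    have "nth (u * H) x = (\<Sum>y | \<epsilon> \<le> y \<and> y \<le> x - \<epsilon> \<and> nth u y \<noteq> 0. nth u y * h (x - y))"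
      unfolding nH[symmetric] by (rule nth_times_eq[OF fin]) (use \<epsilon> hpos nH in force)
    then show "nth H x = nth (u + u * H) x" using h[of x] unfolding \<Phi>_def by (simp add: nH)
  qed
  then have "(1 - u) * (1 + H) = 1" by (simp add: algebra_simps)
  then show ?thesis by blast
qed

lemma series_invertible:
  assumes "(f::series) \<noteq> 0"
  shows "\<exists>g. f * g = 1"
proof -
  define a c where "a = val f" and "c = nth f a"
  have c: "c \<noteq> 0" and a: "a \<in> exps" "-a \<in> exps" using val_props[OF assms] val_exps[OF assms] by (auto simp: a_def c_def)
  \<comment> \<open>Dividing \<open>f\<close> by its leading term leaves 1 - u, where all exponents
    of \<open>u\<close> are positive.\<close>
  define u where "u = 1 - single_series (-a) (1/c) * f"
  have "nth u x \<noteq> 0 \<Longrightarrow> x > 0" for x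
    using a c nth_below_val[OF assms, of "x + a"] unfolding u_def
    by (cases "x = 0"; cases "x < 0") (auto simp: c_def a_def)
  then obtain g where "(1 - u) * g = 1" using one_minus_invertible by blast
  then have "f * (single_series (-a) (1/c) * g) = 1" unfolding u_def by (simp add: mult_ac)
  then show ?thesis by blast
qed

instantiation series :: field
begin

definition inverse_series :: "series \<Rightarrow> series" where
  "inverse_series f = (if f = 0 then 0 else (SOME g. f * g = 1))"

definition divide_series :: "series \<Rightarrow> series \<Rightarrow> series" where
  "divide_series f g = f * inverse g"

instance
proof
  fix a b :: series
  show "a \<noteq> 0 \<Longrightarrow> inverse a * a = 1"
    using someI_ex[OF series_invertible[of a]] by (simp add: inverse_series_def mult.commute)
  show "a div b = a * inverse b" by (simp add: divide_series_def)
  show "inverse (0::series) = 0" by (simp add: inverse_series_def)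
qed

end

lemma nth_of_nat [simp]: "nth (of_nat n) x = (if x = 0 then of_nat n else 0)"
  by (induction n) auto

instance series :: field_char_0
proof
  show "inj (of_nat :: nat \<Rightarrow> series)"
  proof (rule injI)
    fix m n :: nat assume "(of_nat m :: series) = of_nat n"
    then have "nth (of_nat m) 0 = nth (of_nat n) 0" by simp
    then have "(of_nat m :: complex) = of_nat n" unfolding nth_of_nat by simp
    then show "m = n" by (rule of_nat_eq_iff[THEN iffD1])
  qed
qed

section \<open>Hensel's lemma and polynomials of odd degree\<close>

text \<open>A polynomial over series is read as a series of complex polynomials; this is its
  coefficient at exponent \<open>x\<close>. The slice at 0 of a polynomial with integral
  coefficients is its reduction to the residue field.\<close>

definition slice :: "real \<Rightarrow> series poly \<Rightarrow> complex poly" where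
  "slice x p = map_poly (\<lambda>a. nth a x) p"

lemma coeff_slice [simp]: "coeff (slice x p) i = nth (coeff p i) x"
  by (simp add: slice_def coeff_map_poly)

lemma degree_slice_le: "degree (slice x p) \<le> degree p"
  by (rule degree_le) (auto simp: coeff_eq_0)

lemma slice_eqI: "(\<And>x. slice x p = slice x q) \<Longrightarrow> p = q"
  by (metis coeff_slice poly_eqI series_eqI)

lemma slice_left_finite: "finite {x. x \<le> b \<and> slice x p \<noteq> 0}"
proof (rule finite_subset)
  show "finite (\<Union>i\<le>degree p. {x. x \<le> b \<and> nth (coeff p i) x \<noteq> 0})" using nth_finite by auto
  show "{x. x \<le> b \<and> slice x p \<noteq> 0} \<subseteq> (\<Union>i\<le>degree p. {x. x \<le> b \<and> nth (coeff p i) x \<noteq> 0})"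
  proof
    fix x assume x: "x \<in> {x. x \<le> b \<and> slice x p \<noteq> 0}"
    then obtain i where "coeff (slice x p) i \<noteq> 0" by (metis (mono_tags) leading_coeff_0_iff mem_Collect_eq)
    moreover from this have "i \<le> degree p" by (metis coeff_eq_0 coeff_slice le_degree nth_simps(1))
    ultimately show "x \<in> (\<Union>i\<le>degree p. {x. x \<le> b \<and> nth (coeff p i) x \<noteq> 0})" using x by auto
  qed
qed

lemma slice_exps: "slice x p \<noteq> 0 \<Longrightarrow> x \<in> exps"
  by (metis coeff_slice leading_coeff_0_iff nth_exps)

lemma slice_mult:
  assumes D: "finite D" "\<And>y. slice y p \<noteq> 0 \<Longrightarrow> slice (x - y) q \<noteq> 0 \<Longrightarrow> y \<in> D"
  shows "slice x (p * q) = (\<Sum>y\<in>D. slice y p * slice (x - y) q)"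
proof (rule poly_eqI)
  fix i
  have "nth (coeff p j * coeff q l) x = (\<Sum>y\<in>D. nth (coeff p j) y * nth (coeff q l) (x - y))" for j l
  proof (rule nth_times_eq[OF D(1)])
    fix y assume "nth (coeff p j) y \<noteq> 0" "nth (coeff q l) (x - y) \<noteq> 0"
    then have "coeff (slice y p) j \<noteq> 0" "coeff (slice (x - y) q) l \<noteq> 0" by simp_all
    then show "y \<in> D" using D(2)[of y] by fastforce
  qed
  then have "coeff (slice x (p * q)) i = (\<Sum>j\<le>i. \<Sum>y\<in>D. nth (coeff p j) y * nth (coeff q (i - j)) (x - y))"
    by (simp add: coeff_mult)
  also have "\<dots> = coeff (\<Sum>y\<in>D. slice y p * slice (x - y) q) i"
    by (subst sum.swap) (simp add: coeff_sum coeff_mult)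
  finally show "coeff (slice x (p * q)) i = coeff (\<Sum>y\<in>D. slice y p * slice (x - y) q) i" .
qed

lemma slices_exist:
  fixes G :: "real \<Rightarrow> complex poly"
  assumes "\<And>x. degree (G x) \<le> N" "\<And>x. G x \<noteq> 0 \<Longrightarrow> x \<in> exps" "\<And>b. finite {x. x \<le> b \<and> G x \<noteq> 0}"
  shows "\<exists>g. degree g \<le> N \<and> (\<forall>x. slice x g = G x)"
proof -
  define a where "a i = Abs_series (\<lambda>x. coeff (G x) i)" for i
  have "left_finite (\<lambda>x. coeff (G x) i)" for i
  proof -
    have "finite {x. x \<le> b \<and> coeff (G x) i \<noteq> 0}" for b
      by (rule finite_subset[OF _ assms(3)[of b]]) auto
    then show ?thesis using assms(2) unfolding left_finite_def by (metis coeff_0)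
  qed
  then have a: "nth (a i) x = coeff (G x) i" for i x unfolding a_def by (simp add: Abs_series_inverse)
  define g where "g = (\<Sum>i\<le>N. monom (a i) i)"
  have cg: "coeff g i = (if i \<le> N then a i else 0)" for i
    unfolding g_def by (simp add: coeff_sum)
  have "degree g \<le> N" by (rule degree_le) (simp add: cg)
  moreover have "slice x g = G x" for x
  proof (rule poly_eqI)
    fix i show "coeff (slice x g) i = coeff (G x) i"
      using assms(1)[of x] by (auto simp: cg a coeff_eq_0)
  qed
  ultimately show ?thesis by blast
qed

text \<open>Multiply the Bezout identity by \<open>c\<close> and reduce the cofactor of
  \<open>h\<close> modulo \<open>g\<close>. The degree bound on \<open>b\<close> then follows from g
  b = c - h a, whose right side has degree at most \<open>n\<close>.\<close>

lemma polynomial_diophantine: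
  fixes g h u v c :: "'a::field poly"
  assumes uv: "u * g + v * h = 1" and g: "g \<noteq> 0" and deg: "degree g \<le> n" "degree h \<le> n - degree g" "degree c \<le> n"
  shows "\<exists>a b. g * b + h * a = c \<and> (a = 0 \<or> degree a < degree g) \<and> degree b \<le> n - degree g"
proof -
  define a b where "a = (c * v) mod g" and "b = (c - h * a) div g"
  have "c - h * a = c * (u * g + v * h) - h * a" using uv by simp
  also have "\<dots> = g * (c * u) + h * (c * v - a)" by (simp add: algebra_simps)
  also have "c * v - a = g * ((c * v) div g)" unfolding a_def by (simp add: minus_mod_eq_mult_div)
  also have "g * (c * u) + h * (g * (c * v div g)) = g * (c * u + h * (c * v div g))" by (simp add: algebra_simps)
  finally have gb: "g * b = c - h * a" unfolding b_def by (simp add: g)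
  have a: "a = 0 \<or> degree a < degree g" unfolding a_def using degree_mod_less[OF g] by blast
  have "degree (h * a) \<le> n"
    using a deg degree_mult_le[of h a] by (cases "a = 0") auto
  then have "degree (c - h * a) \<le> n" using deg by (intro degree_diff_le) auto
  then have "degree b \<le> n - degree g"
    using g by (cases "b = 0") (auto simp: gb[symmetric] degree_mult_eq)
  then show ?thesis using a gb by (intro exI[of _ a] exI[of _ b]) simp
qed

text \<open>The factors are lifted one exponent at a time: at x > 0 the corrections to
  \<open>g0\<close> and \<open>h0\<close> solve a linear equation whose right side is the slice of
  \<open>f\<close> minus the products of earlier corrections. Only \<open>g0\<close> keeps its
  degree exactly; \<open>h0\<close> is merely bounded, since the leading coefficient of
  \<open>f\<close> may vanish in the residue field.\<close>

lemma hensel: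
  fixes f :: "series poly"
  assumes fn: "degree f \<le> n" and f_neg: "\<And>x. x < 0 \<Longrightarrow> slice x f = 0" and f0: "slice 0 f = g0 * h0"
    and uv: "u * g0 + v * h0 = 1" and g0: "g0 \<noteq> 0"
    and deg: "degree g0 \<le> n" "degree h0 \<le> n - degree g0"
  shows "\<exists>g h. f = g * h \<and> degree g = degree g0 \<and> degree h \<le> n - degree g0"
proof -
  define k where "k = degree g0"
  \<comment> \<open>A solution of g0 b + h0 a = c, stored as (a, b). Fixing the value (0, 0) at
    \<open>c = 0\<close> matters: a correction can then be nonzero only where the right side is, as
    the support condition of the recursion demands.\<close>
  define sol where "sol c = (if c = 0 then (0, 0) else
    SOME (a, b). g0 * b + h0 * a = c \<and> (a = 0 \<or> degree a < k) \<and> degree b \<le> n - k)" for c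
  have sol: "g0 * snd (sol c) + h0 * fst (sol c) = c \<and> (fst (sol c) = 0 \<or> degree (fst (sol c)) < k) \<and> degree (snd (sol c)) \<le> n - k"
    if "degree c \<le> n" for c
  proof (cases "c = 0")
    case False
    then show ?thesis
      using someI_ex[of "\<lambda>p. case p of (a, b) \<Rightarrow> g0 * b + h0 * a = c \<and> (a = 0 \<or> degree a < k) \<and> degree b \<le> n - k"]
        polynomial_diophantine[OF uv g0 deg that] unfolding sol_def k_def by (auto split: prod.splits)
  qed (simp add: sol_def)
  have sol0: "sol 0 = (0, 0)" by (simp add: sol_def)
  define S where "S = {x. 0 < x \<and> slice x f \<noteq> 0}"
  have S_fin: "finite {x. x \<le> b \<and> x \<in> S}" for b
    by (rule finite_subset[OF _ slice_left_finite[of b f]]) (auto simp: S_def)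
  have S_pos: "x \<in> S \<Longrightarrow> 0 < x" for x by (simp add: S_def)
  obtain \<epsilon> where \<epsilon>: "\<epsilon> > 0" "\<And>x. x \<in> S \<Longrightarrow> \<epsilon> \<le> x"
    using finite_positive_gap[of "\<lambda>x. x \<in> S", OF S_fin S_pos] by blast
  define D where "D w x = {y. \<epsilon> \<le> y \<and> y \<le> x - \<epsilon> \<and> w y \<noteq> (0, 0)}" for w :: "real \<Rightarrow> complex poly \<times> complex poly" and x
  define rhs where "rhs w x = slice x f - (\<Sum>y\<in>D w x. fst (w y) * snd (w (x - y)))" for w x
  define \<Phi> where "\<Phi> w x = (if x \<le> 0 then (0, 0) else sol (rhs w x))" for w x
  have small: "\<Phi> w x = (0, 0)" if "x < \<epsilon>" for w x
  proof (cases "x \<le> 0")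
    case False
    then have "slice x f = 0" using \<epsilon>(2)[of x] that unfolding S_def by auto
    moreover have "D w x = {}" using that \<epsilon>(1) unfolding D_def by auto
    ultimately show ?thesis using False unfolding \<Phi>_def rhs_def by (simp add: sol0)
  qed (simp add: \<Phi>_def)
  have "\<exists>w. (\<forall>x. w x = \<Phi> w x) \<and> (\<forall>x. w x \<noteq> (0, 0) \<longrightarrow> x \<in> exps) \<and> (\<forall>b. finite {x. x \<le> b \<and> w x \<noteq> (0, 0)})"
  proof (rule series_recursion[OF \<epsilon>(1), where S = S])
    fix w w' :: "real \<Rightarrow> complex poly \<times> complex poly" and x
    assume e: "\<And>y. y \<le> x - \<epsilon> \<Longrightarrow> w y = w' y"
    have "D w x = D w' x" using e unfolding D_def by auto
    moreover have "fst (w y) * snd (w (x - y)) = fst (w' y) * snd (w' (x - y))" if "y \<in> D w' x" for y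
      using that e[of y] e[of "x - y"] unfolding D_def by auto
    ultimately have "rhs w x = rhs w' x" unfolding rhs_def by simp
    then show "\<Phi> w x = \<Phi> w' x" unfolding \<Phi>_def by simp
  next
    fix w :: "real \<Rightarrow> complex poly \<times> complex poly" and x :: real
    show "x < 0 \<Longrightarrow> \<Phi> w x = (0, 0)" by (simp add: \<Phi>_def)
    assume nz: "\<Phi> w x \<noteq> (0, 0)"
    then have x: "x > 0" "rhs w x \<noteq> 0" using sol0 unfolding \<Phi>_def by (auto split: if_splits)
    show "x \<in> S \<or> (\<exists>y v. \<epsilon> \<le> y \<and> \<epsilon> \<le> v \<and> x = y + v \<and> (y \<in> S \<or> w y \<noteq> (0, 0)) \<and> (v \<in> S \<or> w v \<noteq> (0, 0)))"
    proof (cases "x \<in> S")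
      case False
      then have "(\<Sum>y\<in>D w x. fst (w y) * snd (w (x - y))) \<noteq> 0" using x unfolding rhs_def S_def by auto
      then obtain y where y: "y \<in> D w x" "fst (w y) * snd (w (x - y)) \<noteq> 0"
        by (meson sum.not_neutral_contains_not_neutral)
      then have "w (x - y) \<noteq> (0, 0)" by auto
      then show ?thesis using y(1) unfolding D_def by (intro disjI2 exI[of _ y] exI[of _ "x - y"]) auto
    qed auto
  next
    show "S \<subseteq> exps" using slice_exps unfolding S_def by auto
    show "finite {x \<in> S. x \<le> b}" for b using S_fin[of b] by (simp add: conj_commute)
    show "0 \<le> x" if "x \<in> S" for x using that unfolding S_def by auto
  qed
  then obtain w where w: "\<And>x. w x = \<Phi> w x" and w_exps: "\<And>x. w x \<noteq> (0, 0) \<Longrightarrow> x \<in> exps"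
    and w_fin: "\<And>b. finite {x. x \<le> b \<and> w x \<noteq> (0, 0)}" by blast
  have w_small: "w x = (0, 0)" if "x < \<epsilon>" for x using w[of x] small[OF that, of w] by simp
  have w_deg: "(fst (w x) = 0 \<or> degree (fst (w x)) < k) \<and> degree (snd (w x)) \<le> n - k
    \<and> (x > 0 \<longrightarrow> g0 * snd (w x) + h0 * fst (w x) = rhs w x)" for x
  proof -
    define N where "N = nat \<lceil>x / \<epsilon>\<rceil>"
    \<comment> \<open>The linear equation at x is solvable within the degree bounds only if its
      right side has degree at most \<open>n\<close>, which depends on the bounds for the earlier
      corrections. Those sit at least \<epsilon> below x, so induction over bands of width
      \<epsilon> proves both together.\<close>
    have P: "\<forall>x. x < real N * \<epsilon> \<longrightarrow> (fst (w x) = 0 \<or> degree (fst (w x)) < k) \<and> degree (snd (w x)) \<le> n - k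
      \<and> (x > 0 \<longrightarrow> g0 * snd (w x) + h0 * fst (w x) = rhs w x)" for N
    proof (induction N)
      case 0
      then show ?case using w_small \<epsilon>(1) by auto
    next
      case (Suc N)
      show ?case
      proof (intro allI impI)
        fix x assume x: "x < real (Suc N) * \<epsilon>"
        show "(fst (w x) = 0 \<or> degree (fst (w x)) < k) \<and> degree (snd (w x)) \<le> n - k
          \<and> (x > 0 \<longrightarrow> g0 * snd (w x) + h0 * fst (w x) = rhs w x)"
        proof (cases "x \<le> 0")
          case True
          then show ?thesis using w_small[of x] \<epsilon>(1) by auto
        next
          case False
          have "degree (rhs w x) \<le> n" unfolding rhs_def
          proof (intro degree_diff_le degree_sum_le)
            show "degree (slice x f) \<le> n" using degree_slice_le[of x f] fn by simp
            show "finite (D w x)" by (rule finite_subset[OF _ w_fin[of "x - \<epsilon>"]]) (auto simp: D_def)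
            fix y assume "y \<in> D w x"
            then have "y < real N * \<epsilon>" "x - y < real N * \<epsilon>" using x unfolding D_def by (auto simp: distrib_right)
            then have a: "fst (w y) = 0 \<or> degree (fst (w y)) < k" and b: "degree (snd (w (x - y))) \<le> n - k"
              using Suc by blast+
            show "degree (fst (w y) * snd (w (x - y))) \<le> n"
            proof (cases "fst (w y) = 0")
              case False
              then have "degree (fst (w y)) + degree (snd (w (x - y))) \<le> n"
                using a b deg(1) unfolding k_def by linarith
              then show ?thesis using degree_mult_le order_trans by blast
            qed simp
          qed
          then show ?thesis using sol[of "rhs w x"] w[of x] False unfolding \<Phi>_def by auto
        qed
      qed
    qed
    obtain N :: nat where "x < real N * \<epsilon>" using \<epsilon>(1) by (meson reals_Archimedean3)
    then show ?thesis using P[of N] by blast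
  qed
  define G H where "G x = (if x = 0 then g0 else fst (w x))" and "H x = (if x = 0 then h0 else snd (w x))" for x
  have "\<exists>g. degree g \<le> k \<and> (\<forall>x. slice x g = G x)"
  proof (rule slices_exist)
    show "degree (G x) \<le> k" for x using w_deg[of x] unfolding G_def k_def by auto
    show "x \<in> exps" if "G x \<noteq> 0" for x
    proof (cases "x = 0")
      case False
      then have "w x \<noteq> (0, 0)" using that by (auto simp: G_def)
      then show ?thesis by (rule w_exps)
    qed simp
    show "finite {x. x \<le> b \<and> G x \<noteq> 0}" for b
      by (rule finite_subset[of _ "insert 0 {x. x \<le> b \<and> w x \<noteq> (0, 0)}"]) (use w_fin in \<open>auto simp: G_def\<close>)
  qed
  then obtain g where g: "degree g \<le> k" "\<And>x. slice x g = G x" by blast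
  have "\<exists>h. degree h \<le> n - k \<and> (\<forall>x. slice x h = H x)"
  proof (rule slices_exist)
    show "degree (H x) \<le> n - k" for x using w_deg[of x] deg unfolding H_def k_def by auto
    show "x \<in> exps" if "H x \<noteq> 0" for x
    proof (cases "x = 0")
      case False
      then have "w x \<noteq> (0, 0)" using that by (auto simp: H_def)
      then show ?thesis by (rule w_exps)
    qed simp
    show "finite {x. x \<le> b \<and> H x \<noteq> 0}" for b
      by (rule finite_subset[of _ "insert 0 {x. x \<le> b \<and> w x \<noteq> (0, 0)}"]) (use w_fin in \<open>auto simp: H_def\<close>)
  qed
  then obtain h where h: "degree h \<le> n - k" "\<And>x. slice x h = H x" by blast
  have GH_small: "G x = 0" "H x = 0" if "x < \<epsilon>" "x \<noteq> 0" for x using that w_small[of x] unfolding G_def H_def by auto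
  have "f = g * h"
  proof (rule slice_eqI)
    fix x
    show "slice x f = slice x (g * h)"
    proof (cases "x \<le> 0")
      case True
      have "slice x (g * h) = (\<Sum>y\<in>(if x = 0 then {0} else {}). slice y g * slice (x - y) h)"
      proof (rule slice_mult)
        fix y assume "slice y g \<noteq> 0" "slice (x - y) h \<noteq> 0"
        then have "y = 0 \<or> y \<ge> \<epsilon>" "x - y = 0 \<or> x - y \<ge> \<epsilon>" using GH_small g(2) h(2) by (metis not_less)+
        then show "y \<in> (if x = 0 then {0} else {})" using True \<epsilon>(1) by auto
      qed auto
      then show ?thesis using True f_neg[of x] f0 g(2) h(2) by (auto simp: G_def H_def)
    next
      case False
      have fin: "finite (D w x)" by (rule finite_subset[OF _ w_fin[of "x - \<epsilon>"]]) (auto simp: D_def)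
      have nD: "0 \<notin> D w x" "x \<notin> D w x" using \<epsilon>(1) unfolding D_def by auto
      \<comment> \<open>The terms at y = 0 and y = x pair a correction with \<open>g0\<close> or
        \<open>h0\<close> and make up the left side of the linear equation; the terms in between are
        exactly those subtracted in \<open>rhs\<close>.\<close>
      have "slice x (g * h) = (\<Sum>y\<in>insert 0 (insert x (D w x)). slice y g * slice (x - y) h)"
      proof (rule slice_mult)
        fix y assume "slice y g \<noteq> 0" "slice (x - y) h \<noteq> 0"
        then have "y = 0 \<or> (y \<ge> \<epsilon> \<and> w y \<noteq> (0,0))" "x - y = 0 \<or> x - y \<ge> \<epsilon>"
          using GH_small g(2) h(2) unfolding G_def by (metis not_less fst_conv)+
        then show "y \<in> insert 0 (insert x (D w x))" unfolding D_def by auto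
      qed (use fin in auto)
      also have "\<dots> = g0 * snd (w x) + fst (w x) * h0 + (\<Sum>y\<in>D w x. slice y g * slice (x - y) h)"
        using False fin nD by (simp add: g(2) h(2) G_def H_def add.assoc)
      also have "(\<Sum>y\<in>D w x. slice y g * slice (x - y) h) = (\<Sum>y\<in>D w x. fst (w y) * snd (w (x - y)))"
        using \<epsilon>(1) by (intro sum.cong refl) (auto simp: g(2) h(2) G_def H_def D_def)
      also have "g0 * snd (w x) + fst (w x) * h0 = rhs w x" using w_deg[of x] False by (simp add: mult.commute)
      finally show ?thesis unfolding rhs_def by simp
    qed
  qed
  moreover have "degree g = k"
  proof (rule antisym[OF g(1)])
    have "coeff (slice 0 g) k \<noteq> 0" using g0 g(2)[of 0] unfolding G_def k_def by simp
    then have "coeff g k \<noteq> 0" by (metis coeff_slice nth_simps(1))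
    then show "k \<le> degree g" by (rule le_degree)
  qed
  ultimately show ?thesis using h(1) unfolding k_def by blast
qed

text \<open>This finds the slope of a Newton polygon by connectedness. The slopes at which the
  minimum is attained on \<open>P\<close> form a closed set, and so do those at which it is attained
  on \<open>E\<close>; both are nonempty and together they cover the line, so they meet, and there
  the two minima agree.\<close>

lemma exists_balanced_slope:
  fixes v :: "nat \<Rightarrow> real"
  assumes fin: "finite E" "finite P" and E: "0 \<in> E" and P: "n \<in> P" and n: "\<And>i. i \<in> E \<Longrightarrow> i < n" and pos: "0 \<notin> P"
  shows "\<exists>\<sigma>. \<exists>i\<in>E. \<exists>j\<in>P. v i + real i * \<sigma> = v j + real j * \<sigma> \<and> (\<forall>l\<in>E \<union> P. v i + real i * \<sigma> \<le> v l + real l * \<sigma>)"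
proof -
  define A where "A = {\<sigma>. \<exists>j\<in>P. \<forall>i\<in>E. v j + real j * \<sigma> \<le> v i + real i * \<sigma>}"
  define B where "B = {\<sigma>. \<exists>i\<in>E. \<forall>j\<in>P. v i + real i * \<sigma> \<le> v j + real j * \<sigma>}"
  have cl: "closed {\<sigma>. v i + real i * \<sigma> \<le> v j + real j * \<sigma>}" for i j
    by (intro closed_Collect_le continuous_intros)
  have "A = (\<Union>j\<in>P. \<Inter>i\<in>E. {\<sigma>. v j + real j * \<sigma> \<le> v i + real i * \<sigma>})" unfolding A_def by auto
  then have "closed A" using cl fin by (auto intro!: closed_UN closed_INT)
  have "B = (\<Union>i\<in>E. \<Inter>j\<in>P. {\<sigma>. v i + real i * \<sigma> \<le> v j + real j * \<sigma>})" unfolding B_def by auto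
  then have "closed B" using cl fin by (auto intro!: closed_UN closed_INT)
  have "A \<union> B = UNIV"
  proof -
    have "\<sigma> \<in> A \<union> B" for \<sigma>
    proof -
      obtain i where i: "i \<in> E" "\<And>l. l \<in> E \<Longrightarrow> v i + real i * \<sigma> \<le> v l + real l * \<sigma>"
        using ex_min_if_finite[of "(\<lambda>l. v l + real l * \<sigma>) ` E"] fin E by (auto simp: not_less; metis not_less)
      obtain j where j: "j \<in> P" "\<And>l. l \<in> P \<Longrightarrow> v j + real j * \<sigma> \<le> v l + real l * \<sigma>"
        using ex_min_if_finite[of "(\<lambda>l. v l + real l * \<sigma>) ` P"] fin P by (auto simp: not_less; metis not_less)
      show ?thesis
      proof (cases "v j + real j * \<sigma> \<le> v i + real i * \<sigma>")
        case True
        then have "\<forall>l\<in>E. v j + real j * \<sigma> \<le> v l + real l * \<sigma>" using i(2) order_trans by blast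
        then have "\<sigma> \<in> A" unfolding A_def using j(1) by blast
        then show ?thesis by simp
      next
        case False
        then have "v i + real i * \<sigma> \<le> v j + real j * \<sigma>" by simp
        then have "\<forall>l\<in>P. v i + real i * \<sigma> \<le> v l + real l * \<sigma>" using j(2) order_trans by blast
        then have "\<sigma> \<in> B" unfolding B_def using i(1) by blast
        then show ?thesis by simp
      qed
    qed
    then show ?thesis by auto
  qed
  moreover have "A \<noteq> {}"
  proof -
    \<comment> \<open>At slope \<open>- s\<close> the index \<open>n\<close>, which exceeds every
      index in \<open>E\<close> by at least 1, gains at least \<open>s\<close>, enough to outweigh
      any difference of the values \<open>v\<close>.\<close>
    define s where "s = (\<Sum>i\<in>E. \<bar>v i - v n\<bar>)"
    have "v n + real n * (- s) \<le> v i + real i * (- s)" if "i \<in> E" for i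
    proof -
      have "\<bar>v i - v n\<bar> \<le> s" unfolding s_def using that fin by (intro member_le_sum) auto
      moreover have "1 * s \<le> (real n - real i) * s" using n[OF that] calculation by (intro mult_right_mono) auto
      ultimately show ?thesis by (simp add: algebra_simps)
    qed
    then have "- s \<in> A" unfolding A_def using P by blast
    then show ?thesis by auto
  qed
  moreover have "B \<noteq> {}"
  proof -
    \<comment> \<open>At slope \<open>s\<close> the index 0 wins against all indices in
      \<open>P\<close>, because these are at least 1.\<close>
    define s where "s = (\<Sum>j\<in>P. \<bar>v j - v 0\<bar>)"
    have "v 0 + real 0 * s \<le> v j + real j * s" if "j \<in> P" for j
    proof -
      have "\<bar>v j - v 0\<bar> \<le> s" unfolding s_def using that fin by (intro member_le_sum) auto
      moreover have "j \<noteq> 0" using that pos by metis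
      moreover have "1 * s \<le> real j * s" using calculation by (intro mult_right_mono) auto
      ultimately show ?thesis by (simp add: algebra_simps)
    qed
    then have "s \<in> B" unfolding B_def using E by blast
    then show ?thesis by auto
  qed
  moreover have "connected (UNIV :: real set)" by (rule connectedI_interval) auto
  ultimately have "A \<inter> B \<noteq> {}"
    using connected_closedD[of UNIV A B] \<open>closed A\<close> \<open>closed B\<close> by auto
  then obtain \<sigma> i j where "i \<in> E" "j \<in> P" and i: "\<And>j. j \<in> P \<Longrightarrow> v i + real i * \<sigma> \<le> v j + real j * \<sigma>"
    and j: "\<And>i. i \<in> E \<Longrightarrow> v j + real j * \<sigma> \<le> v i + real i * \<sigma>" unfolding A_def B_def by blast
  then have "v i + real i * \<sigma> = v j + real j * \<sigma>" by (simp add: antisym)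
  then show ?thesis using \<open>i \<in> E\<close> \<open>j \<in> P\<close> i j by (intro exI[of _ \<sigma>] bexI[of _ i] bexI[of _ j]) auto
qed

lemma bezout_of_remainder:
  fixes h g q :: "'a::field poly"
  assumes "h - [:d:] = g * q" "d \<noteq> 0"
  shows "(- smult (1 / d) q) * g + [:1 / d:] * h = 1"
proof -
  have "h = [:d:] + g * q" using assms(1) by (simp add: diff_eq_eq add.commute)
  then show ?thesis using assms(2) by (simp add: smult_add_right mult.commute)
qed

lemma bezout_power:
  fixes x y :: "'a::comm_ring_1"
  assumes "a * x + b * y = 1"
  shows "\<exists>u v. u * x ^ k + v * y = 1"
proof (induction k)
  case 0
  show ?case by (intro exI[of _ 1] exI[of _ 0]) simp
next
  case (Suc k)
  then obtain u v where "u * x ^ k + v * y = 1" by blast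
  then have "(u * x ^ k + v * y) * (a * x + b * y) = 1" using assms by simp
  then have "(u * a) * x ^ Suc k + (u * x ^ k * b + v * (a * x + b * y)) * y = 1" by (simp add: algebra_simps)
  then show ?case by blast
qed

text \<open>By the binomial theorem only the two top terms reach index \<open>m\<close>. This is the
  computation behind the Tschirnhaus shift that removes the second highest coefficient.\<close>

lemma coeff_pcompose_shift:
  fixes p :: "'a::idom poly"
  assumes "degree p \<le> Suc m"
  shows "coeff (pcompose p [:c, 1:]) m = coeff p m + of_nat (Suc m) * c * coeff p (Suc m)"
  using assms
proof (induction p arbitrary: m)
  case (pCons a p)
  have top: "coeff (pcompose p [:c, 1:]) n = coeff p n" if "degree p \<le> n" for n
  proof (cases "degree p = n")
    case True
    have "lead_coeff (pcompose p [:c, 1:]) = lead_coeff p" by (subst lead_coeff_comp) auto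
    then show ?thesis using True by (simp add: degree_pcompose)
  next
    case False
    then show ?thesis using that by (simp add: coeff_eq_0 degree_pcompose)
  qed
  show ?case
  proof (cases "p = 0")
    case False
    then have d: "degree p \<le> m" using pCons.prems by simp
    show ?thesis
    proof (cases m)
      case 0
      then obtain b where "p = [:b:]" using d degree_eq_zeroE by blast
      then show ?thesis using 0 by (simp add: pcompose_pCons)
    next
      case (Suc k)
      then show ?thesis using pCons.IH[of k] d top[of m]
        by (simp add: pcompose_pCons algebra_simps)
    qed
  qed (auto simp: pcompose_pCons coeff_pCons split: nat.splits)
qed simp

text \<open>
  The slope balances a coefficient of even index against one of odd index. After rescaling, the residue
  polynomial has two nonzero coefficients but none of index \<open>n - 1\<close>, so it is not a constant times
  \<open>(X - c)\<^sup>n\<close>; one of the two Hensel factors has odd degree below \<open>n\<close>.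
\<close>

lemma root_depressed:
  fixes f :: "series poly"
  assumes IH: "\<And>g :: series poly. degree g < degree f \<Longrightarrow> odd (degree g) \<Longrightarrow> \<exists>y. poly g y = 0"
    and n: "degree f = Suc m" "odd (Suc m)" and dep: "coeff f m = 0"
  shows "\<exists>y. poly f y = 0"
proof (cases "coeff f 0 = 0")
  case True
  then show ?thesis by (intro exI[of _ 0]) (simp add: poly_0_coeff_0)
next
  case c0: False
  define n where "n = Suc m"
  have n': "degree f = n" "odd n" using n by (auto simp: n_def)
  define E Od where "E = {i. i \<le> n \<and> even i \<and> coeff f i \<noteq> 0}" and "Od = {i. i \<le> n \<and> odd i \<and> coeff f i \<noteq> 0}"
  have "coeff f n \<noteq> 0" using n' by (metis degree_0 dvd_0_right leading_coeff_0_iff)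
  have "\<exists>\<sigma>. \<exists>i\<in>E. \<exists>j\<in>Od. val (coeff f i) + real i * \<sigma> = val (coeff f j) + real j * \<sigma> \<and>
    (\<forall>l\<in>E \<union> Od. val (coeff f i) + real i * \<sigma> \<le> val (coeff f l) + real l * \<sigma>)"
  proof (rule exists_balanced_slope)
    show "finite E" "finite Od" unfolding E_def Od_def by auto
    show "0 \<in> E" "n \<in> Od" "0 \<notin> Od" using c0 n' \<open>coeff f n \<noteq> 0\<close> unfolding E_def Od_def by auto
    show "i < n" if "i \<in> E" for i using that n' unfolding E_def by (metis (mono_tags, lifting) le_neq_implies_less mem_Collect_eq)
  qed
  then obtain \<sigma> i j where ij: "i \<in> E" "j \<in> Od" and eq: "val (coeff f i) + real i * \<sigma> = val (coeff f j) + real j * \<sigma>"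
    and min: "\<And>l. l \<in> E \<union> Od \<Longrightarrow> val (coeff f i) + real i * \<sigma> \<le> val (coeff f l) + real l * \<sigma>" by blast
  define w where "w = val (coeff f i) + real i * \<sigma>"
  have vexps: "val (coeff f i) \<in> exps" "val (coeff f j) \<in> exps" using ij val_exps unfolding E_def Od_def by auto
  \<comment> \<open>The balance is an equation between exponents in which the slope has an odd
    factor, one index being even and the other odd. Without that parity the rescaling by t^\<sigma>
    could leave the field.\<close>
  have "of_int (int j - int i) * \<sigma> = val (coeff f i) - val (coeff f j)" using eq by (simp add: algebra_simps)
  then have "of_int (int j - int i) * \<sigma> \<in> exps" using vexps by (simp add: exps_diff)
  moreover have "odd (int j - int i)" using ij unfolding E_def Od_def by simp
  ultimately have \<sigma>: "\<sigma> \<in> exps" by (rule exps_odd_divide)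
  have l\<sigma>: "real l * \<sigma> \<in> exps" for l using exps_of_int_mult[OF \<sigma>, of "int l"] by simp
  have w: "w \<in> exps" unfolding w_def by (intro exps_add vexps l\<sigma>)
  define t where "t = single_series \<sigma> 1"
  have tpow: "t ^ l = single_series (real l * \<sigma>) 1" for l
  proof (induction l)
    case 0 show ?case by (simp add: one_series_def)
  next
    case (Suc l)
    then show ?case using \<sigma> l\<sigma> unfolding t_def by (simp add: single_mult algebra_simps)
  qed
  \<comment> \<open>This is f(t^\<sigma> X) divided by t^w. By minimality all its coefficients have
    valuation at least 0, with equality at \<open>i\<close> and \<open>j\<close>.\<close>
  define F where "F = (\<Sum>l\<le>n. monom (single_series (real l * \<sigma> - w) 1 * coeff f l) l)"
  have cF: "coeff F l = (if l \<le> n then single_series (real l * \<sigma> - w) 1 * coeff f l else 0)" for l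
    unfolding F_def by (simp add: coeff_sum)
  have e: "real l * \<sigma> - w \<in> exps" for l by (intro exps_diff l\<sigma> w)
  have poly_F: "poly F y = single_series (-w) 1 * poly f (t * y)" for y
  proof -
    have "poly F y = (\<Sum>l\<le>n. single_series (real l * \<sigma> - w) 1 * coeff f l * y ^ l)"
      unfolding F_def by (simp add: poly_sum poly_monom)
    also have "\<dots> = (\<Sum>l\<le>n. single_series (-w) 1 * (coeff f l * (t * y) ^ l))"
    proof (rule sum.cong[OF refl])
      fix l
      have "single_series (real l * \<sigma> - w) 1 = single_series (-w) 1 * t ^ l"
        unfolding tpow using w l\<sigma> by (simp add: single_mult)
      then show "single_series (real l * \<sigma> - w) 1 * coeff f l * y ^ l = single_series (-w) 1 * (coeff f l * (t * y) ^ l)"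
        by (simp add: power_mult_distrib mult_ac)
    qed
    finally show ?thesis unfolding poly_altdef n'(1) sum_distrib_left .
  qed
  have nthF: "nth (coeff F l) x = (if l \<le> n then nth (coeff f l) (x - (real l * \<sigma> - w)) else 0)" for l x
    using e by (simp add: cF)
  have Fdeg: "degree F = n"
  proof (rule antisym)
    show "degree F \<le> n" by (rule degree_le) (simp add: cF)
    have "single_series (real n * \<sigma> - w) 1 \<noteq> 0" using nth_single[OF e, of n 1] by (metis nth_simps(1) one_neq_zero)
    then have "coeff F n \<noteq> 0" using \<open>coeff f n \<noteq> 0\<close> by (simp add: cF)
    then show "n \<le> degree F" by (rule le_degree)
  qed
  have F_neg: "slice x F = 0" if "x < 0" for x
  proof (rule poly_eqI)
    fix l
    have "nth (coeff f l) (x - (real l * \<sigma> - w)) = 0" if "l \<le> n"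
    proof (cases "coeff f l = 0")
      case False
      then have "l \<in> E \<union> Od" using that unfolding E_def Od_def by auto
      then have "w \<le> val (coeff f l) + real l * \<sigma>" using min unfolding w_def by blast
      then show ?thesis using \<open>x < 0\<close> False by (intro nth_below_val) auto
    qed simp
    then show "coeff (slice x F) l = coeff 0 l" by (simp add: nthF)
  qed
  define r where "r = slice 0 F"
  have ri: "coeff r i \<noteq> 0" using ij val_props(1)[of "coeff f i"] unfolding r_def E_def by (simp add: nthF w_def)
  have rj: "coeff r j \<noteq> 0" using ij val_props(1)[of "coeff f j"] eq unfolding r_def Od_def by (simp add: nthF w_def)
  have rm: "coeff r m = 0" unfolding r_def by (simp add: nthF dep)
  have r0: "r \<noteq> 0" using ri by auto
  have "i \<noteq> j" using ij unfolding E_def Od_def by auto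
  have rdeg: "degree r \<le> n" unfolding r_def using degree_slice_le[of 0 F] Fdeg by simp
  have "degree r > 0" using le_degree[OF rj] ij unfolding Od_def by (auto intro: Nat.gr0I)
  then have "\<not> constant (poly r)" by (simp add: constant_degree)
  then obtain c where c: "poly r c = 0" using fundamental_theorem_of_algebra by blast
  define k where "k = order c r"
  have k: "k > 0" "k \<le> n" using c r0 order_gt_0_iff[of r c] order_degree[OF r0, of c] rdeg unfolding k_def by auto
  obtain h0 where h0: "r = [:- c, 1:] ^ k * h0" and h0c: "poly h0 c \<noteq> 0"
  proof -
    obtain h0 where "r = [:- c, 1:] ^ order c r * h0" "\<not> [:- c, 1:] dvd h0" using order_decomp[OF r0] by blast
    then show ?thesis using that unfolding k_def by (simp add: poly_eq_0_iff_dvd)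
  qed
  have "h0 \<noteq> 0" using h0c by auto
  have dg: "degree ([:- c, 1:] ^ k) = k" by (simp add: degree_linear_power)
  have dh: "degree h0 \<le> n - k"
  proof -
    have "degree r = k + degree h0" unfolding h0 using \<open>h0 \<noteq> 0\<close> dg by (subst degree_mult_eq) auto
    then show ?thesis using rdeg by simp
  qed
  have "k < n"
  proof (rule ccontr)
    assume "\<not> k < n"
    then have kn: "k = n" using k by simp
    then have "degree h0 = 0" using dh by simp
    then obtain b where b: "h0 = [:b:]" using degree_eq_zeroE by blast
    have cr: "coeff r l = b * (of_nat (n choose l) * (- c) ^ (n - l))" if "l \<le> n" for l
      unfolding h0 b kn using coeff_linear_poly_power[OF that, of "-c" 1] by simp
    have "b \<noteq> 0" using b \<open>h0 \<noteq> 0\<close> by auto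
    have "coeff r m = b * (of_nat n * (- c))" using cr[of m] unfolding n_def by simp
    then have "c = 0" using rm \<open>b \<noteq> 0\<close> unfolding n_def by (simp del: of_nat_Suc)
    have "coeff r l = 0" if "l < n" for l using cr[of l] that \<open>c = 0\<close> by simp
    then have "i \<ge> n" "j \<ge> n" using ri rj not_less by blast+
    then show False using ij \<open>i \<noteq> j\<close> unfolding E_def Od_def by auto
  qed
  have "\<exists>u v. u * [:- c, 1:] ^ k + v * h0 = 1"
  proof -
    obtain q where "h0 - [:poly h0 c:] = [:- c, 1:] * q" using poly_eq_0_iff_dvd[of "h0 - [:poly h0 c:]" c] by (auto elim: dvdE)
    then have "(- smult (1 / poly h0 c) q) * [:- c, 1:] + [:1 / poly h0 c:] * h0 = 1"
      using h0c by (rule bezout_of_remainder)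
    then show ?thesis by (rule bezout_power)
  qed
  then obtain u v where uv: "u * [:- c, 1:] ^ k + v * h0 = 1" by blast
  have "\<exists>g h. F = g * h \<and> degree g = degree ([:- c, 1:] ^ k) \<and> degree h \<le> n - degree ([:- c, 1:] ^ k)"
    by (rule hensel[OF _ F_neg _ uv]) (use Fdeg h0 dg dh k in \<open>auto simp: r_def\<close>)
  then obtain g h where gh: "F = g * h" "degree g = k" "degree h \<le> n - k" using dg by auto
  have "F \<noteq> 0" using Fdeg n' by auto
  then have "degree h = n - k" using Fdeg gh by (auto simp: degree_mult_eq)
  have "\<exists>y. poly F y = 0"
  proof (cases "odd k")
    case True
    then show ?thesis using IH[of g] gh n' \<open>k < n\<close> by auto
  next
    case False
    then have "odd (degree h)" using \<open>degree h = n - k\<close> n' k by simp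
    then show ?thesis using IH[of h] gh n' \<open>degree h = n - k\<close> k by auto
  qed
  then obtain y where "poly F y = 0" by blast
  moreover have "single_series (-w) 1 \<noteq> 0" using nth_single[of "-w" 1 "-w"] w by (metis exps_uminus nth_simps(1) one_neq_zero)
  ultimately have "poly f (t * y) = 0" unfolding poly_F by simp
  then show ?thesis by blast
qed

theorem odd_degree_root:
  fixes f :: "series poly"
  assumes "odd (degree f)"
  shows "\<exists>y. poly f y = 0"
  using assms
proof (induction "degree f" arbitrary: f rule: less_induct)
  case less
  then obtain m where m: "degree f = Suc m" by (metis even_zero not0_implies_Suc)
  \<comment> \<open>The Tschirnhaus shift: substituting X + c cancels the coefficient of index
    \<open>m\<close>; characteristic 0 makes the division by \<open>Suc m\<close> possible.\<close>
  define c where "c = - coeff f m / (of_nat (Suc m) * coeff f (Suc m))"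
  define g where "g = pcompose f [:c, 1:]"
  have dg: "degree g = degree f" unfolding g_def by (simp add: degree_pcompose)
  have "coeff f (Suc m) \<noteq> 0" using m by (metis degree_0 leading_coeff_0_iff nat.distinct(1))
  have "(of_nat (Suc m) :: series) \<noteq> 0" by (rule of_nat_neq_0)
  have "coeff g m = coeff f m + of_nat (Suc m) * c * coeff f (Suc m)"
    unfolding g_def using coeff_pcompose_shift[of f m c] m by simp
  also have "\<dots> = 0"
    unfolding c_def using \<open>coeff f (Suc m) \<noteq> 0\<close> \<open>(of_nat (Suc m) :: series) \<noteq> 0\<close> by (simp del: of_nat_Suc)
  finally have "\<exists>y. poly g y = 0"
    using less m dg by (intro root_depressed[of g m]) auto
  then show ?case unfolding g_def poly_pcompose by blast
qed

section \<open>The pencil of quadrics over the field of series\<close>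

definition tt :: "nat \<Rightarrow> series" where "tt i = single_series (wt i) 1"

lemma single_nonzero [simp]: "a \<in> exps \<Longrightarrow> c \<noteq> 0 \<Longrightarrow> single_series a c \<noteq> 0"
  using nth_single[of a c a] by force

lemma tt_nonzero [simp]: "tt i \<noteq> 0"
  unfolding tt_def by simp

lemma val_tt [simp]: "val (tt i) = wt i"
  unfolding tt_def by simp

text \<open>The leading term of the summand of least valuation meets no other term at its exponent,
  so it cannot cancel.\<close>

lemma distinct_val_sum_nonzero:
  assumes "finite I" "I \<noteq> {}" "\<And>i. i \<in> I \<Longrightarrow> u i \<noteq> 0" "inj_on (\<lambda>i. val (u i)) I"
  shows "sum u I \<noteq> 0"
proof -
  obtain i where i: "i \<in> I" and min: "\<And>j. j \<in> I \<Longrightarrow> val (u i) \<le> val (u j)"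
    using ex_min_if_finite[of "(\<lambda>i. val (u i)) ` I"] assms(1,2) by (auto simp: not_less)
  have "nth (sum u I) (val (u i)) = (\<Sum>j\<in>I. if j = i then nth (u i) (val (u i)) else 0)"
    unfolding nth_sum
  proof (rule sum.cong[OF refl])
    fix j assume j: "j \<in> I"
    show "nth (u j) (val (u i)) = (if j = i then nth (u i) (val (u i)) else 0)"
    proof (cases "j = i")
      case False
      then have "val (u i) \<noteq> val (u j)" using assms(4) i j by (auto dest: inj_onD)
      then have "val (u i) < val (u j)" using min[OF j] by simp
      then show ?thesis using False nth_below_val assms(3)[OF j] by simp
    qed simp
  qed
  also have "\<dots> \<noteq> 0" using i assms(1) val_props(1)[OF assms(3)[OF i]] by simp
  finally show ?thesis by (metis nth_simps(1))
qed

text \<open>A nonzero term has valuation \<tau> + \<open>wt i\<close> + 2 \<open>val (w i)\<close>.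
  Two such values cannot coincide since the weights differ modulo twice the exponent group, so the
  nonzero terms cannot cancel each other.\<close>

lemma diagonal_anisotropic:
  assumes I: "I \<subseteq> {..4}" and s: "\<And>i. i \<in> I \<Longrightarrow> s i \<noteq> 0 \<and> val (s i) = \<tau>"
    and zero: "(\<Sum>i\<in>I. s i * tt i * (w i)\<^sup>2) = 0" and i: "i \<in> I"
  shows "w i = 0"
proof (rule ccontr)
  assume "w i \<noteq> 0"
  define J where "J = {i \<in> I. w i \<noteq> 0}"
  have fin: "finite I" using I finite_subset by blast
  have "(\<Sum>i\<in>J. s i * tt i * (w i)\<^sup>2) = (\<Sum>i\<in>I. s i * tt i * (w i)\<^sup>2)"
    unfolding J_def by (rule sum.mono_neutral_left) (use fin in auto)
  moreover have "(\<Sum>i\<in>J. s i * tt i * (w i)\<^sup>2) \<noteq> 0"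
  proof (rule distinct_val_sum_nonzero)
    show "finite J" "J \<noteq> {}" using fin i \<open>w i \<noteq> 0\<close> unfolding J_def by auto
    show "s i * tt i * (w i)\<^sup>2 \<noteq> 0" if "i \<in> J" for i using that s unfolding J_def by auto
    have v: "val (s i * tt i * (w i)\<^sup>2) = \<tau> + wt i + 2 * val (w i)" if "i \<in> J" for i
      using that s[of i] unfolding J_def by (simp add: val_mult power2_eq_square)
    show "inj_on (\<lambda>i. val (s i * tt i * (w i)\<^sup>2)) J"
    proof (rule inj_onI, rule ccontr)
      fix i j assume ij: "i \<in> J" "j \<in> J" "val (s i * tt i * (w i)\<^sup>2) = val (s j * tt j * (w j)\<^sup>2)" "i \<noteq> j"
      then have "(wt i - wt j) / 2 = val (w j) - val (w i)" using v by simp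
      also have "\<dots> \<in> exps" using ij unfolding J_def by (intro exps_diff val_exps) auto
      finally show False using wt_distinct_mod_2[of i j] ij I unfolding J_def by auto
    qed
  qed
  ultimately show False using zero by simp
qed

lemma nth_of_nat_mult [simp]: "nth (of_nat n * f) x = of_nat n * nth f x"
  by (induction n) (auto simp: algebra_simps)

text \<open>
  At most one coefficient of a member of the pencil has an exceptional valuation; the other four make up
  an anisotropic form. A totally isotropic plane would meet the hyperplane given by that coordinate.
\<close>

lemma no_isotropic_plane:
  fixes \<mu> \<nu> :: series and p q :: "nat \<Rightarrow> series"
  assumes nz: "\<mu> \<noteq> 0 \<or> \<nu> \<noteq> 0"
    and pp: "(\<Sum>i\<le>4. (\<mu> + of_nat i * \<nu>) * tt i * (p i * p i)) = 0"
    and pq: "(\<Sum>i\<le>4. (\<mu> + of_nat i * \<nu>) * tt i * (p i * q i)) = 0"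
    and qq: "(\<Sum>i\<le>4. (\<mu> + of_nat i * \<nu>) * tt i * (q i * q i)) = 0"
  shows "\<exists>a b. (a \<noteq> 0 \<or> b \<noteq> 0) \<and> (\<forall>i\<le>4. a * p i + b * q i = 0)"
proof -
  define s where "s i = \<mu> + of_nat i * \<nu>" for i
  define T where "T = {i. i \<le> 4 \<and> s i \<noteq> 0}"
  have "T \<noteq> {}"
  proof
    assume "T = {}"
    then have "s 0 = 0" "s 1 = 0" unfolding T_def by auto
    then show False using nz unfolding s_def by auto
  qed
  have "finite T" unfolding T_def by auto
  define m where "m = Min ((\<lambda>i. val (s i)) ` T)"
  have m_le: "m \<le> val (s i)" if "i \<in> T" for i
    unfolding m_def using that \<open>finite T\<close> by auto
  have "m \<in> (\<lambda>i. val (s i)) ` T" unfolding m_def using \<open>T \<noteq> {}\<close> \<open>finite T\<close> by (intro Min_in) auto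
  then obtain l where l: "l \<in> T" "val (s l) = m" by auto
  define V where "V = {i. i \<le> 4 \<and> (s i = 0 \<or> val (s i) > m)}"
  \<comment> \<open>The coefficient of \<open>s i\<close> at the least valuation \<open>m\<close> is
    an affine function of \<open>i\<close> over the complex numbers. Two zeros would make it vanish
    identically, but it is nonzero at \<open>l\<close>, where the minimum is attained.\<close>
  have V1: "i = j" if ij: "i \<in> V" "j \<in> V" for i j
  proof (rule ccontr)
    assume "i \<noteq> j"
    have van: "nth (s i) m = 0" if "i \<in> V" for i
      using that nth_below_val[of "s i" m] unfolding V_def by (cases "s i = 0") auto
    have e: "nth \<mu> m + of_nat i * nth \<nu> m = 0" "nth \<mu> m + of_nat j * nth \<nu> m = 0"
      using van ij unfolding s_def by auto
    have "(of_nat i - of_nat j) * nth \<nu> m = (nth \<mu> m + of_nat i * nth \<nu> m) - (nth \<mu> m + of_nat j * nth \<nu> m)"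
      by (simp add: left_diff_distrib)
    also have "\<dots> = 0" unfolding e by simp
    finally have "(of_nat i - of_nat j) * nth \<nu> m = 0" .
    then have "nth \<nu> m = 0" using \<open>i \<noteq> j\<close> by simp
    then have "nth (s l) m = 0" using \<open>nth \<mu> m + of_nat i * nth \<nu> m = 0\<close> unfolding s_def by simp
    then show False using l val_props(1)[of "s l"] unfolding T_def by auto
  qed
  then obtain i0 where i0: "i0 \<le> 4" "V \<subseteq> {i0}"
  proof (cases "V = {}")
    case False
    then obtain i where "i \<in> V" by blast
    then show ?thesis using V1 that[of i] unfolding V_def by auto
  qed (use that[of 0] in auto)
  obtain a b where ab: "a \<noteq> 0 \<or> b \<noteq> 0" "a * p i0 + b * q i0 = 0"
  proof (cases "p i0 = 0")
    case True
    then show ?thesis using that[of 1 0] by simp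
  next
    case False
    then show ?thesis using that[of "q i0" "- p i0"] by (simp add: mult.commute)
  qed
  define w where "w i = a * p i + b * q i" for i
  have "(\<Sum>i\<le>4. s i * tt i * (w i)\<^sup>2) = (\<Sum>i\<le>4. a * a * (s i * tt i * (p i * p i)) + 2 * a * b * (s i * tt i * (p i * q i)) + b * b * (s i * tt i * (q i * q i)))"
    unfolding w_def power2_eq_square by (intro sum.cong refl) (simp add: algebra_simps)
  also have "\<dots> = a * a * (\<Sum>i\<le>4. s i * tt i * (p i * p i)) + 2 * a * b * (\<Sum>i\<le>4. s i * tt i * (p i * q i)) + b * b * (\<Sum>i\<le>4. s i * tt i * (q i * q i))"
    by (simp only: sum.distrib sum_distrib_left)
  also have "\<dots> = 0" using pp pq qq unfolding s_def by simp
  finally have "(\<Sum>i\<le>4. s i * tt i * (w i)\<^sup>2) = 0" .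
  moreover have "(\<Sum>i\<le>4. s i * tt i * (w i)\<^sup>2) = (\<Sum>i\<in>{..4} - {i0}. s i * tt i * (w i)\<^sup>2)"
    by (rule sum.mono_neutral_right) (use ab in \<open>auto simp: w_def\<close>)
  ultimately have z: "(\<Sum>i\<in>{..4} - {i0}. s i * tt i * (w i)\<^sup>2) = 0" by simp
  have "w i = 0" if "i \<le> 4" for i
  proof (cases "i = i0")
    case False
    show ?thesis
    proof (rule diagonal_anisotropic[OF _ _ z])
      fix i assume i: "i \<in> {..4} - {i0}"
      then have "i \<notin> V" using i0 by auto
      then have "s i \<noteq> 0" "val (s i) \<le> m" using i unfolding V_def by auto
      then show "s i \<noteq> 0 \<and> val (s i) = m" using m_le[of i] i unfolding T_def by auto
    qed (use that False in auto)
  qed (use ab in \<open>simp add: w_def\<close>)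
  then show ?thesis using ab(1) unfolding w_def by blast
qed

text \<open>The hypotheses are the components of both quadratic forms at p + q \<surd>a: the value
  at p plus a times the value at q, and the polar form of p and q. With N1 and N2 the values at q,
  the member N2 Q1 - N1 Q2 of the pencil vanishes on the span of p and q; the normalisation at
  \<open>j\<close> then forces q = 0, hence N1 = N2 = 0. That case is excluded because Q1 would
  vanish at p, although it is anisotropic.\<close>

theorem no_quadratic_point:
  fixes a :: series and p q :: "nat \<Rightarrow> series"
  assumes j: "j \<le> 4" "p j = 1" "q j = 0"
    and 1: "(\<Sum>i\<le>4. tt i * (p i * p i + a * (q i * q i))) = 0" "(\<Sum>i\<le>4. tt i * (p i * q i)) = 0"
    and 2: "(\<Sum>i\<le>4. of_nat i * tt i * (p i * p i + a * (q i * q i))) = 0" "(\<Sum>i\<le>4. of_nat i * tt i * (p i * q i)) = 0"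
  shows False
proof -
  define N1 N2 where "N1 = (\<Sum>i\<le>4. tt i * (q i * q i))" and "N2 = (\<Sum>i\<le>4. of_nat i * tt i * (q i * q i))"
  have val1: "val (1::series) = 0" using val_single[of 0 1] by (simp add: one_series_def)
  have an: "w i = 0" if "(\<Sum>i\<le>4. tt i * (w i * w i)) = 0" "i \<le> 4" for w i
    by (rule diagonal_anisotropic[of "{..4}" "\<lambda>_. 1" 0])
      (use that val1 in \<open>auto simp: power2_eq_square\<close>)
  have P1: "(\<Sum>i\<le>4. tt i * (p i * p i)) = - a * N1"
    using 1(1) unfolding N1_def sum_distrib_left by (simp add: distrib_left sum.distrib eq_neg_iff_add_eq_0 mult_ac sum_negf)
  have P2: "(\<Sum>i\<le>4. of_nat i * tt i * (p i * p i)) = - a * N2"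
    using 2(1) unfolding N2_def sum_distrib_left by (simp add: distrib_left sum.distrib eq_neg_iff_add_eq_0 mult_ac sum_negf)
  have N: "N1 \<noteq> 0 \<or> N2 \<noteq> 0"
  proof (rule ccontr)
    assume "\<not> (N1 \<noteq> 0 \<or> N2 \<noteq> 0)"
    then have "(\<Sum>i\<le>4. tt i * (p i * p i)) = 0" using P1 by simp
    then have "p j = 0" using an j by blast
    then show False using j by simp
  qed
  have split: "(\<Sum>i\<le>4. (N2 + of_nat i * (- N1)) * tt i * f i) = N2 * (\<Sum>i\<le>4. tt i * f i) - N1 * (\<Sum>i\<le>4. of_nat i * tt i * f i)" for f
    by (simp add: sum_distrib_left sum_subtractf[symmetric] algebra_simps)
  have "\<exists>\<alpha> \<beta>. (\<alpha> \<noteq> 0 \<or> \<beta> \<noteq> 0) \<and> (\<forall>i\<le>4. \<alpha> * p i + \<beta> * q i = 0)"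
  proof (rule no_isotropic_plane[of N2 "- N1"])
    show "N2 \<noteq> 0 \<or> - N1 \<noteq> 0" using N by auto
    show "(\<Sum>i\<le>4. (N2 + of_nat i * - N1) * tt i * (p i * p i)) = 0" unfolding split P1 P2 by (simp add: mult_ac)
    show "(\<Sum>i\<le>4. (N2 + of_nat i * - N1) * tt i * (p i * q i)) = 0" unfolding split 1 2 by simp
    show "(\<Sum>i\<le>4. (N2 + of_nat i * - N1) * tt i * (q i * q i)) = 0" unfolding split N1_def[symmetric] N2_def[symmetric] by (simp add: mult_ac)
  qed
  then obtain \<alpha> \<beta> where ab: "\<alpha> \<noteq> 0 \<or> \<beta> \<noteq> 0" "\<And>i. i \<le> 4 \<Longrightarrow> \<alpha> * p i + \<beta> * q i = 0" by blast
  have "\<alpha> = 0" using ab(2)[of j] j by simp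
  then have "q i = 0" if "i \<le> 4" for i using ab(1) ab(2)[OF that] by auto
  then show False using N unfolding N1_def N2_def by simp
qed

text \<open>This endomorphism substitutes the square of t for t. It presents the field as an
  extension of itself in which every image of a monomial is a square, so that extensions by such
  square roots need no new type.\<close>

lift_definition double :: "series \<Rightarrow> series" is "\<lambda>f x. f (x / 2)"
proof -
  fix f :: "real \<Rightarrow> complex" assume f: "left_finite f"
  have "x \<in> exps" if "f (x / 2) \<noteq> 0" for x
  proof -
    have "x / 2 \<in> exps" using f that unfolding left_finite_def by blast
    then show ?thesis using exps_of_int_mult[of "x / 2" 2] by simp
  qed
  moreover have "finite {x. x \<le> b \<and> f (x / 2) \<noteq> 0}" for b
  proof (rule finite_subset)
    show "finite ((\<lambda>x. 2 * x) ` {x. x \<le> b / 2 \<and> f x \<noteq> 0})"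
      using f unfolding left_finite_def by (intro finite_imageI) blast
    show "{x. x \<le> b \<and> f (x / 2) \<noteq> 0} \<subseteq> (\<lambda>x. 2 * x) ` {x. x \<le> b / 2 \<and> f x \<noteq> 0}"
    proof
      fix x assume "x \<in> {x. x \<le> b \<and> f (x / 2) \<noteq> 0}"
      then show "x \<in> (\<lambda>x. 2 * x) ` {x. x \<le> b / 2 \<and> f x \<noteq> 0}" by (intro image_eqI[of _ _ "x / 2"]) auto
    qed
  qed
  ultimately show "left_finite (\<lambda>x. f (x / 2))" unfolding left_finite_def by blast
qed

lemma double_0 [simp]: "double 0 = 0" and double_1 [simp]: "double 1 = 1"
  by (rule series_eqI; simp add: double.rep_eq)+

lemma double_add: "double (f + g) = double f + double g"
  by (rule series_eqI) (simp add: double.rep_eq)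

lemma double_mult: "double (f * g) = double f * double g"
proof (rule series_eqI)
  fix x
  show "nth (double (f * g)) x = nth (double f * double g) x"
    unfolding double.rep_eq times_series.rep_eq conv_def
    by (rule sum.reindex_bij_witness[of _ "\<lambda>y. y / 2" "\<lambda>y. 2 * y"]) (auto simp: diff_divide_distrib)
qed

lemma double_eq_0_iff [simp]: "double f = 0 \<longleftrightarrow> f = 0"
proof
  assume d: "double f = 0"
  show "f = 0"
  proof (rule series_eqI)
    fix x
    have "nth (double f) (2 * x) = 0" by (simp add: d)
    then show "nth f x = nth 0 x" by (simp add: double.rep_eq)
  qed
qed simp

lemma double_single: "a \<in> exps \<Longrightarrow> double (single_series a c) = single_series (2 * a) c"
  using exps_of_int_mult[of a 2] by (intro series_eqI) (auto simp: double.rep_eq)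

text \<open>A series amounts to countably many complex coefficients, and each of these to two
  Dedekind cuts of rationals; coding the triples of position, part and rational by naturals yields a
  set of naturals, and such sets inject into the reals.\<close>

lemma ex_inj_series_complex: "\<exists>\<phi> :: series \<Rightarrow> complex. inj \<phi>"
proof -
  obtain g :: "nat set \<Rightarrow> real" where g: "inj g"
    using nat_sets_lepoll_reals01 unfolding lepoll_def by auto
  define cut :: "real \<Rightarrow> rat set" where "cut r = {s. of_rat s < r}" for r
  have cut: "r = r'" if "cut r = cut r'" for r r'
  proof (rule ccontr)
    have neq: "cut r \<noteq> cut r'" if less: "r < r'" for r r'
    proof -
      obtain s where "r < of_rat s" "of_rat s < r'" using of_rat_dense[OF less] by blast
      then have "s \<in> cut r'" "s \<notin> cut r" unfolding cut_def by auto
      then show ?thesis by blast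
    qed
    assume "r \<noteq> r'"
    then show False using neq[of r r'] neq[of r' r] that by (cases "r < r'") auto
  qed
  define enc :: "series \<Rightarrow> nat set" where
    "enc f = {to_nat (n :: nat, b, s :: rat) |n b s. s \<in> cut (if b then Re (nth f (from_nat_into exps n)) else Im (nth f (from_nat_into exps n)))}" for f
  have "inj enc"
  proof (rule injI)
    fix f g assume e: "enc f = enc g"
    have mem: "to_nat (n :: nat, b, s :: rat) \<in> enc f \<longleftrightarrow> s \<in> cut (if b then Re (nth f (from_nat_into exps n)) else Im (nth f (from_nat_into exps n)))" for n b s f
      unfolding enc_def by auto
    show "f = g"
    proof (rule series_eqI)
      fix x
      show "nth f x = nth g x"
      proof (cases "x \<in> exps")
        case True
        then obtain n where n: "from_nat_into exps n = x"
          using from_nat_into_surj[OF countable_exps True] by blast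
        have "cut (Re (nth f x)) = cut (Re (nth g x))" using mem[of n True _ f] mem[of n True _ g] e n by auto
        moreover have "cut (Im (nth f x)) = cut (Im (nth g x))" using mem[of n False _ f] mem[of n False _ g] e n by auto
        ultimately show ?thesis using cut by (simp add: complex_eq_iff)
      next
        case False
        then show ?thesis using nth_exps by metis
      qed
    qed
  qed
  then have "inj (\<lambda>f. complex_of_real (g (enc f)))" using g by (auto simp: inj_def)
  then show ?thesis by blast
qed

section \<open>Field extensions of degree not divisible by 4\<close>

lemma add_eq_add_halves:
  fixes x :: "'a::ab_semigroup_add"
  assumes "x = u + h" "y = v + h" "h + h = s"
  shows "x + y = (u + v) + s"
  unfolding assms(1,2) assms(3)[symmetric] by (simp add: ac_simps)

text \<open>The characteristic polynomial of the matrix of \<open>T\<close> has odd degree and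
  therefore a root. Vectors are functions on an arbitrary finite index set, so that the positions
  above the diagonal of a matrix can serve as coordinates.\<close>

lemma odd_dim_eigenvector:
  fixes T :: "('i \<Rightarrow> 'k::field) \<Rightarrow> 'i \<Rightarrow> 'k"
  assumes closed: "\<And>p :: 'k poly. odd (degree p) \<Longrightarrow> \<exists>x. poly p x = 0"
    and I: "finite I" "odd (card I)"
    and add: "\<And>f g p. p \<in> I \<Longrightarrow> T (\<lambda>q. f q + g q) p = T f p + T g p"
    and scale: "\<And>a f p. p \<in> I \<Longrightarrow> T (\<lambda>q. a * f q) p = a * T f p"
  shows "\<exists>e b. (\<exists>p\<in>I. b p \<noteq> 0) \<and> (\<forall>p. p \<notin> I \<longrightarrow> b p = 0) \<and> (\<forall>p\<in>I. T b p = e * b p)"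
proof -
  define n where "n = card I"
  obtain h where h: "bij_betw h {0..<n} I" using ex_bij_betw_nat_finite[OF I(1)] unfolding n_def by blast
  define \<delta> :: "'i \<Rightarrow> 'i \<Rightarrow> 'k" where "\<delta> q = (\<lambda>p. if p = q then 1 else 0)" for q
  define A where "A = mat n n (\<lambda>(i, j). T (\<delta> (h j)) (h i))"
  have A: "A \<in> carrier_mat n n" unfolding A_def by simp
  have "odd (degree (char_poly A))" using degree_monic_char_poly[OF A] I(2) unfolding n_def by simp
  then obtain e where "poly (char_poly A) e = 0" using closed by blast
  then have "eigenvalue A e" using eigenvalue_root_char_poly[OF A] by blast
  then obtain v where v: "v \<in> carrier_vec n" "v \<noteq> 0\<^sub>v n" "A *\<^sub>v v = e \<cdot>\<^sub>v v"
    using A unfolding eigenvalue_def eigenvector_def by auto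
  define b where "b p = (if p \<in> I then v $ (inv_into {0..<n} h p) else 0)" for p
  have hb: "b (h i) = v $ i" if "i < n" for i
    using h that unfolding b_def by (auto simp: bij_betw_def inv_into_f_f)
  have expand: "T (\<lambda>q. if q \<in> S then b q else 0) p = (\<Sum>q\<in>S. T (\<delta> q) p * b q)" if "finite S" "p \<in> I" for S p
    using that
  proof (induction S rule: finite_induct)
    case empty
    have "T (\<lambda>q. 0 * b q) p = 0" using scale[OF that(2), of 0 b] by simp
    then show ?case by simp
  next
    case (insert s S)
    have "(\<lambda>q. if q \<in> insert s S then b q else 0) = (\<lambda>q. b s * \<delta> s q + (if q \<in> S then b q else 0))"
      using insert.hyps by (auto simp: \<delta>_def fun_eq_iff)
    then have "T (\<lambda>q. if q \<in> insert s S then b q else 0) p = b s * T (\<delta> s) p + T (\<lambda>q. if q \<in> S then b q else 0) p"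
      using add[OF that(2), of "\<lambda>q. b s * \<delta> s q"] scale[OF that(2)] by simp
    then show ?case using insert by (simp add: mult.commute)
  qed
  have "T b p = e * b p" if p: "p \<in> I" for p
  proof -
    obtain i where i: "i < n" "p = h i" using h p unfolding bij_betw_def by force
    have "(\<lambda>q. if q \<in> I then b q else 0) = b" unfolding b_def by auto
    then have "T b p = (\<Sum>q\<in>I. T (\<delta> q) p * b q)" using expand[OF I(1) p] by simp
    also have "\<dots> = (\<Sum>j = 0..<n. T (\<delta> (h j)) p * b (h j))"
      by (rule sum.reindex_bij_betw[OF h, symmetric])
    also have "\<dots> = (\<Sum>j = 0..<n. A $$ (i, j) * v $ j)"
      by (rule sum.cong[OF refl]) (use i hb in \<open>auto simp: A_def\<close>)
    also have "\<dots> = (A *\<^sub>v v) $ i" using A v(1) i by (simp add: scalar_prod_def)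
    also have "\<dots> = e * b p" unfolding v(3) using i v(1) hb by simp
    finally show ?thesis .
  qed
  moreover have "\<exists>p\<in>I. b p \<noteq> 0"
  proof -
    obtain i where "i < n" "v $ i \<noteq> 0" using v(1,2) by (metis eq_vecI carrier_vecD index_zero_vec(1) index_zero_vec(2))
    then show ?thesis using hb[of i] h unfolding bij_betw_def by (intro bexI[of _ "h i"]) auto
  qed
  moreover have "b p = 0" if "p \<notin> I" for p using that unfolding b_def by simp
  ultimately show ?thesis by blast
qed

lemma card_increasing_pairs: "card {(i, j). i < j \<and> j < (d::nat)} = d * (d - 1) div 2"
proof -
  define S where "S = (SIGMA j:{..<d}. {..<j})"
  have "bij_betw (\<lambda>(j, i). (i, j)) S {(i, j). i < j \<and> j < d}"
    unfolding S_def by (rule bij_betw_byWitness[of _ "\<lambda>(i, j). (j, i)"]) auto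
  then have "card {(i, j). i < j \<and> j < d} = card S" using bij_betw_same_card by metis
  also have "\<dots> = (\<Sum>j<d. j)" unfolding S_def by simp
  also have "\<dots> = d * (d - 1) div 2"
  proof -
    have "2 * (\<Sum>j<d. j) = d * (d - 1)"
    proof (induction d)
      case (Suc d)
      then show ?case by (cases d) auto
    qed simp
    then show ?thesis by simp
  qed
  finally show ?thesis .
qed

text \<open>The alternating forms make up a space of odd dimension \<open>d (d - 1) / 2\<close>, on which \<open>A\<close> acts.\<close>

lemma alternating_eigenform:
  fixes A :: "nat \<Rightarrow> nat \<Rightarrow> 'k::field"
  assumes closed: "\<And>p :: 'k poly. odd (degree p) \<Longrightarrow> \<exists>x. poly p x = 0"
    and d: "odd (d * (d - 1) div 2)"
  shows "\<exists>e B. (\<exists>i<d. \<exists>j<d. B i j \<noteq> 0) \<and>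
    (\<forall>i<d. \<forall>j<d. (\<Sum>l<d. A l i * B l j) + (\<Sum>l<d. B i l * A l j) = e * B i j)"
proof -
  define I where "I = {(i, j). i < j \<and> j < d}"
  define ext :: "(nat \<times> nat \<Rightarrow> 'k) \<Rightarrow> nat \<Rightarrow> nat \<Rightarrow> 'k"
    \<comment> \<open>Entries above the diagonal determine an alternating matrix; \<open>T\<close>
      is the action on such matrices in these coordinates.\<close>
    where "ext b i j = (if i < j then b (i, j) else if j < i then - b (j, i) else 0)" for b i j
  define T where "T b = (\<lambda>(i, j). (\<Sum>l<d. A l i * ext b l j) + (\<Sum>l<d. ext b i l * A l j))" for b
  have "finite I" unfolding I_def by (rule finite_subset[of _ "{..<d} \<times> {..<d}"]) auto
  have ea: "ext (\<lambda>q. f q + g q) i j = ext f i j + ext g i j" for f g i j unfolding ext_def by simp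
  have es: "ext (\<lambda>q. a * f q) i j = a * ext f i j" for a f i j unfolding ext_def by simp
  have "\<exists>e b. (\<exists>p\<in>I. b p \<noteq> 0) \<and> (\<forall>p. p \<notin> I \<longrightarrow> b p = 0) \<and> (\<forall>p\<in>I. T b p = e * b p)"
  proof (rule odd_dim_eigenvector[OF closed])
    show "finite I" by fact
    show "odd (card I)" unfolding I_def card_increasing_pairs by (rule d)
    fix f g :: "nat \<times> nat \<Rightarrow> 'k" and a p
    show "T (\<lambda>q. f q + g q) p = T f p + T g p"
      unfolding T_def ea by (simp add: sum.distrib algebra_simps split: prod.splits)
    show "T (\<lambda>q. a * f q) p = a * T f p"
      unfolding T_def es by (simp add: sum_distrib_left algebra_simps split: prod.splits)
  qed
  then obtain e b where b: "\<exists>p\<in>I. b p \<noteq> 0" "\<And>p. p \<in> I \<Longrightarrow> T b p = e * b p" by blast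
  define B where "B = ext b"
  have anti: "B i j = - B j i" for i j unfolding B_def ext_def by auto
  have eq: "(\<Sum>l<d. A l i * B l j) + (\<Sum>l<d. B i l * A l j) = e * B i j" if "i < j" "j < d" for i j
    using b(2)[of "(i, j)"] that unfolding T_def B_def I_def by (simp add: ext_def)
  \<comment> \<open>The action sends alternating matrices to alternating matrices, so the eigenvalue
    equation above the diagonal implies the one below and, since the characteristic is 0, the one on
    it.\<close>
  have swap: "(\<Sum>l<d. A l i * B l j) + (\<Sum>l<d. B i l * A l j) = - ((\<Sum>l<d. A l j * B l i) + (\<Sum>l<d. B j l * A l i))" for i j
  proof -
    have "(\<Sum>l<d. A l i * B l j) = - (\<Sum>l<d. B j l * A l i)" unfolding sum_negf[symmetric]
      by (rule sum.cong[OF refl]) (subst anti, simp add: mult.commute)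
    moreover have "(\<Sum>l<d. B i l * A l j) = - (\<Sum>l<d. A l j * B l i)" unfolding sum_negf[symmetric]
      by (rule sum.cong[OF refl]) (subst anti, simp add: mult.commute)
    ultimately show ?thesis by simp
  qed
  have "(\<Sum>l<d. A l i * B l j) + (\<Sum>l<d. B i l * A l j) = e * B i j" if ij: "i < d" "j < d" for i j
  proof (cases i j rule: linorder_cases)
    case less
    then show ?thesis using eq ij by blast
  next
    case equal
    have B0: "B j j = 0" unfolding B_def ext_def by simp
    have "(\<Sum>l<d. A l j * B l j) = - (\<Sum>l<d. B j l * A l j)" unfolding sum_negf[symmetric]
      by (rule sum.cong[OF refl]) (subst anti, simp add: mult.commute)
    then show ?thesis using B0 equal by simp
  next
    case greater
    then have "(\<Sum>l<d. A l j * B l i) + (\<Sum>l<d. B j l * A l i) = e * B j i" using eq ij by blast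
    then show ?thesis unfolding swap[of i j] using anti[of i j] by simp
  qed
  moreover have "\<exists>i<d. \<exists>j<d. B i j \<noteq> 0" using b(1) unfolding I_def B_def ext_def by fastforce
  ultimately show ?thesis by blast
qed

section \<open>Field extensions as vector spaces over an embedded base field\<close>

locale scalars = field R for R :: "('a, 'b) ring_scheme" (structure) +
  fixes \<iota> :: "'k::field_char_0 \<Rightarrow> 'a"
  assumes emb_closed [simp]: "\<iota> a \<in> carrier R"
    and emb_add: "\<iota> (a + b) = \<iota> a \<oplus> \<iota> b"
    and emb_mult: "\<iota> (a * b) = \<iota> a \<otimes> \<iota> b"
    and emb_1: "\<iota> 1 = \<one>"
begin

lemma emb_0: "\<iota> 0 = \<zero>"
proof -
  have "\<iota> 0 \<oplus> \<iota> 0 = \<iota> 0" using emb_add[of 0 0] by simp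
  then show ?thesis using add.l_cancel_one[of "\<iota> 0" "\<iota> 0"] by simp
qed

lemma emb_uminus: "\<iota> (- a) = \<ominus> \<iota> a"
proof -
  have "\<iota> (- a) \<oplus> \<iota> a = \<zero>" using emb_add[of "-a" a] by (simp add: emb_0)
  then show ?thesis by (simp add: minus_equality)
qed

lemma emb_eq_0: "\<iota> a = \<zero> \<Longrightarrow> a = 0"
proof (rule ccontr)
  assume "\<iota> a = \<zero>" "a \<noteq> 0"
  then have "\<one> = \<iota> (a * inverse a)" by (simp add: emb_1)
  also have "\<dots> = \<zero>" using \<open>\<iota> a = \<zero>\<close> by (simp add: emb_mult)
  finally show False by simp
qed

lemma emb_inverse: "a \<noteq> 0 \<Longrightarrow> inv (\<iota> a) = \<iota> (inverse a)"
  by (rule comm_inv_char) (simp_all add: emb_mult[symmetric] emb_1)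

definition K where "K = range \<iota>"

lemma subfield_K: "subfield K R"
proof (rule subfieldI')
  show "subring K R"
    by (rule subringI) (auto simp: K_def emb_1[symmetric] emb_mult[symmetric] emb_add[symmetric] emb_uminus[symmetric])
  show "inv k \<in> K" if k: "k \<in> K - {\<zero>}" for k
  proof -
    obtain a where a: "k = \<iota> a" using k unfolding K_def by auto
    then have "a \<noteq> 0" using k emb_0 by auto
    then show ?thesis unfolding a K_def by (simp add: emb_inverse)
  qed
qed

lemma K_subset: "K \<subseteq> carrier R"
  unfolding K_def by auto

lemma add_eq_imp_minus_eq:
  assumes "x \<in> carrier R" "l \<in> carrier R" "y \<in> carrier R" "m \<in> carrier R" and eq: "x \<oplus> l = y \<oplus> m"
  shows "x \<ominus> y = m \<ominus> l"
proof -
  have "m \<ominus> l = \<ominus> y \<oplus> (y \<oplus> m) \<oplus> \<ominus> l" using assms(1-4) by (simp add: minus_eq r_neg1 r_neg2)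
  also have "\<dots> = \<ominus> y \<oplus> x" unfolding eq[symmetric] using assms(1-4) by (simp add: a_assoc r_neg)
  also have "\<dots> = x \<ominus> y" using assms(1-4) by (simp add: minus_eq a_comm)
  finally show ?thesis by simp
qed

text \<open>Each line extension in the inductive construction of a dimension contributes one
  coordinate. The parametrisation accepts all sequences but depends only on the first
  \<open>n\<close> entries, which avoids vectors of a length fixed by the type.\<close>

lemma dimension_coordinates:
  assumes "dimension n K E"
  shows "\<exists>L :: (nat \<Rightarrow> 'k) \<Rightarrow> 'a. E \<subseteq> carrier R \<and> range L = E
    \<and> (\<forall>c c'. L c = L c' \<longleftrightarrow> (\<forall>i<n. c i = c' i))
    \<and> (\<forall>c c'. L (\<lambda>i. c i + c' i) = L c \<oplus> L c')
    \<and> (\<forall>a c. L (\<lambda>i. a * c i) = \<iota> a \<otimes> L c)"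
  using assms
proof (induction n arbitrary: E)
  case 0
  then have "E = {\<zero>}" using dimension_zero[OF subfield_K] by blast
  then show ?case by (intro exI[of _ "\<lambda>_. \<zero>"]) auto
next
  case (Suc n)
  obtain v E' where v: "v \<in> carrier R" "v \<notin> E'" and d: "dimension n K E'" and E: "E = line_extension K v E'"
    using dimension_backwards[OF subfield_K Suc.prems] by blast
  obtain L where E': "E' \<subseteq> carrier R" and rL: "range L = E'" and inj: "\<And>c c'. L c = L c' \<longleftrightarrow> (\<forall>i<n. c i = c' i)"
    and add: "\<And>c c'. L (\<lambda>i. c i + c' i) = L c \<oplus> L c'" and scale: "\<And>a c. L (\<lambda>i. a * c i) = \<iota> a \<otimes> L c"
    using Suc.IH[OF d] by blast
  have Lc [simp]: "L c \<in> carrier R" for c using E' rL by blast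
  define M where "M c = \<iota> (c n) \<otimes> v \<oplus> L c" for c :: "nat \<Rightarrow> 'k"
  have "E \<subseteq> carrier R" unfolding E using line_extension_in_carrier[OF K_subset v(1) E'] .
  moreover have "range M = E"
  proof
    show "range M \<subseteq> E"
    proof
      fix u assume "u \<in> range M"
      then obtain c where "u = \<iota> (c n) \<otimes> v \<oplus> L c" unfolding M_def by auto
      moreover have "\<iota> (c n) \<in> K" "L c \<in> E'" unfolding K_def using rL by auto
      ultimately show "u \<in> E" unfolding E line_extension_mem_iff by blast
    qed
    show "E \<subseteq> range M"
    proof
      fix u assume "u \<in> E"
      then obtain a w where "w \<in> E'" and u: "u = \<iota> a \<otimes> v \<oplus> w" unfolding E K_def by (auto simp: line_extension_mem_iff)
      then obtain c where c: "w = L c" using rL by auto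
      have "L (c(n := a)) = L c" by (subst inj) auto
      then have "M (c(n := a)) = u" unfolding M_def u c by simp
      then show "u \<in> range M" by (metis rangeI)
    qed
  qed
  moreover have "M c = M c' \<longleftrightarrow> (\<forall>i<Suc n. c i = c' i)" for c c'
  proof
    assume eq: "M c = M c'"
    have "c n = c' n"
    \<comment> \<open>If the new coordinates differed, subtracting the two representations would
      exhibit a nonzero multiple of \<open>v\<close>, and hence \<open>v\<close> itself, as an
      element of the smaller space.\<close>
    proof (rule ccontr)
      assume ne: "c n \<noteq> c' n"
      define g where "g = (\<lambda>i. c' i + (- 1) * c i)"
      have "L g = L c' \<oplus> \<iota> (- 1) \<otimes> L c" unfolding g_def add scale by simp
      then have Lg: "L g = L c' \<ominus> L c" by (simp add: emb_uminus emb_1 l_minus minus_eq)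
      have "\<iota> (c n - c' n) = \<iota> (c n) \<ominus> \<iota> (c' n)" using emb_add[of "c n" "- c' n"] by (simp add: emb_uminus minus_eq)
      then have "\<iota> (c n - c' n) \<otimes> v = \<iota> (c n) \<otimes> v \<ominus> \<iota> (c' n) \<otimes> v"
        using v(1) by (simp add: minus_eq l_distr l_minus)
      also have "\<dots> = L g" unfolding Lg using eq v(1) unfolding M_def by (intro add_eq_imp_minus_eq) auto
      finally have "\<iota> (inverse (c n - c' n)) \<otimes> L g = \<iota> (inverse (c n - c' n)) \<otimes> (\<iota> (c n - c' n) \<otimes> v)" by simp
      also have "\<dots> = \<iota> (inverse (c n - c' n) * (c n - c' n)) \<otimes> v" using v(1) by (simp add: emb_mult m_assoc)
      also have "\<dots> = v" using ne v(1) by (simp add: emb_1)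
      finally have "v = L (\<lambda>i. inverse (c n - c' n) * g i)" using scale by simp
      then show False using v(2) rL by auto
    qed
    moreover from this have "L c = L c'" using eq v(1) unfolding M_def by simp
    ultimately show "\<forall>i<Suc n. c i = c' i" using inj by (auto simp: less_Suc_eq)
  next
    assume "\<forall>i<Suc n. c i = c' i"
    then show "M c = M c'" unfolding M_def using inj[of c c'] by auto
  qed
  moreover have "M (\<lambda>i. c i + c' i) = M c \<oplus> M c'" for c c'
    unfolding M_def add emb_add using v(1) by (simp add: l_distr a_ac)
  moreover have "M (\<lambda>i. a * c i) = \<iota> a \<otimes> M c" for a c
    unfolding M_def scale emb_mult using v(1) by (simp add: r_distr m_assoc)
  ultimately show ?case by blast
qed

lemma coordinates:
  assumes "dimension n K E"
  obtains L :: "(nat \<Rightarrow> 'k) \<Rightarrow> 'a" and co :: "'a \<Rightarrow> nat \<Rightarrow> 'k" where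
    "E \<subseteq> carrier R" "\<And>c. L c \<in> E" "\<And>u. u \<in> E \<Longrightarrow> L (co u) = u" "\<And>c i. i < n \<Longrightarrow> co (L c) i = c i"
    "\<And>u v i. u \<in> E \<Longrightarrow> v \<in> E \<Longrightarrow> i < n \<Longrightarrow> co (u \<oplus> v) i = co u i + co v i"
    "\<And>a u i. u \<in> E \<Longrightarrow> i < n \<Longrightarrow> co (\<iota> a \<otimes> u) i = a * co u i"
    "\<And>c c'. \<forall>i<n. c i = c' i \<Longrightarrow> L c = L c'"
    "\<And>c c'. L (\<lambda>i. c i + c' i) = L c \<oplus> L c'" "\<And>a c. L (\<lambda>i. a * c i) = \<iota> a \<otimes> L c"
proof -
  obtain L where E: "E \<subseteq> carrier R" and rL: "range L = E" and inj: "\<And>c c'. L c = L c' \<longleftrightarrow> (\<forall>i<n. c i = c' i)"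
    and add: "\<And>c c'. L (\<lambda>i. c i + c' i) = L c \<oplus> L c'" and scale: "\<And>a c. L (\<lambda>i. a * c i) = \<iota> a \<otimes> L c"
    using dimension_coordinates[OF assms] by blast
  define co where "co u = (SOME c. L c = u)" for u
  have Lco: "L (co u) = u" if "u \<in> E" for u
    unfolding co_def using that rL by (intro someI_ex[of "\<lambda>c. L c = u"]) auto
  have coL: "co (L c) i = c i" if "i < n" for c i
    using Lco[of "L c"] rL inj that by blast
  show ?thesis
  proof (rule that[of L co])
    show "co (u \<oplus> v) i = co u i + co v i" if "u \<in> E" "v \<in> E" "i < n" for u v i
      using coL[OF that(3), of "\<lambda>i. co u i + co v i"] that add Lco by simp
    show "co (\<iota> a \<otimes> u) i = a * co u i" if "u \<in> E" "i < n" for a u i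
      using coL[OF that(2), of "\<lambda>i. a * co u i"] that scale Lco by simp
    show "L c = L c'" if "\<forall>i<n. c i = c' i" for c c' using inj that by blast
  qed (use E rL Lco coL add scale in auto)
qed

lemma L_expand:
  fixes L :: "(nat \<Rightarrow> 'k) \<Rightarrow> 'a" and F :: "'a \<Rightarrow> 'k"
  assumes L: "\<And>c. L c \<in> carrier R" "\<And>c c'. (\<And>i. i < n \<Longrightarrow> c i = c' i) \<Longrightarrow> L c = L c'"
    "\<And>c c'. L (\<lambda>i. c i + c' i) = L c \<oplus> L c'" "\<And>a c. L (\<lambda>i. a * c i) = \<iota> a \<otimes> L c"
    and F: "\<And>u v. u \<in> carrier R \<Longrightarrow> v \<in> carrier R \<Longrightarrow> F (u \<oplus> v) = F u + F v"
    "\<And>a u. u \<in> carrier R \<Longrightarrow> F (\<iota> a \<otimes> u) = a * F u"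
  shows "F (L c) = (\<Sum>j<n. c j * F (L (\<lambda>i. if i = j then 1 else 0)))"
proof -
  have "F (L (\<lambda>i. if i < m then c i else 0)) = (\<Sum>j<m. c j * F (L (\<lambda>i. if i = j then 1 else 0)))" for m
  proof (induction m)
    case 0
    have "F (L (\<lambda>i. 0 * c i)) = 0" unfolding L(4) F(2)[OF L(1)] by simp
    then show ?case by simp
  next
    case (Suc m)
    have "(\<lambda>i. if i < Suc m then c i else 0) = (\<lambda>i. (if i < m then c i else 0) + c m * (if i = m then 1 else 0))"
      by (auto simp: fun_eq_iff less_Suc_eq)
    then have "F (L (\<lambda>i. if i < Suc m then c i else 0)) = F (L (\<lambda>i. if i < m then c i else 0)) + c m * F (L (\<lambda>i. if i = m then 1 else 0))"
      using L(3)[of "\<lambda>i. if i < m then c i else 0" "\<lambda>i. c m * (if i = m then 1 else 0)"]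
        L(4)[of "c m" "\<lambda>i. if i = m then 1 else 0"] F L(1) by simp
    then show ?case using Suc by simp
  qed
  from this[of n] show ?thesis using L(2)[of c "\<lambda>i. if i < n then c i else 0"] by simp
qed

end

locale odd_closed_scalars = scalars R \<iota> for R :: "('a, 'b) ring_scheme" (structure) and \<iota> :: "'k::field_char_0 \<Rightarrow> 'a" +
  assumes odd_closed: "\<And>p :: 'k poly. odd (degree p) \<Longrightarrow> \<exists>x. poly p x = 0"
begin

text \<open>Multiplication by \<open>z\<close> is a linear operator on an odd-dimensional space and
  has an eigenvector; cancelling that nonzero element of the field leaves \<open>z\<close> equal to
  its eigenvalue.\<close>

lemma odd_stable_space_scalar:
  assumes z: "z \<in> carrier R" and d: "dimension n K E" and n: "odd n" and st: "\<And>u. u \<in> E \<Longrightarrow> z \<otimes> u \<in> E"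
  shows "z \<in> K"
proof -
  obtain L co where E: "E \<subseteq> carrier R" and L: "\<And>c. L c \<in> E" "\<And>u. u \<in> E \<Longrightarrow> L (co u) = u" "\<And>c i. i < n \<Longrightarrow> co (L c) i = c i"
    and co: "\<And>u v i. u \<in> E \<Longrightarrow> v \<in> E \<Longrightarrow> i < n \<Longrightarrow> co (u \<oplus> v) i = co u i + co v i"
    "\<And>a u i. u \<in> E \<Longrightarrow> i < n \<Longrightarrow> co (\<iota> a \<otimes> u) i = a * co u i"
    and cong: "\<And>c c'. \<forall>i<n. c i = c' i \<Longrightarrow> L c = L c'"
    and lin: "\<And>c c'. L (\<lambda>i. c i + c' i) = L c \<oplus> L c'" "\<And>a c. L (\<lambda>i. a * c i) = \<iota> a \<otimes> L c"
    by (rule coordinates[OF d]) (rule that)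
  have Lc [simp]: "L c \<in> carrier R" for c using E L(1) by blast
  define T where "T c = co (z \<otimes> L c)" for c
  have "\<exists>e b. (\<exists>p\<in>{..<n}. b p \<noteq> 0) \<and> (\<forall>p. p \<notin> {..<n} \<longrightarrow> b p = 0) \<and> (\<forall>p\<in>{..<n}. T b p = e * b p)"
  proof (rule odd_dim_eigenvector[OF odd_closed])
    fix f g :: "nat \<Rightarrow> 'k" and a p assume p: "p \<in> {..<n}"
    have "z \<otimes> L (\<lambda>q. f q + g q) = z \<otimes> L f \<oplus> z \<otimes> L g" unfolding lin using z by (simp add: r_distr)
    then show "T (\<lambda>q. f q + g q) p = T f p + T g p" unfolding T_def using co st L p by simp
    have "z \<otimes> L (\<lambda>q. a * f q) = \<iota> a \<otimes> (z \<otimes> L f)" unfolding lin using z by (simp add: m_lcomm)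
    then show "T (\<lambda>q. a * f q) p = a * T f p" unfolding T_def using co st L p by simp
  qed (use n in auto)
  then obtain e b where b: "\<exists>p<n. b p \<noteq> 0" and ev: "\<And>p. p < n \<Longrightarrow> T b p = e * b p" by auto
  have "z \<otimes> L b = L (T b)" unfolding T_def using L st by simp
  also have "\<dots> = L (\<lambda>i. e * b i)" using ev by (intro cong) blast
  also have "\<dots> = \<iota> e \<otimes> L b" by (rule lin)
  finally have "z \<otimes> L b = \<iota> e \<otimes> L b" .
  moreover have "L b \<noteq> \<zero>"
  proof
    assume "L b = \<zero>"
    also have "\<dots> = L (\<lambda>i. 0 * b i)" unfolding lin by (simp add: emb_0)
    finally have "L b = L (\<lambda>i. 0 * b i)" .
    then have "b p = 0" if "p < n" for p using L(3)[OF that, of b] L(3)[OF that, of "\<lambda>i. 0 * b i"] by simp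
    then show False using b by blast
  qed
  ultimately have "z = \<iota> e" using z by (simp add: m_rcancel)
  then show ?thesis unfolding K_def by blast
qed

text \<open>This is \<open>alternating_eigenform\<close> for the matrix of multiplication by
  \<open>y\<close>, freed from coordinates. Up to the term with \<open>e\<close>, the last clause
  says that \<open>y\<close> is skew-adjoint.\<close>

lemma exists_eigenform:
  assumes d: "dimension d K (carrier R)" "odd (d * (d - 1) div 2)" and y: "y \<in> carrier R"
  shows "\<exists>(\<beta> :: 'a \<Rightarrow> 'a \<Rightarrow> 'k) e. (\<forall>u\<in>carrier R. \<forall>v\<in>carrier R. \<forall>w\<in>carrier R. \<beta> (u \<oplus> v) w = \<beta> u w + \<beta> v w \<and> \<beta> w (u \<oplus> v) = \<beta> w u + \<beta> w v)
    \<and> (\<forall>a. \<forall>u\<in>carrier R. \<forall>w\<in>carrier R. \<beta> (\<iota> a \<otimes> u) w = a * \<beta> u w \<and> \<beta> w (\<iota> a \<otimes> u) = a * \<beta> w u)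
    \<and> (\<exists>u\<in>carrier R. \<exists>v\<in>carrier R. \<beta> u v \<noteq> 0)
    \<and> (\<forall>u\<in>carrier R. \<forall>v\<in>carrier R. \<beta> (y \<otimes> u) v + \<beta> u (y \<otimes> v) = e * \<beta> u v)"
proof -
  obtain L co where E: "carrier R \<subseteq> carrier R" and L: "\<And>c. L c \<in> carrier R" "\<And>u. u \<in> carrier R \<Longrightarrow> L (co u) = u" "\<And>c i. i < d \<Longrightarrow> co (L c) i = c i"
    and co: "\<And>u v i. u \<in> carrier R \<Longrightarrow> v \<in> carrier R \<Longrightarrow> i < d \<Longrightarrow> co (u \<oplus> v) i = co u i + co v i"
    "\<And>a u i. u \<in> carrier R \<Longrightarrow> i < d \<Longrightarrow> co (\<iota> a \<otimes> u) i = a * co u i"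
    and cong: "\<And>c c'. \<forall>i<d. c i = c' i \<Longrightarrow> L c = L c'"
    and lin: "\<And>c c'. L (\<lambda>i. c i + c' i) = L c \<oplus> L c'" "\<And>a c. L (\<lambda>i. a * c i) = \<iota> a \<otimes> L c"
    by (rule coordinates[OF d(1)]) (rule that)
  define \<delta> where "\<delta> j = L (\<lambda>i. if i = j then 1 else 0)" for j
  have \<delta>: "\<delta> j \<in> carrier R" for j unfolding \<delta>_def by (rule L)
  have co\<delta>: "co (\<delta> j) i = (if i = j then 1 else 0)" if "i < d" for i j
    unfolding \<delta>_def L(3)[OF that] by simp
  define A where "A i j = co (y \<otimes> \<delta> j) i" for i j
  obtain e B where B: "\<exists>i<d. \<exists>j<d. B i j \<noteq> 0"
    and eB: "\<And>i j. i < d \<Longrightarrow> j < d \<Longrightarrow> (\<Sum>l<d. A l i * B l j) + (\<Sum>l<d. B i l * A l j) = e * B i j"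
    using alternating_eigenform[OF odd_closed d(2), of A] by blast
  define \<beta> where "\<beta> u v = (\<Sum>i<d. \<Sum>j<d. co u i * B i j * co v j)" for u v
  have add: "\<beta> (u \<oplus> v) w = \<beta> u w + \<beta> v w" "\<beta> w (u \<oplus> v) = \<beta> w u + \<beta> w v"
    if "u \<in> carrier R" "v \<in> carrier R" "w \<in> carrier R" for u v w
    unfolding \<beta>_def sum.distrib[symmetric] by (intro sum.cong refl; use co that in \<open>simp add: algebra_simps\<close>)+
  have scale: "\<beta> (\<iota> a \<otimes> u) w = a * \<beta> u w" "\<beta> w (\<iota> a \<otimes> u) = a * \<beta> w u" if "u \<in> carrier R" "w \<in> carrier R" for a u w
    unfolding \<beta>_def sum_distrib_left by (intro sum.cong refl; use co that in \<open>simp add: algebra_simps\<close>)+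
  have \<beta>l: "\<beta> u (\<delta> j) = (\<Sum>i<d. co u i * B i j)" if "j < d" for u j
  proof -
    have "\<beta> u (\<delta> j) = (\<Sum>i<d. \<Sum>k<d. if k = j then co u i * B i j else 0)"
      unfolding \<beta>_def by (intro sum.cong refl) (simp add: co\<delta>)
    then show ?thesis using that by simp
  qed
  have \<beta>r: "\<beta> (\<delta> i) v = (\<Sum>j<d. B i j * co v j)" if "i < d" for v i
  proof -
    have "\<beta> (\<delta> i) v = (\<Sum>k<d. if k = i then (\<Sum>j<d. B i j * co v j) else 0)"
      unfolding \<beta>_def by (intro sum.cong refl) (simp add: co\<delta>)
    then show ?thesis using that by simp
  qed
  have basis: "\<beta> (y \<otimes> \<delta> i) (\<delta> j) + \<beta> (\<delta> i) (y \<otimes> \<delta> j) = e * \<beta> (\<delta> i) (\<delta> j)" if ij: "i < d" "j < d" for i j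
  proof -
    have "\<beta> (\<delta> i) (\<delta> j) = (\<Sum>l<d. if l = i then B i j else 0)" unfolding \<beta>l[OF ij(2)] by (intro sum.cong refl) (simp add: co\<delta>)
    then have "\<beta> (\<delta> i) (\<delta> j) = B i j" using ij by simp
    then show ?thesis unfolding \<beta>l[OF ij(2), of "y \<otimes> \<delta> i"] \<beta>r[OF ij(1), of "y \<otimes> \<delta> j"] using eB[OF ij] unfolding A_def by simp
  qed
  \<comment> \<open>\<open>G\<close> measures the failure of the eigenform equation. It is bilinear,
    so its vanishing on the basis is enough.\<close>
  define G where "G u v = \<beta> (y \<otimes> u) v + \<beta> u (y \<otimes> v) - e * \<beta> u v" for u v
  have G_add: "G (u \<oplus> v) w = G u w + G v w" "G w (u \<oplus> v) = G w u + G w v"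
    if "u \<in> carrier R" "v \<in> carrier R" "w \<in> carrier R" for u v w
    unfolding G_def using that y by (simp_all add: r_distr add algebra_simps)
  have G_scale: "G (\<iota> a \<otimes> u) w = a * G u w" "G w (\<iota> a \<otimes> u) = a * G w u" if "u \<in> carrier R" "w \<in> carrier R" for a u w
    unfolding G_def using that y by (simp_all add: m_lcomm[of y "\<iota> a"] scale algebra_simps)
  have G0: "G u v = 0" if u: "u \<in> carrier R" and v: "v \<in> carrier R" for u v
  proof -
    have "G (L (co u)) v = (\<Sum>i<d. co u i * G (\<delta> i) v)"
      by (rule L_expand[of L d "\<lambda>u. G u v", folded \<delta>_def]) (use L(1) cong lin G_add G_scale v in auto)
    moreover have "G (\<delta> i) (L (co v)) = (\<Sum>j<d. co v j * G (\<delta> i) (\<delta> j))" if "i < d" for i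
      by (rule L_expand[of L d "\<lambda>v. G (\<delta> i) v", folded \<delta>_def]) (use L(1) cong lin G_add G_scale \<delta> in auto)
    moreover have "G (\<delta> i) (\<delta> j) = 0" if "i < d" "j < d" for i j using basis[OF that] unfolding G_def by simp
    ultimately show ?thesis using L(2) u v by simp
  qed
  have "\<exists>u\<in>carrier R. \<exists>v\<in>carrier R. \<beta> u v \<noteq> 0"
  proof -
    obtain i j where ij: "i < d" "j < d" "B i j \<noteq> 0" using B by blast
    have "\<beta> (\<delta> i) (\<delta> j) = (\<Sum>l<d. if l = i then B i j else 0)" unfolding \<beta>l[OF ij(2)] by (intro sum.cong refl) (simp add: co\<delta>)
    then have "\<beta> (\<delta> i) (\<delta> j) \<noteq> 0" using ij by simp
    then show ?thesis using \<delta> by blast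
  qed
  moreover have "\<beta> (y \<otimes> u) v + \<beta> u (y \<otimes> v) = e * \<beta> u v" if "u \<in> carrier R" "v \<in> carrier R" for u v
    using G0[OF that] unfolding G_def by simp
  ultimately show ?thesis
    by (intro exI[of _ \<beta>] exI[of _ e] conjI ballI allI) (simp_all add: add scale)
qed

section \<open>Towers containing a quadratic step\<close>

lemma quadratic_subfield:
  assumes F: "subfield F R" and y: "y \<in> carrier R" "y \<notin> F" "y \<otimes> y \<in> F"
  shows "subfield (line_extension F y F) R \<and> dimension 2 F (line_extension F y F)"
proof -
  let ?W = "line_extension F y F"
  note Fp = subringE[OF subfieldE(1)[OF F]]
  have Fc [simp]: "a \<in> carrier R" if "a \<in> F" for a using Fp(1) that by blast
  have mem: "u \<in> ?W \<longleftrightarrow> (\<exists>a\<in>F. \<exists>b\<in>F. u = b \<otimes> y \<oplus> a)" for u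
    by (auto simp: line_extension_mem_iff)
  have memI: "b \<otimes> y \<oplus> a \<in> ?W" if "a \<in> F" "b \<in> F" for a b
    unfolding mem using that by blast
  have inv_F: "inv a \<in> F" if "a \<in> F" "a \<noteq> \<zero>" for a
    using subfield_m_inv(1)[OF F, of a] that by simp
  have "subfield ?W R"
  proof (rule subfieldI')
    show "subring ?W R"
    proof (rule subringI)
      show "?W \<subseteq> carrier R" using line_extension_in_carrier[OF Fp(1) y(1) Fp(1)] .
      show "\<one> \<in> ?W" unfolding mem using Fp(2,3) y(1) by (intro bexI[of _ \<one>] bexI[of _ \<zero>]) auto
      fix u v assume u: "u \<in> ?W" and v: "v \<in> ?W"
      obtain a b where ab: "a \<in> F" "b \<in> F" and ue: "u = b \<otimes> y \<oplus> a" using u unfolding mem by blast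
      obtain c d where cd: "c \<in> F" "d \<in> F" and ve: "v = d \<otimes> y \<oplus> c" using v unfolding mem by blast
      have "\<ominus> u = (\<ominus> b) \<otimes> y \<oplus> (\<ominus> a)" unfolding ue using ab y(1) by (simp add: minus_add l_minus)
      then show "\<ominus> u \<in> ?W" using memI[OF Fp(5)[OF ab(1)] Fp(5)[OF ab(2)]] by simp
      have "u \<oplus> v = (b \<oplus> d) \<otimes> y \<oplus> (a \<oplus> c)" unfolding ue ve using ab cd y(1) by (simp add: l_distr a_ac)
      then show "u \<oplus> v \<in> ?W" using memI[OF Fp(7)[OF ab(1) cd(1)] Fp(7)[OF ab(2) cd(2)]] by simp
      have "u \<otimes> v = (b \<otimes> c \<oplus> a \<otimes> d) \<otimes> y \<oplus> (b \<otimes> d \<otimes> (y \<otimes> y) \<oplus> a \<otimes> c)"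
        unfolding ue ve using ab cd y(1) by (simp add: l_distr r_distr a_ac m_ac)
      moreover have "b \<otimes> c \<oplus> a \<otimes> d \<in> F" "b \<otimes> d \<otimes> (y \<otimes> y) \<oplus> a \<otimes> c \<in> F"
        by (intro Fp(6,7) ab cd y(3))+
      ultimately show "u \<otimes> v \<in> ?W" using memI by simp
    qed
    fix u assume u: "u \<in> ?W - {\<zero>}"
    then have "u \<in> ?W" by simp
    then obtain a b where ab: "a \<in> F" "b \<in> F" and ue: "u = b \<otimes> y \<oplus> a" unfolding mem by blast
    show "inv u \<in> ?W"
    proof (cases "b = \<zero>")
      case True
      then have "u = a" unfolding ue using ab y(1) by simp
      then have "inv u = \<zero> \<otimes> y \<oplus> inv a" using u ab y(1) inv_F[of a] by simp
      moreover have "inv a \<in> F" using inv_F[of a] ab u \<open>u = a\<close> by blast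
      ultimately show ?thesis using memI[OF _ Fp(2)] by simp
    next
      case False
      \<comment> \<open>Up to sign this is the conjugate of \<open>u\<close>: the product is b^2 y^2
        - a^2 in \<open>F\<close>, and \<open>w\<close> is nonzero because \<open>y\<close> is not
        in \<open>F\<close>. Thus the inverse of \<open>u\<close> is \<open>w\<close> divided by an
        element of \<open>F\<close>.\<close>
      define w where "w = b \<otimes> y \<oplus> \<ominus> a"
      have w: "w \<in> carrier R" unfolding w_def using ab y(1) by simp
      have "w \<noteq> \<zero>"
      proof
        assume "w = \<zero>"
        then have "b \<otimes> y = a" unfolding w_def using ab y(1)
          by (metis Fc a_inv_closed add.inv_equality m_closed minus_minus)
        then have "inv b \<otimes> a = inv b \<otimes> (b \<otimes> y)" by simp
        also have "\<dots> = y" using inv_F[OF ab(2) False] ab y(1) False subfield_m_inv(3)[OF F, of b] by (simp add: m_assoc[symmetric])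
        finally have "y = inv b \<otimes> a" by simp
        then show False using y(2) Fp(6)[OF inv_F[OF ab(2) False] ab(1)] by simp
      qed
      have uc: "u \<in> carrier R" "u \<noteq> \<zero>" using u ab y(1) ue by auto
      define n where "n = b \<otimes> b \<otimes> (y \<otimes> y) \<oplus> \<ominus> (a \<otimes> a)"
      have nF: "n \<in> F" unfolding n_def by (intro Fp(5,6,7) ab y(3))
      have "u \<otimes> w = b \<otimes> y \<otimes> (b \<otimes> y) \<oplus> (\<ominus> (b \<otimes> y \<otimes> a) \<oplus> (b \<otimes> y \<otimes> a \<oplus> \<ominus> (a \<otimes> a)))"
        unfolding ue w_def using ab y(1) by (simp add: l_distr r_distr r_minus a_ac m_ac)
      also have "\<dots> = n" unfolding n_def using ab y(1) by (simp add: r_neg1 r_neg2 m_ac)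
      finally have uw: "u \<otimes> w = n" .
      have n0: "n \<noteq> \<zero>" using uw uc w \<open>w \<noteq> \<zero>\<close> integral_iff by blast
      have "u \<otimes> (w \<otimes> inv n) = \<one>" using uw uc w inv_F[OF nF n0] subfield_m_inv(2)[OF F, of n] nF n0 by (simp add: m_assoc[symmetric])
      then have "inv u = w \<otimes> inv n" using uc w inv_F[OF nF n0] by (intro comm_inv_char) auto
      also have "\<dots> = (b \<otimes> inv n) \<otimes> y \<oplus> (\<ominus> a \<otimes> inv n)" unfolding w_def using ab y(1) inv_F[OF nF n0] by (simp add: l_distr r_distr m_ac)
      finally have "inv u = (b \<otimes> inv n) \<otimes> y \<oplus> (\<ominus> a \<otimes> inv n)" .
      moreover have "b \<otimes> inv n \<in> F" "\<ominus> a \<otimes> inv n \<in> F" by (intro Fp(5,6) ab inv_F[OF nF n0])+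
      ultimately show ?thesis using memI by simp
    qed
  qed
  moreover have "dimension 2 F ?W"
    using Suc_dim[OF y(1,2) dimension_one[OF F]] by (simp add: numeral_2_eq_2)
  ultimately show ?thesis by blast
qed

lemma finite_dimension_over_subfield:
  assumes F: "subfield F R" "K \<subseteq> F" and d: "dimension d K (carrier R)"
  shows "finite_dimension F (carrier R)"
proof -
  obtain Us where Us: "set Us \<subseteq> carrier R" "Span K Us = carrier R" using exists_base[OF subfield_K d] by blast
  have sub: "subalgebra F (Span F Us) R" using Span_is_subalgebra[OF F(1) Us(1)] .
  then have "subalgebra K (Span F Us) R" using F(2) unfolding subalgebra_def subalgebra_axioms_def by blast
  then have "Span K Us \<subseteq> Span F Us"
    using subalgebra_Span_incl[OF subfield_K, of "Span F Us" Us] Span_base_incl[OF F(1) Us(1)] by blast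
  moreover have "Span F Us \<subseteq> carrier R" using subalgebra_in_carrier[OF sub] .
  ultimately have "Span F Us = carrier R" using Us(2) by blast
  then show ?thesis using Span_finite_dimension[OF F(1) Us(1)] by simp
qed

text \<open>The degree formula for the tower \<open>K\<close>, \<open>F\<close>, F(y),
  \<open>R\<close>, whose middle step has degree 2.\<close>

lemma quadratic_tower_degree:
  assumes F: "subfield F R" "K \<subseteq> F" and n: "dimension n K F" and d: "dimension d K (carrier R)"
    and y: "y \<in> carrier R" "y \<notin> F" "y \<otimes> y \<in> F"
  shows "2 * n dvd d"
proof -
  define W where "W = line_extension F y F"
  have W: "subfield W R" "dimension 2 F W" using quadratic_subfield[OF F(1) y] unfolding W_def by auto
  have "F \<subseteq> W"
  proof
    fix a assume "a \<in> F"
    then have "a = \<zero> \<otimes> y \<oplus> a" using y(1) subringE(1)[OF subfieldE(1)[OF F(1)]] by auto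
    then show "a \<in> W" unfolding W_def line_extension_mem_iff using \<open>a \<in> F\<close> subringE(2)[OF subfieldE(1)[OF F(1)]] by blast
  qed
  then obtain m where m: "dimension m W (carrier R)"
    using finite_dimension_over_subfield[OF W(1) _ d] F(2) unfolding finite_dimension_def by blast
  have "dimension (n * 2) K W" using telescopic_base[OF subfield_K F(1) n W(2)] .
  then have "dimension (n * 2 * m) K (carrier R)" using telescopic_base[OF subfield_K W(1) _ m] by blast
  then have "d = n * 2 * m" using dimension_is_inj[OF subfield_K d] by blast
  then show ?thesis by simp
qed

text \<open>
  An eigenform of \<open>y\<close> makes a translate of \<open>y\<close> skew-adjoint. The elements self-adjoint for the form are a
  subfield \<open>Z\<close> which contains \<open>y\<^sup>2\<close> but not \<open>y\<close>, so \<open>2 [Z : K]\<close> divides the degree \<open>d\<close>; when 4 does not divide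
  \<open>d\<close>, the degree of \<open>Z\<close> is odd and \<open>y\<^sup>2\<close> is a scalar.
\<close>

lemma translate_square_scalar:
  assumes d: "dimension d K (carrier R)" "d mod 4 = 2" and y0: "y0 \<in> carrier R"
  shows "\<exists>c. (y0 \<ominus> \<iota> c) \<otimes> (y0 \<ominus> \<iota> c) \<in> K"
proof -
  have "odd (d * (d - 1) div 2)"
  proof -
    have "d = 4 * (d div 4) + 2" using d(2) by presburger
    then obtain k where "d = 4 * k + 2" by blast
    then have "d * (d - 1) div 2 = (2 * k + 1) * (4 * k + 1)" by (simp add: algebra_simps)
    then show ?thesis by simp
  qed
  then obtain \<beta> :: "'a \<Rightarrow> 'a \<Rightarrow> 'k" and e where
    add: "\<And>u v w. u \<in> carrier R \<Longrightarrow> v \<in> carrier R \<Longrightarrow> w \<in> carrier R \<Longrightarrow> \<beta> (u \<oplus> v) w = \<beta> u w + \<beta> v w \<and> \<beta> w (u \<oplus> v) = \<beta> w u + \<beta> w v"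
    and scale: "\<And>a u w. u \<in> carrier R \<Longrightarrow> w \<in> carrier R \<Longrightarrow> \<beta> (\<iota> a \<otimes> u) w = a * \<beta> u w \<and> \<beta> w (\<iota> a \<otimes> u) = a * \<beta> w u"
    and nz: "\<exists>u\<in>carrier R. \<exists>v\<in>carrier R. \<beta> u v \<noteq> 0"
    and ev: "\<And>u v. u \<in> carrier R \<Longrightarrow> v \<in> carrier R \<Longrightarrow> \<beta> (y0 \<otimes> u) v + \<beta> u (y0 \<otimes> v) = e * \<beta> u v"
    using exists_eigenform[OF d(1) _ y0] by blast
  \<comment> \<open>Subtracting half the eigenvalue spreads \<open>e\<close> evenly over the two
    slots of the form, so that it disappears from the equation.\<close>
  define y where "y = y0 \<oplus> \<iota> (- (e / 2))"
  have y: "y \<in> carrier R" unfolding y_def using y0 by simp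
  have skew: "\<beta> (y \<otimes> u) v = - \<beta> u (y \<otimes> v)" if uv: "u \<in> carrier R" "v \<in> carrier R" for u v
  proof -
    have "\<beta> (y \<otimes> u) v = \<beta> (y0 \<otimes> u) v + (- (e / 2)) * \<beta> u v" "\<beta> u (y \<otimes> v) = \<beta> u (y0 \<otimes> v) + (- (e / 2)) * \<beta> u v"
      unfolding y_def using uv y0 by (simp_all add: l_distr add scale)
    moreover have "(- (e / 2)) * \<beta> u v + (- (e / 2)) * \<beta> u v = - (e * \<beta> u v)"
      by (simp only: distrib_right[symmetric]) simp
    ultimately have "\<beta> (y \<otimes> u) v + \<beta> u (y \<otimes> v) = (\<beta> (y0 \<otimes> u) v + \<beta> u (y0 \<otimes> v)) + - (e * \<beta> u v)"
      by (rule add_eq_add_halves)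
    then show ?thesis using ev[OF uv] by (simp add: eq_neg_iff_add_eq_0)
  qed
  have "y \<otimes> y \<in> K"
  proof (cases "y = \<zero>")
    case True
    then show ?thesis using subringE(2)[OF subfieldE(1)[OF subfield_K]] by simp
  next
    case False
    define Z where "Z = {z \<in> carrier R. \<forall>u\<in>carrier R. \<forall>v\<in>carrier R. \<beta> (z \<otimes> u) v = \<beta> u (z \<otimes> v)}"
    have ZI: "z \<in> Z" if "z \<in> carrier R" "\<And>u v. u \<in> carrier R \<Longrightarrow> v \<in> carrier R \<Longrightarrow> \<beta> (z \<otimes> u) v = \<beta> u (z \<otimes> v)" for z
      using that unfolding Z_def by blast
    have ZD: "z \<in> carrier R" "\<And>u v. u \<in> carrier R \<Longrightarrow> v \<in> carrier R \<Longrightarrow> \<beta> (z \<otimes> u) v = \<beta> u (z \<otimes> v)" if "z \<in> Z" for z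
      using that unfolding Z_def by blast+
    have KZ: "K \<subseteq> Z"
    proof
      fix k assume "k \<in> K"
      then obtain a where "k = \<iota> a" unfolding K_def by blast
      then show "k \<in> Z" using scale by (intro ZI) auto
    qed
    have Zm: "z \<otimes> z' \<in> Z" if z: "z \<in> Z" "z' \<in> Z" for z z'
    proof (rule ZI)
      fix u v assume uv: "u \<in> carrier R" "v \<in> carrier R"
      have "\<beta> (z \<otimes> z' \<otimes> u) v = \<beta> (z' \<otimes> u) (z \<otimes> v)" using ZD[OF z(1)] ZD[OF z(2)] uv by (simp add: m_assoc)
      also have "\<dots> = \<beta> u (z' \<otimes> (z \<otimes> v))" using ZD[OF z(1)] ZD[OF z(2)] uv by simp
      also have "z' \<otimes> (z \<otimes> v) = z \<otimes> z' \<otimes> v" using ZD(1)[OF z(1)] ZD(1)[OF z(2)] uv by (simp add: m_ac)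
      finally show "\<beta> (z \<otimes> z' \<otimes> u) v = \<beta> u (z \<otimes> z' \<otimes> v)" .
    qed (use ZD(1) z in simp)
    have Za: "z \<oplus> z' \<in> Z" if z: "z \<in> Z" "z' \<in> Z" for z z'
      using ZD[OF z(1)] ZD[OF z(2)] by (intro ZI) (auto simp: l_distr add)
    have neg: "\<ominus> z = \<iota> (- 1) \<otimes> z" if "z \<in> carrier R" for z using that by (simp add: emb_uminus emb_1 l_minus)
    have "subfield Z R"
    proof (rule subfieldI')
      show "subring Z R"
      proof (rule subringI)
        show "Z \<subseteq> carrier R" unfolding Z_def by blast
        show "\<one> \<in> Z" by (rule ZI) auto
        show "\<ominus> h \<in> Z" if h: "h \<in> Z" for h
        proof -
          have "\<iota> (- 1) \<in> Z" using KZ unfolding K_def by blast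
          then show ?thesis using neg[OF ZD(1)[OF h]] Zm h by simp
        qed
      qed (use Zm Za in auto)
      fix z assume z: "z \<in> Z - {\<zero>}"
      then have zc: "z \<in> carrier R" "z \<noteq> \<zero>" using ZD by auto
      then have iz: "inv z \<in> carrier R" "z \<otimes> inv z = \<one>" using field_Units by auto
      show "inv z \<in> Z"
      proof (rule ZI)
        fix u v assume uv: "u \<in> carrier R" "v \<in> carrier R"
        have c: "z \<otimes> (inv z \<otimes> x) = x" if "x \<in> carrier R" for x using that iz zc by (simp add: m_assoc[symmetric])
        have "\<beta> (inv z \<otimes> u) v = \<beta> (inv z \<otimes> u) (z \<otimes> (inv z \<otimes> v))" using c uv by simp
        also have "\<dots> = \<beta> (z \<otimes> (inv z \<otimes> u)) (inv z \<otimes> v)" using ZD(2)[of z "inv z \<otimes> u" "inv z \<otimes> v"] z uv iz by simp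
        also have "\<dots> = \<beta> u (inv z \<otimes> v)" using c uv by simp
        finally show "\<beta> (inv z \<otimes> u) v = \<beta> u (inv z \<otimes> v)" .
      qed (use iz in simp)
    qed
    have "y \<otimes> y \<in> Z"
    proof (rule ZI)
      fix u v assume uv: "u \<in> carrier R" "v \<in> carrier R"
      have "\<beta> (y \<otimes> y \<otimes> u) v = - \<beta> (y \<otimes> u) (y \<otimes> v)" using skew[of "y \<otimes> u" v] uv y by (simp add: m_assoc)
      also have "\<dots> = \<beta> u (y \<otimes> (y \<otimes> v))" using skew[of u "y \<otimes> v"] uv y by simp
      finally show "\<beta> (y \<otimes> y \<otimes> u) v = \<beta> u (y \<otimes> y \<otimes> v)" using uv y by (simp add: m_assoc)
    qed (use y in simp)
    have "y \<notin> Z"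
    proof
      assume "y \<in> Z"
      have iy: "inv y \<in> carrier R" "y \<otimes> inv y = \<one>" using field_Units False y by auto
      have "\<beta> u v = 0" if uv: "u \<in> carrier R" "v \<in> carrier R" for u v
      proof -
        have "y \<otimes> (inv y \<otimes> u) = u" using uv iy y by (simp add: m_assoc[symmetric])
        \<comment> \<open>If \<open>y\<close> were self-adjoint as well as skew-adjoint, then,
          \<open>y\<close> being invertible, every value of the form would equal its own
          negative.\<close>
        moreover have "\<beta> (y \<otimes> (inv y \<otimes> u)) v = - \<beta> (y \<otimes> (inv y \<otimes> u)) v"
          using skew[of "inv y \<otimes> u" v] ZD(2)[OF \<open>y \<in> Z\<close>, of "inv y \<otimes> u" v] uv iy by simp
        ultimately show ?thesis by simp
      qed
      then show False using nz by blast
    qed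
    have "subalgebra K Z R"
    proof -
      have "subgroup Z (add_monoid R)" using subring.axioms(1)[OF subfieldE(1)[OF \<open>subfield Z R\<close>]] by (simp add: additive_subgroup_def)
      then show ?thesis using Zm KZ unfolding subalgebra_def subalgebra_axioms_def by blast
    qed
    then obtain n where n: "dimension n K Z"
      using subalbegra_incl_imp_finite_dimension[OF subfield_K finite_dimensionI[OF d(1)]] ZD(1) unfolding finite_dimension_def by blast
    have "2 * n dvd d" using quadratic_tower_degree[OF \<open>subfield Z R\<close> KZ n d(1) y \<open>y \<notin> Z\<close> \<open>y \<otimes> y \<in> Z\<close>] .
    then have "odd n" using d(2) by (auto elim!: dvdE evenE) 
    \<comment> \<open>\<open>Z\<close> is stable under multiplication by its own element y^2, which
      is all that the eigenvector argument asks of it.\<close>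
    then show ?thesis using odd_stable_space_scalar[OF _ n] Zm \<open>y \<otimes> y \<in> Z\<close> y by blast
  qed
  then show ?thesis unfolding y_def emb_uminus minus_eq by blast
qed

text \<open>The conclusion treats degrees 1 and 2 uniformly: in degree 1 the generator is
  \<open>y = \<zero>\<close>, otherwise \<open>y\<close> is a square root outside \<open>K\<close>.
  In the second case every element has a translate whose square is a scalar, and these translates
  are compared with the quadratic field generated by the first one.\<close>

theorem degree_not_dvd_4:
  assumes d: "dimension d K (carrier R)" "\<not> 4 dvd d"
  shows "\<exists>y\<in>carrier R. \<exists>a. y \<otimes> y = \<iota> a \<and> (y \<in> K \<longrightarrow> y = \<zero>) \<and> (\<forall>z\<in>carrier R. \<exists>p q. z = \<iota> p \<oplus> \<iota> q \<otimes> y)"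
proof (cases "carrier R = K")
  case True
  have "\<forall>z\<in>carrier R. \<exists>p q. z = \<iota> p \<oplus> \<iota> q \<otimes> \<zero>" unfolding True using emb_closed by (auto simp: K_def)
  then show ?thesis by (intro bexI[of _ \<zero>] exI[of _ 0]) (auto simp: emb_0)
next
  case False
  have "even d"
  proof (rule ccontr)
    assume "odd d"
    then have "carrier R \<subseteq> K" using odd_stable_space_scalar[OF _ d(1)] by auto
    then show False using False K_subset by blast
  qed
  then have d2: "d mod 4 = 2" using d(2) by presburger
  obtain y0 where y0: "y0 \<in> carrier R" "y0 \<notin> K" using False K_subset by blast
  note Kp = subringE[OF subfieldE(1)[OF subfield_K]]
  obtain c where c: "(y0 \<ominus> \<iota> c) \<otimes> (y0 \<ominus> \<iota> c) \<in> K" using translate_square_scalar[OF d(1) d2 y0(1)] by blast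
  define y where "y = y0 \<ominus> \<iota> c"
  have y: "y \<in> carrier R" "y \<otimes> y \<in> K" unfolding y_def using c y0(1) by auto
  have shift: "x = (x \<ominus> \<iota> c) \<oplus> \<iota> c" if "x \<in> carrier R" for x c using that by (simp add: minus_eq a_assoc l_neg)
  have "y \<notin> K"
  proof
    assume "y \<in> K"
    then have "y \<oplus> \<iota> c \<in> K" using Kp(7) K_def by blast
    then show False using shift[OF y0(1), of c] y0(2) unfolding y_def by simp
  qed
  define F where "F = line_extension K y K"
  have F: "subfield F R" "dimension 2 K F" using quadratic_subfield[OF subfield_K y(1) \<open>y \<notin> K\<close> y(2)] unfolding F_def by auto
  have memF: "z \<in> F \<longleftrightarrow> (\<exists>p q. z = \<iota> p \<oplus> \<iota> q \<otimes> y)" for z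
    unfolding F_def line_extension_mem_iff K_def using y(1) by (auto simp: a_comm; metis a_comm emb_closed m_closed)
  have KF: "K \<subseteq> F"
  proof
    fix k assume "k \<in> K"
    then obtain a where "k = \<iota> a" unfolding K_def by blast
    then have "k = \<iota> a \<oplus> \<iota> 0 \<otimes> y" using y(1) by (simp add: emb_0)
    then show "k \<in> F" unfolding memF by blast
  qed
  have "z \<in> F" if z: "z \<in> carrier R" for z
  proof -
    obtain c where c: "(z \<ominus> \<iota> c) \<otimes> (z \<ominus> \<iota> c) \<in> K" using translate_square_scalar[OF d(1) d2 z] by blast
    have "z \<ominus> \<iota> c \<in> F"
    proof (rule ccontr)
      assume n: "z \<ominus> \<iota> c \<notin> F"
      \<comment> \<open>A translate outside \<open>F\<close> would generate a quadratic extension of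
        \<open>F\<close>, itself quadratic over \<open>K\<close>.\<close>
      have "2 * 2 dvd d" by (rule quadratic_tower_degree[OF F(1) KF F(2) d(1) _ n subsetD[OF KF c]]) (use z in simp)
      then show False using d(2) by simp
    qed
    moreover have "\<iota> c \<in> F" using KF unfolding K_def by blast
    ultimately have "(z \<ominus> \<iota> c) \<oplus> \<iota> c \<in> F" using subringE(7)[OF subfieldE(1)[OF F(1)]] by blast
    then show ?thesis using shift[OF z, of c] by simp
  qed
  moreover obtain a where "y \<otimes> y = \<iota> a" using y(2) unfolding K_def by blast
  ultimately show ?thesis using y(1) \<open>y \<notin> K\<close> memF by blast
qed

end

section \<open>Polynomials over the image of a field\<close>

abbreviation lookup :: "('a \<Rightarrow>\<^sub>0 'b::zero) \<Rightarrow> 'a \<Rightarrow> 'b" where "lookup \<equiv> Poly_Mapping.lookup"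

text \<open>A second model of polynomials, in which ring arithmetic and cancellation come from type
  classes. Arguments about ideals are carried out here and moved to the record
  \<open>hcoord_ring\<close> by the map \<Phi>.\<close>

type_synonym 'k mpoly = "nat multiset \<Rightarrow>\<^sub>0 'k"

lemma sum_nonzero_ex: "sum f A \<noteq> 0 \<Longrightarrow> \<exists>i\<in>A. f i \<noteq> 0"
  by (metis sum.neutral)

lemma finite_submultisets: "finite {a. a \<subseteq># m}"
proof (induction m)
  case (add x m)
  have "{a. a \<subseteq># add_mset x m} \<subseteq> {a. a \<subseteq># m} \<union> add_mset x ` {a. a \<subseteq># m}"
  proof
    fix a assume a: "a \<in> {a. a \<subseteq># add_mset x m}"
    show "a \<in> {a. a \<subseteq># m} \<union> add_mset x ` {a. a \<subseteq># m}"
    proof (cases "x \<in># a")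
      case True
      then have "a = add_mset x (a - {#x#})" by simp
      moreover have "a - {#x#} \<subseteq># m" using a by (simp add: subset_eq_diff_conv)
      ultimately show ?thesis by blast
    next
      case False
      have "count a y \<le> count m y" for y
        using a False mset_subset_eq_count[of a "add_mset x m" y] by (cases "y = x") (auto simp: not_in_iff)
      then show ?thesis by (simp add: subseteq_mset_def)
    qed
  qed
  then show ?case using add finite_subset by blast
qed simp

text \<open>This brings the product to the shape used in \<open>hcoord_ring\<close>: a pair of
  monomials with product \<open>m\<close> is a submultiset of \<open>m\<close> together with its
  complement.\<close>

lemma lookup_mult_submultisets:
  fixes p q :: "'k::semiring_0 mpoly"
  shows "lookup (p * q) m = (\<Sum>a | a \<subseteq># m. lookup p a * lookup q (m - a))"
proof -
  have inner: "(\<Sum>b. lookup q b when m = a + b) = (if a \<subseteq># m then lookup q (m - a) else 0)" for a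
  proof (cases "a \<subseteq># m")
    case True
    then have "(lookup q b when m = a + b) = (lookup q b when b = m - a)" for b
      by (auto simp: when_def)
    then show ?thesis using True by simp
  next
    case False
    then have "(lookup q b when m = a + b) = 0" for b by (auto simp: when_def)
    then show ?thesis using False by simp
  qed
  have "lookup (p * q) m = (\<Sum>a. lookup p a * (if a \<subseteq># m then lookup q (m - a) else 0))"
    unfolding lookup_mult inner ..
  also have "\<dots> = (\<Sum>a | a \<subseteq># m. lookup p a * (if a \<subseteq># m then lookup q (m - a) else 0))"
    by (rule Sum_any.expand_superset[OF finite_submultisets]) (auto split: if_splits)
  finally show ?thesis by simp
qed

lemma lookup_mult_nonzero:
  fixes p q :: "'k::semiring_0 mpoly"
  assumes "lookup (p * q) m \<noteq> 0"
  shows "\<exists>a. a \<subseteq># m \<and> lookup p a \<noteq> 0 \<and> lookup q (m - a) \<noteq> 0"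
proof (rule ccontr)
  assume n: "\<not> ?thesis"
  have "lookup p a * lookup q (m - a) = 0" if "a \<subseteq># m" for a
    using n that by (cases "lookup p a = 0") auto
  then have "lookup (p * q) m = 0" unfolding lookup_mult_submultisets by (intro sum.neutral) auto
  then show False using assms by simp
qed

lemma lookup_single_mult:
  fixes p :: "'k::semiring_0 mpoly"
  shows "lookup (Poly_Mapping.single m c * p) m' = (if m \<subseteq># m' then c * lookup p (m' - m) else 0)"
proof -
  have "lookup (Poly_Mapping.single m c * p) m' = (\<Sum>a | a \<subseteq># m'. if a = m then c * lookup p (m' - m) else 0)"
    unfolding lookup_mult_submultisets by (intro sum.cong refl) (auto simp: lookup_single when_def)
  then show ?thesis by (simp add: finite_submultisets)
qed

lemma poly_mapping_sum_single: "p = (\<Sum>m\<in>Poly_Mapping.keys p. Poly_Mapping.single m (lookup p m))"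
  by (rule poly_mapping_eqI) (simp add: lookup_sum lookup_single when_def in_keys_iff)

definition vars_le :: "nat \<Rightarrow> 'k::zero mpoly set" where
  "vars_le n = {p. \<forall>m. lookup p m \<noteq> 0 \<longrightarrow> set_mset m \<subseteq> {..n}}"

lemma vars_leI: "(\<And>m. lookup p m \<noteq> 0 \<Longrightarrow> set_mset m \<subseteq> {..n}) \<Longrightarrow> p \<in> vars_le n"
  and vars_leD: "p \<in> vars_le n \<Longrightarrow> lookup p m \<noteq> 0 \<Longrightarrow> set_mset m \<subseteq> {..n}"
  unfolding vars_le_def by auto

lemma vars_le_0 [simp]: "0 \<in> vars_le n"
  unfolding vars_le_def by simp

lemma vars_le_single: "set_mset m \<subseteq> {..n} \<Longrightarrow> Poly_Mapping.single m c \<in> vars_le n"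
  unfolding vars_le_def by (auto simp: lookup_single when_def)

lemma vars_le_1 [simp]: "1 \<in> vars_le n"
  unfolding single_one[symmetric] by (rule vars_le_single) simp

lemma vars_le_add: "p \<in> vars_le n \<Longrightarrow> q \<in> vars_le n \<Longrightarrow> p + q \<in> vars_le n"
  unfolding vars_le_def by (auto simp: lookup_add) (metis add.right_neutral atMost_iff subset_eq)+

lemma vars_le_uminus: "(p :: 'k::ab_group_add mpoly) \<in> vars_le n \<Longrightarrow> - p \<in> vars_le n"
  unfolding vars_le_def by simp

lemma vars_le_mult:
  assumes "(p :: 'k::semiring_0 mpoly) \<in> vars_le n" "q \<in> vars_le n"
  shows "p * q \<in> vars_le n"
proof (rule vars_leI)
  fix m assume "lookup (p * q) m \<noteq> 0"
  then obtain a where a: "a \<subseteq># m" "lookup p a \<noteq> 0" "lookup q (m - a) \<noteq> 0"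
    using lookup_mult_nonzero by blast
  have "set_mset m = set_mset a \<union> set_mset (m - a)"
    using a(1) by (metis set_mset_union subset_mset.add_diff_inverse)
  then show "set_mset m \<subseteq> {..n}" using vars_leD[OF assms(1) a(2)] vars_leD[OF assms(2) a(3)] by simp
qed

lemma vars_le_sum: "(\<And>i. i \<in> A \<Longrightarrow> f i \<in> vars_le n) \<Longrightarrow> sum f A \<in> vars_le n"
  by (induction A rule: infinite_finite_induct) (auto intro: vars_le_add)

definition homog :: "nat \<Rightarrow> 'k::zero mpoly \<Rightarrow> bool" where
  "homog d p \<longleftrightarrow> (\<forall>m. lookup p m \<noteq> 0 \<longrightarrow> size m = d)"

lemma homog_single: "size m = d \<Longrightarrow> homog d (Poly_Mapping.single m c)"
  unfolding homog_def by (auto simp: lookup_single when_def)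

lemma homog_add: "homog d p \<Longrightarrow> homog d q \<Longrightarrow> homog d (p + q)"
  unfolding homog_def by (metis add_0 lookup_add)

lemma homog_0 [simp]: "homog d 0"
  unfolding homog_def by simp

lemma homog_sum: "(\<And>i. i \<in> A \<Longrightarrow> homog d (f i)) \<Longrightarrow> homog d (sum f A)"
  by (induction A rule: infinite_finite_induct) (auto intro: homog_add)

lemma homog_uminus: "homog d (p :: 'k::ab_group_add mpoly) \<Longrightarrow> homog d (- p)"
  unfolding homog_def by simp

lemma homog_mult:
  assumes "homog d (p :: 'k::semiring_0 mpoly)" "homog e q"
  shows "homog (d + e) (p * q)"
  unfolding homog_def
proof (intro allI impI)
  fix m assume "lookup (p * q) m \<noteq> 0"
  then obtain a where a: "a \<subseteq># m" "lookup p a \<noteq> 0" "lookup q (m - a) \<noteq> 0"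
    using lookup_mult_nonzero by blast
  then have "size a = d" "size (m - a) = e" using assms unfolding homog_def by auto
  then show "size m = d + e" using a(1) by (metis size_union subset_mset.add_diff_inverse)
qed

lemma homog_1 [simp]: "homog 0 (1 :: 'k::zero_neq_one mpoly)"
  unfolding homog_def by (auto simp: lookup_one when_def)

text \<open>The ring laws pass to the image of a set closed under the operations. Both the
  transported coefficient field and its coordinate ring are obtained in this way.\<close>

lemma cring_image:
  fixes S :: "('s, 't) ring_scheme" and h :: "'c::comm_ring_1 \<Rightarrow> 's"
  assumes carr: "carrier S = h ` C"
    and C: "0 \<in> C" "1 \<in> C" "\<And>a b. a \<in> C \<Longrightarrow> b \<in> C \<Longrightarrow> a + b \<in> C" "\<And>a b. a \<in> C \<Longrightarrow> b \<in> C \<Longrightarrow> a * b \<in> C" "\<And>a. a \<in> C \<Longrightarrow> - a \<in> C"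
    and hom: "h 0 = \<zero>\<^bsub>S\<^esub>" "h 1 = \<one>\<^bsub>S\<^esub>" "\<And>a b. a \<in> C \<Longrightarrow> b \<in> C \<Longrightarrow> h (a + b) = h a \<oplus>\<^bsub>S\<^esub> h b"
      "\<And>a b. a \<in> C \<Longrightarrow> b \<in> C \<Longrightarrow> h (a * b) = h a \<otimes>\<^bsub>S\<^esub> h b"
  shows "cring S" "\<And>a b. a \<in> C \<Longrightarrow> b \<in> C \<Longrightarrow> h a \<ominus>\<^bsub>S\<^esub> h b = h (a - b)" "\<And>a. a \<in> C \<Longrightarrow> \<ominus>\<^bsub>S\<^esub> h a = h (- a)"
proof -
  show S: "cring S"
  proof (rule cringI)
    show "abelian_group S"
    proof (rule abelian_groupI)
      fix x y z assume "x \<in> carrier S" "y \<in> carrier S" "z \<in> carrier S"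
      then obtain a b c where abc: "x = h a" "y = h b" "z = h c" "a \<in> C" "b \<in> C" "c \<in> C" unfolding carr by blast
      show "x \<oplus>\<^bsub>S\<^esub> y \<in> carrier S" unfolding carr abc using abc C by (simp add: hom(3)[symmetric])
      show "(x \<oplus>\<^bsub>S\<^esub> y) \<oplus>\<^bsub>S\<^esub> z = x \<oplus>\<^bsub>S\<^esub> (y \<oplus>\<^bsub>S\<^esub> z)"
        unfolding abc using abc C by (simp add: hom(3)[symmetric] add.assoc)
      show "x \<oplus>\<^bsub>S\<^esub> y = y \<oplus>\<^bsub>S\<^esub> x" unfolding abc using abc C by (simp add: hom(3)[symmetric] add.commute)
    next
      show "\<zero>\<^bsub>S\<^esub> \<in> carrier S" unfolding carr hom(1)[symmetric] using C by blast
      fix x assume "x \<in> carrier S"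
      then obtain a where a: "x = h a" "a \<in> C" unfolding carr by blast
      show "\<zero>\<^bsub>S\<^esub> \<oplus>\<^bsub>S\<^esub> x = x" unfolding a hom(1)[symmetric] using a C by (simp add: hom(3)[symmetric])
      show "\<exists>y\<in>carrier S. y \<oplus>\<^bsub>S\<^esub> x = \<zero>\<^bsub>S\<^esub>"
        unfolding a hom(1)[symmetric] carr using a C by (intro bexI[of _ "h (- a)"]) (simp_all add: hom(3)[symmetric])
    qed
    show "comm_monoid S"
    proof (rule comm_monoidI)
      fix x y z assume "x \<in> carrier S" "y \<in> carrier S" "z \<in> carrier S"
      then obtain a b c where abc: "x = h a" "y = h b" "z = h c" "a \<in> C" "b \<in> C" "c \<in> C" unfolding carr by blast
      show "x \<otimes>\<^bsub>S\<^esub> y \<in> carrier S" unfolding carr abc using abc C by (simp add: hom(4)[symmetric])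
      show "(x \<otimes>\<^bsub>S\<^esub> y) \<otimes>\<^bsub>S\<^esub> z = x \<otimes>\<^bsub>S\<^esub> (y \<otimes>\<^bsub>S\<^esub> z)"
        unfolding abc using abc C by (simp add: hom(4)[symmetric] mult.assoc)
      show "x \<otimes>\<^bsub>S\<^esub> y = y \<otimes>\<^bsub>S\<^esub> x" unfolding abc using abc C by (simp add: hom(4)[symmetric] mult.commute)
    next
      show "\<one>\<^bsub>S\<^esub> \<in> carrier S" unfolding carr hom(2)[symmetric] using C by blast
      fix x assume "x \<in> carrier S"
      then obtain a where a: "x = h a" "a \<in> C" unfolding carr by blast
      show "\<one>\<^bsub>S\<^esub> \<otimes>\<^bsub>S\<^esub> x = x" unfolding a hom(2)[symmetric] using a C by (simp add: hom(4)[symmetric])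
    qed
    fix x y z assume "x \<in> carrier S" "y \<in> carrier S" "z \<in> carrier S"
    then obtain a b c where abc: "x = h a" "y = h b" "z = h c" "a \<in> C" "b \<in> C" "c \<in> C" unfolding carr by blast
    show "(x \<oplus>\<^bsub>S\<^esub> y) \<otimes>\<^bsub>S\<^esub> z = x \<otimes>\<^bsub>S\<^esub> z \<oplus>\<^bsub>S\<^esub> y \<otimes>\<^bsub>S\<^esub> z"
      unfolding abc using abc C by (simp add: hom(3,4)[symmetric] distrib_right)
  qed
  interpret S: cring S by (rule S)
  show neg: "\<ominus>\<^bsub>S\<^esub> h a = h (- a)" if "a \<in> C" for a
  proof (rule S.minus_equality)
    show "h (- a) \<oplus>\<^bsub>S\<^esub> h a = \<zero>\<^bsub>S\<^esub>" using that C hom(1) by (simp add: hom(3)[symmetric])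
  qed (use that C carr in auto)
  show "h a \<ominus>\<^bsub>S\<^esub> h b = h (a - b)" if "a \<in> C" "b \<in> C" for a b
    using that C neg[of b] hom(3)[of a "- b"] by (simp add: a_minus_def)
qed

section \<open>Moving a field and its polynomials to a record on another type\<close>

locale transport =
  fixes \<phi> :: "'k::field_char_0 \<Rightarrow> 'b"
  assumes inj_phi: "inj \<phi>"
begin

text \<open>The injection \<phi> is merely one of sets: the operations are carried over to its
  range, regardless of any arithmetic on the target type.\<close>

definition k :: "'b ring" where
  "k = \<lparr>carrier = range \<phi>, monoid.mult = (\<lambda>a b. \<phi> (inv_into UNIV \<phi> a * inv_into UNIV \<phi> b)), one = \<phi> 1,
    ring.zero = \<phi> 0, ring.add = (\<lambda>a b. \<phi> (inv_into UNIV \<phi> a + inv_into UNIV \<phi> b))\<rparr>"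

lemma phi_eq_iff [simp]: "\<phi> a = \<phi> b \<longleftrightarrow> a = b"
  using inj_phi by (auto dest: injD)

lemma k_simps [simp]: "carrier k = range \<phi>" "\<phi> a \<otimes>\<^bsub>k\<^esub> \<phi> b = \<phi> (a * b)" "\<phi> a \<oplus>\<^bsub>k\<^esub> \<phi> b = \<phi> (a + b)"
  "\<one>\<^bsub>k\<^esub> = \<phi> 1" "\<zero>\<^bsub>k\<^esub> = \<phi> 0"
  unfolding k_def using inj_phi by simp_all

lemma field_k: "field k"
proof -
  interpret cring k by (rule cring_image[of k \<phi> UNIV]) auto
  show ?thesis
  proof (rule cring_fieldI2)
    fix a assume a: "a \<in> carrier k" "a \<noteq> \<zero>\<^bsub>k\<^esub>"
    then obtain x where x: "a = \<phi> x" "x \<noteq> 0" by auto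
    then show "\<exists>b\<in>carrier k. a \<otimes>\<^bsub>k\<^esub> b = \<one>\<^bsub>k\<^esub>" by (intro bexI[of _ "\<phi> (inverse x)"]) auto
  qed simp
qed

lemma add_pow_k: "add_pow k (n::nat) (\<phi> a) = \<phi> (of_nat n * a)"
proof -
  interpret field k by (rule field_k)
  show ?thesis
  proof (induction n)
    case (Suc n)
    then show ?case by (simp add: add.nat_pow_Suc algebra_simps)
  qed (simp add: add_pow_def)
qed

lemma char_zero_k: "char_zero k"
  unfolding char_zero_def by (simp add: add_pow_k)

lemma finsum_k: "finite A \<Longrightarrow> finsum k (\<lambda>a. \<phi> (f a)) A = \<phi> (sum f A)"
proof -
  interpret field k by (rule field_k)
  show "finite A \<Longrightarrow> finsum k (\<lambda>a. \<phi> (f a)) A = \<phi> (sum f A)"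
    by (induction A rule: finite_induct) auto
qed

definition \<Phi> :: "'k mpoly \<Rightarrow> 'b mpolynomial" where "\<Phi> p = (\<lambda>m. \<phi> (lookup p m))"

abbreviation "S n \<equiv> hcoord_ring k n"

lemma Phi_eq_iff [simp]: "\<Phi> p = \<Phi> q \<longleftrightarrow> p = q"
  unfolding \<Phi>_def by (metis poly_mapping_eqI phi_eq_iff)

lemma Phi_add: "\<Phi> (p + q) = \<Phi> p \<oplus>\<^bsub>S n\<^esub> \<Phi> q"
  unfolding \<Phi>_def hcoord_ring_def by (auto simp: lookup_add)

lemma Phi_0: "\<Phi> 0 = \<zero>\<^bsub>S n\<^esub>"
  unfolding \<Phi>_def hcoord_ring_def by auto

lemma Phi_1: "\<Phi> 1 = \<one>\<^bsub>S n\<^esub>"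
  unfolding \<Phi>_def hcoord_ring_def by (auto simp: lookup_one when_def)

lemma Phi_mult: "\<Phi> (p * q) = \<Phi> p \<otimes>\<^bsub>S n\<^esub> \<Phi> q"
  unfolding \<Phi>_def hcoord_ring_def lookup_mult_submultisets
  by (auto simp: finsum_k[OF finite_submultisets])

lemma carrier_S: "carrier (S n) = \<Phi> ` vars_le n"
proof
  show "\<Phi> ` vars_le n \<subseteq> carrier (S n)"
    unfolding hcoord_ring_def \<Phi>_def using vars_leD by fastforce
  show "carrier (S n) \<subseteq> \<Phi> ` vars_le n"
  proof
    fix f assume "f \<in> carrier (S n)"
    then have f: "\<And>m. f m \<in> range \<phi>" "finite {m. f m \<noteq> \<phi> 0}" "\<And>m. f m \<noteq> \<phi> 0 \<Longrightarrow> set_mset m \<subseteq> {..n}"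
      unfolding hcoord_ring_def by auto
    define g where "g m = inv_into UNIV \<phi> (f m)" for m
    have g: "f m = \<phi> (g m)" for m unfolding g_def using f(1) by (simp add: f_inv_into_f)
    then have "finite {m. g m \<noteq> 0}" using f(2) by simp
    then have lg: "lookup (Abs_poly_mapping g) = g" by simp
    have "f = \<Phi> (Abs_poly_mapping g)" unfolding \<Phi>_def lg using g by auto
    moreover have "Abs_poly_mapping g \<in> vars_le n"
    proof (rule vars_leI)
      fix m assume "lookup (Abs_poly_mapping g) m \<noteq> 0"
      then have "g m \<noteq> 0" unfolding lg .
      then show "set_mset m \<subseteq> {..n}" using f(3)[of m] g by simp
    qed
    ultimately show "f \<in> \<Phi> ` vars_le n" by blast
  qed
qed

lemma cring_S: "cring (S n)"
  and Phi_diff: "p \<in> vars_le n \<Longrightarrow> q \<in> vars_le n \<Longrightarrow> \<Phi> p \<ominus>\<^bsub>S n\<^esub> \<Phi> q = \<Phi> (p - q)"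
  and Phi_uminus: "p \<in> vars_le n \<Longrightarrow> \<ominus>\<^bsub>S n\<^esub> \<Phi> p = \<Phi> (- p)"
  by (rule cring_image[OF carrier_S]; simp add: Phi_0[symmetric] Phi_1[symmetric] vars_le_add vars_le_mult vars_le_uminus Phi_add[symmetric] Phi_mult[symmetric])+

lemma Phi_carrier [simp]: "\<Phi> p \<in> carrier (S n) \<longleftrightarrow> p \<in> vars_le n"
  unfolding carrier_S by auto

lemma homogeneous_Phi [simp]: "homogeneous_poly k d (\<Phi> p) \<longleftrightarrow> homog d p"
  unfolding homogeneous_poly_def homog_def \<Phi>_def by simp

lemma const_poly_Phi: "const_poly k (\<phi> c) = \<Phi> (Poly_Mapping.single {#} c)"
  unfolding const_poly_def \<Phi>_def by (auto simp: lookup_single when_def)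

definition quad :: "(nat \<Rightarrow> 'k) \<Rightarrow> 'k mpoly" where
  "quad c = (\<Sum>i\<le>4. Poly_Mapping.single {#i, i#} (c i))"

lemma lookup_quad: "lookup (quad c) m = (\<Sum>i\<le>4. if m = {#i, i#} then c i else 0)"
  unfolding quad_def by (auto simp: lookup_sum lookup_single when_def intro!: sum.cong)

lemma lookup_quad_square: "i \<le> 4 \<Longrightarrow> lookup (quad c) {#i, i#} = c i"
proof -
  assume i: "i \<le> 4"
  have "lookup (quad c) {#i, i#} = (\<Sum>j\<le>4. if j = i then c i else 0)"
    unfolding lookup_quad by (intro sum.cong refl) (auto simp: add_eq_conv_diff)
  then show ?thesis using i by simp
qed

lemma quad_vars: "quad c \<in> vars_le 4"
  unfolding quad_def by (intro vars_le_sum vars_le_single) auto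

lemma quad_homog: "homog 2 (quad c)"
  unfolding quad_def by (intro homog_sum homog_single) auto

lemma quadric_form_quad:
  assumes "i \<le> 4" "c i \<noteq> 0"
  shows "quadric_form k 4 (\<Phi> (quad c))"
proof -
  have "quad c \<noteq> 0" using lookup_quad_square[OF assms(1), of c] assms(2) by auto
  then show ?thesis unfolding quadric_form_def using quad_vars quad_homog by (simp add: Phi_0[symmetric])
qed

lemma partial_deriv_quad:
  assumes i: "i \<le> 4"
  shows "partial_deriv k i (\<Phi> (quad c)) = \<Phi> (Poly_Mapping.single {#i#} (2 * c i))"
proof
  fix m
  have "lookup (quad c) (add_mset i m) = (\<Sum>j\<le>4. if j = i then (if m = {#i#} then c i else 0) else 0)"
    unfolding lookup_quad by (intro sum.cong refl) (auto simp: add_eq_conv_diff)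
  then have "lookup (quad c) (add_mset i m) = (if m = {#i#} then c i else 0)" using i by simp
  then show "partial_deriv k i (\<Phi> (quad c)) m = \<Phi> (Poly_Mapping.single {#i#} (2 * c i)) m"
    unfolding partial_deriv_def \<Phi>_def by (auto simp: add_pow_k lookup_single when_def)
qed

end

section \<open>The two quadrics form a regular sequence\<close>

lift_definition part0 :: "nat \<Rightarrow> 'c::zero mpoly \<Rightarrow> 'c mpoly" is
  "\<lambda>N f m. if count m 0 = N then f m else 0"
  by (erule finite_subset[rotated]) auto

lemma lookup_part0: "lookup (part0 N f) m = (if count m 0 = N then lookup f m else 0)"
  by transfer simp

lemma part0_add: "part0 N (f + g) = part0 N f + part0 N g"
  by (rule poly_mapping_eqI) (simp add: lookup_part0 lookup_add)

lemma part0_vars: "f \<in> vars_le n \<Longrightarrow> part0 N f \<in> vars_le n"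
  unfolding vars_le_def by (auto simp: lookup_part0 split: if_splits)

lemma part0_mult:
  fixes p q :: "'k::semiring_0 mpoly"
  assumes "\<And>m. lookup q m \<noteq> 0 \<Longrightarrow> count m 0 = b"
  shows "part0 (a + b) (p * q) = part0 a p * q"
proof (rule poly_mapping_eqI)
  fix m
  have *: "lookup p x * lookup q (m - x) = 0" if "x \<subseteq># m" "count x 0 \<noteq> count m 0 - b" for x
  proof -
    have "count x 0 \<le> count m 0" using that(1) by (rule mset_subset_eq_count)
    then have "count m 0 - count x 0 \<noteq> b" using that(2) by linarith
    then have "lookup q (m - x) = 0" using assms[of "m - x"] by auto
    then show ?thesis by simp
  qed
  have **: "lookup p x * lookup q (m - x) = 0" if "x \<subseteq># m" "count m 0 < b" for x
  proof -
    have "count m 0 - count x 0 \<noteq> b" using that(2) by linarith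
    then have "lookup q (m - x) = 0" using assms[of "m - x"] by auto
    then show ?thesis by simp
  qed
  show "lookup (part0 (a + b) (p * q)) m = lookup (part0 a p * q) m"
  proof (cases "count m 0 = a + b")
    case True
    then show ?thesis unfolding lookup_part0 lookup_mult_submultisets using * by (auto intro!: sum.cong)
  next
    case False
    have "lookup (part0 a p) x * lookup q (m - x) = 0" if "x \<subseteq># m" for x
      using *[OF that] **[OF that] False by (cases "count m 0 < b") (auto simp: lookup_part0)
    then have "(\<Sum>x | x \<subseteq># m. lookup (part0 a p) x * lookup q (m - x)) = 0" by (intro sum.neutral) auto
    then show ?thesis using False unfolding lookup_part0 lookup_mult_submultisets by simp
  qed
qed

lemma mult_single_divide:
  fixes f :: "'k::field mpoly"
  assumes f: "\<And>m. lookup f m \<noteq> 0 \<Longrightarrow> M \<subseteq># m" "f \<in> vars_le n" and a: "a \<noteq> 0"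
  shows "\<exists>g \<in> vars_le n. f = Poly_Mapping.single M a * g"
proof -
  define g where "g = Poly_Mapping.map_key (\<lambda>m. m + M) f"
  have "inj (\<lambda>m. m + M)" by (auto simp: inj_def)
  then have lg: "lookup g m = lookup f (m + M)" for m unfolding g_def by (simp add: map_key.rep_eq)
  have "g \<in> vars_le n" by (rule vars_leI) (use lg vars_leD[OF f(2)] in fastforce)
  then have "Poly_Mapping.single {#} (inverse a) * g \<in> vars_le n" by (intro vars_le_mult vars_le_single) auto
  moreover have "f = Poly_Mapping.single M a * (Poly_Mapping.single {#} (inverse a) * g)"
  proof (rule poly_mapping_eqI)
    fix m show "lookup f m = lookup (Poly_Mapping.single M a * (Poly_Mapping.single {#} (inverse a) * g)) m"
      using a f(1)[of m] by (auto simp: lookup_single_mult lg)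
  qed
  ultimately show ?thesis by blast
qed

text \<open>
  Descent on the degree in \<open>x\<^sub>0\<close>: as \<open>q\<close> and \<open>r\<close> are free of \<open>x\<^sub>0\<close>, the parts of top degree in \<open>x\<^sub>0\<close>
  satisfy \<open>F q = G a x\<^sub>0\<^sup>2\<close>, and a multiple of the divisor cancels them.
\<close>

lemma dvd_of_mult_eq:
  fixes f g q r :: "'k::field mpoly"
  assumes a: "a \<noteq> 0" and q: "q \<noteq> 0" "q \<in> vars_le n" "\<And>m. lookup q m \<noteq> 0 \<Longrightarrow> count m 0 = 0"
    and r: "r \<in> vars_le n" "\<And>m. lookup r m \<noteq> 0 \<Longrightarrow> count m 0 = 0"
    and f: "f \<in> vars_le n" and g: "g \<in> vars_le n"
    and eq: "f * q = g * (Poly_Mapping.single {#0, 0#} a + r)"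
  shows "\<exists>h \<in> vars_le n. f = h * (Poly_Mapping.single {#0, 0#} a + r)"
proof -
  let ?A = "Poly_Mapping.single {#0, 0#} a :: 'k mpoly"
  have "\<exists>h \<in> vars_le n. f = h * (?A + r)" if "\<And>m. lookup g m \<noteq> 0 \<Longrightarrow> count m 0 < N" for N
    using that f g eq
  \<comment> \<open>\<open>N\<close> is a strict bound on the degree of \<open>g\<close> in the
    variable of index 0, so \<open>N = 0\<close> leaves only \<open>g = 0\<close>, and then
    \<open>f = 0\<close> because \<open>q\<close> is not a zero divisor.\<close>
  proof (induction N arbitrary: f g)
    case 0
    then have "g = 0" by (intro poly_mapping_eqI) auto
    then have "f = 0" using 0 q(1) by simp
    then show ?case by (intro bexI[of _ 0]) auto
  next
    case (Suc N)
    define F G where "F = part0 (N + 2) f" and "G = part0 N g"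
    have "part0 (N + 2 + 0) (f * q) = F * q" unfolding F_def using q(3) by (rule part0_mult)
    moreover have "part0 (N + 2) (g * ?A) = G * ?A" unfolding G_def
      by (rule part0_mult) (auto simp: lookup_single when_def split: if_splits)
    moreover have "part0 (N + 2 + 0) (g * r) = part0 (N + 2) g * r" using r(2) by (rule part0_mult)
    moreover have "part0 (N + 2) g = 0"
      by (rule poly_mapping_eqI) (use Suc.prems(1) in \<open>force simp: lookup_part0\<close>)
    ultimately have FG: "F * q = G * ?A" using Suc.prems(4) by (simp add: distrib_left part0_add)
    have "\<exists>F2 \<in> vars_le n. F = ?A * F2"
    proof (rule mult_single_divide[OF _ _ a])
      fix m assume "lookup F m \<noteq> 0"
      then have "count m 0 = N + 2" unfolding F_def lookup_part0 by (metis)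
      then show "{#0, 0#} \<subseteq># m" by (simp add: subseteq_mset_def)
    next
      show "F \<in> vars_le n" unfolding F_def using Suc.prems(2) by (rule part0_vars)
    qed
    then obtain F2 where F2: "F2 \<in> vars_le n" "F = ?A * F2" by blast
    have "?A \<noteq> 0" using a by (metis lookup_single_eq lookup_zero)
    have "?A * (F2 * q) = ?A * G" using FG F2(2) by (simp add: mult_ac)
    then have "F2 * q = G" using \<open>?A \<noteq> 0\<close> by simp
    then have G: "G = F2 * q" by simp
    define f' g' where "f' = f - F2 * (?A + r)" and "g' = g - G"
    have "\<exists>h \<in> vars_le n. f' = h * (?A + r)"
    proof (rule Suc.IH)
      show "count m 0 < N" if "lookup g' m \<noteq> 0" for m
        using that Suc.prems(1)[of m] unfolding g'_def G_def by (auto simp: lookup_minus lookup_part0 split: if_splits)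
      have "?A + r \<in> vars_le n" by (intro vars_le_add vars_le_single r(1)) auto
      then have "- (F2 * (?A + r)) \<in> vars_le n" by (intro vars_le_uminus vars_le_mult F2(1))
      then show "f' \<in> vars_le n" unfolding f'_def using vars_le_add[OF Suc.prems(2)] by (metis add_uminus_conv_diff)
      have "- G \<in> vars_le n" unfolding G_def by (intro vars_le_uminus part0_vars Suc.prems(3))
      then show "g' \<in> vars_le n" unfolding g'_def using vars_le_add[OF Suc.prems(3)] by (metis add_uminus_conv_diff)
      show "f' * q = g' * (?A + r)" unfolding f'_def g'_def G using Suc.prems(4) by (simp add: algebra_simps)
    qed
    then obtain h where h: "h \<in> vars_le n" "f' = h * (?A + r)" by blast
    have "f = (h + F2) * (?A + r)" using h(2) unfolding f'_def by (simp add: algebra_simps)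
    then show ?case using h(1) F2(1) by (intro bexI[of _ "h + F2"] vars_le_add)
  qed
  moreover have "\<exists>N. \<forall>m. lookup g m \<noteq> 0 \<longrightarrow> count m 0 < N"
  proof -
    have "finite ((\<lambda>m. count m 0) ` {m. lookup g m \<noteq> 0})" by simp
    then obtain N where "\<forall>x \<in> (\<lambda>m. count m 0) ` {m. lookup g m \<noteq> 0}. x < N" using finite_nat_set_iff_bounded by blast
    then show ?thesis by blast
  qed
  ultimately show ?thesis by blast
qed

context transport
begin

text \<open>The first form has a nonzero constant as the coefficient of the square of the variable 0
  and the second is free of that variable, so division in this variable shows that the first form
  divides \<open>p\<close> if it divides \<open>p * quad d\<close>.\<close>

lemma complete_intersection_quad:
  assumes c: "c 0 \<noteq> 0" and d: "d 0 = 0" "d 1 \<noteq> 0"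
  shows "complete_intersection2 k 4 (\<Phi> (quad c)) (\<Phi> (quad d))"
  unfolding complete_intersection2_def Let_def
proof (intro conjI ballI impI)
  have c0: "quad c \<noteq> 0" using lookup_quad_square[of 0 c] c by auto
  fix f assume "f \<in> carrier (S 4)"
  then obtain p where p: "f = \<Phi> p" "p \<in> vars_le 4" unfolding carrier_S by blast
  show "f = \<zero>\<^bsub>S 4\<^esub>" if "f \<otimes>\<^bsub>S 4\<^esub> \<Phi> (quad c) = \<zero>\<^bsub>S 4\<^esub>"
    using that c0 unfolding p by (simp add: Phi_mult[symmetric] Phi_0[symmetric])
  assume "f \<otimes>\<^bsub>S 4\<^esub> \<Phi> (quad d) \<in> PIdl\<^bsub>S 4\<^esub> \<Phi> (quad c)"
  then obtain g where g: "g \<in> vars_le 4" "p * quad d = g * quad c"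
    unfolding cgenideal_def carrier_S p by (auto simp: Phi_mult[symmetric])
  define r where "r = (\<Sum>i\<in>{1..4}. Poly_Mapping.single {#i, i#} (c i))"
  have split: "{..4} = insert 0 {1..(4::nat)}" by auto
  have qc: "quad c = Poly_Mapping.single {#0, 0#} (c 0) + r" unfolding quad_def r_def split by simp
  have "\<exists>h \<in> vars_le 4. p = h * (Poly_Mapping.single {#0, 0#} (c 0) + r)"
  proof (rule dvd_of_mult_eq[OF c _ quad_vars _ _ _ p(2) g(1)])
    show "quad d \<noteq> 0" using lookup_quad_square[of 1 d] d by auto
    show "count m 0 = 0" if "lookup (quad d) m \<noteq> 0" for m
    proof -
      have "\<exists>i\<in>{..4}. (if m = {#i, i#} then d i else 0) \<noteq> 0"
        using that unfolding lookup_quad by (rule sum_nonzero_ex)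
      then show ?thesis using d(1) by (auto split: if_splits intro!: Nat.gr0I)
    qed
    show "r \<in> vars_le 4" unfolding r_def by (intro vars_le_sum vars_le_single) auto
    show "count m 0 = 0" if "lookup r m \<noteq> 0" for m
    proof -
      have "\<exists>i\<in>{1..4}. lookup (Poly_Mapping.single {#i, i#} (c i)) m \<noteq> 0"
        using that unfolding r_def lookup_sum by (rule sum_nonzero_ex)
      then show ?thesis by (auto simp: lookup_single when_def split: if_splits)
    qed
    show "p * quad d = g * (Poly_Mapping.single {#0, 0#} (c 0) + r)" using g(2) unfolding qc .
  qed
  then obtain h where h: "h \<in> vars_le 4" "p = h * quad c" unfolding qc by blast
  then have "f = \<Phi> h \<otimes>\<^bsub>S 4\<^esub> \<Phi> (quad c)" unfolding p by (simp add: Phi_mult[symmetric])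
  then show "f \<in> PIdl\<^bsub>S 4\<^esub> \<Phi> (quad c)" using h(1) unfolding cgenideal_def carrier_S by blast
qed

end

section \<open>Homogeneous primes of the coordinate ring and the Jacobian criterion\<close>

locale proj_point = transport \<phi> for \<phi> :: "'k::field_char_0 \<Rightarrow> 'b" +
  fixes n :: nat and P :: "'b mpolynomial set"
  assumes P: "P \<in> proj_space k n"
begin

definition I :: "'k mpoly set" where "I = {p \<in> vars_le n. \<Phi> p \<in> P}"

lemma primeideal_P: "primeideal P (S n)"
  using P unfolding proj_space_def by blast

lemma I_vars: "p \<in> I \<Longrightarrow> p \<in> vars_le n"
  unfolding I_def by simp

lemma mem_P_iff: "p \<in> vars_le n \<Longrightarrow> \<Phi> p \<in> P \<longleftrightarrow> p \<in> I"
  unfolding I_def by simp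

lemma I_0 [simp]: "0 \<in> I"
proof -
  interpret primeideal P "S n" by (rule primeideal_P)
  show ?thesis unfolding I_def using additive_subgroup.zero_closed[OF is_additive_subgroup] by (simp add: Phi_0[of n])
qed

lemma I_add: "p \<in> I \<Longrightarrow> q \<in> I \<Longrightarrow> p + q \<in> I"
proof -
  interpret primeideal P "S n" by (rule primeideal_P)
  show "p \<in> I \<Longrightarrow> q \<in> I \<Longrightarrow> p + q \<in> I" unfolding I_def by (simp add: vars_le_add Phi_add[of _ _ n])
qed

lemma I_mult: "p \<in> I \<Longrightarrow> q \<in> vars_le n \<Longrightarrow> q * p \<in> I"
proof -
  interpret primeideal P "S n" by (rule primeideal_P)
  show "p \<in> I \<Longrightarrow> q \<in> vars_le n \<Longrightarrow> q * p \<in> I"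
    unfolding I_def by (simp add: vars_le_mult Phi_mult[of _ _ n] I_l_closed)
qed

lemma I_prime: "p \<in> vars_le n \<Longrightarrow> q \<in> vars_le n \<Longrightarrow> p * q \<in> I \<Longrightarrow> p \<in> I \<or> q \<in> I"
proof -
  interpret primeideal P "S n" by (rule primeideal_P)
  show "p \<in> vars_le n \<Longrightarrow> q \<in> vars_le n \<Longrightarrow> p * q \<in> I \<Longrightarrow> p \<in> I \<or> q \<in> I"
    unfolding I_def using I_prime[of "\<Phi> p" "\<Phi> q"] by (simp add: Phi_mult[of _ _ n])
qed

lemma I_1: "1 \<notin> I"
proof
  interpret primeideal P "S n" by (rule primeideal_P)
  assume "1 \<in> I"
  then have "\<one>\<^bsub>S n\<^esub> \<in> P" unfolding I_def by (simp add: Phi_1[of n])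
  then show False using one_imp_carrier I_notcarr by blast
qed

lemma I_uminus: "p \<in> I \<Longrightarrow> - p \<in> I"
  using I_mult[OF _ vars_le_uminus[OF vars_le_1], of p] by simp

lemma I_diff: "p \<in> I \<Longrightarrow> q \<in> I \<Longrightarrow> p - q \<in> I"
  using I_add[of p "- q"] I_uminus by simp

lemma I_sum: "(\<And>i. i \<in> A \<Longrightarrow> f i \<in> I) \<Longrightarrow> sum f A \<in> I"
  by (induction A rule: infinite_finite_induct) (auto intro: I_add)

lemma single_mem_I_cancel:
  assumes "Poly_Mapping.single m c \<in> I" "c \<noteq> 0"
  shows "Poly_Mapping.single m 1 \<in> I"
proof -
  have "Poly_Mapping.single {#} (inverse c) * Poly_Mapping.single m c \<in> I"
    by (rule I_mult[OF assms(1)]) (simp add: vars_le_single)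
  then show ?thesis using assms(2) by (simp add: mult_single)
qed

definition xv :: "nat \<Rightarrow> 'k mpoly" where "xv i = Poly_Mapping.single {#i#} 1"

lemma xv_vars: "i \<le> n \<Longrightarrow> xv i \<in> vars_le n"
  unfolding xv_def by (simp add: vars_le_single)

lemma xv_homog: "homog 1 (xv i)"
  unfolding xv_def by (simp add: homog_single)

text \<open>Otherwise every monomial of positive degree would lie in the ideal, and with them the
  irrelevant ideal. The index found chooses an affine chart containing the point.\<close>

lemma exists_xv_notin: "\<exists>i\<le>n. xv i \<notin> I"
proof (rule ccontr)
  assume "\<not> (\<exists>i\<le>n. xv i \<notin> I)"
  then have xv: "xv i \<in> I" if "i \<le> n" for i using that by blast
  have "irrelevant_ideal k n \<subseteq> P"
  proof
    fix f assume f: "f \<in> irrelevant_ideal k n"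
    then obtain p where p: "f = \<Phi> p" "p \<in> vars_le n" unfolding irrelevant_ideal_def carrier_S by blast
    have p0: "lookup p {#} = 0" using f unfolding p irrelevant_ideal_def \<Phi>_def by simp
    have "(\<Sum>m\<in>Poly_Mapping.keys p. Poly_Mapping.single m (lookup p m)) \<in> I"
    proof (rule I_sum)
      fix m assume m: "m \<in> Poly_Mapping.keys p"
      then have nz: "lookup p m \<noteq> 0" by (simp add: in_keys_iff)
      then have "m \<noteq> {#}" using p0 by metis
      then obtain i m' where m': "m = add_mset i m'" by (metis multiset_cases)
      have v: "set_mset m \<subseteq> {..n}" using vars_leD[OF p(2) nz] .
      have "Poly_Mapping.single m (lookup p m) = Poly_Mapping.single m' (lookup p m) * xv i"
        unfolding xv_def m' by (simp add: mult_single)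
      then show "Poly_Mapping.single m (lookup p m) \<in> I"
        using I_mult[OF xv[of i], of "Poly_Mapping.single m' (lookup p m)"] v unfolding m' by (simp add: vars_le_single)
    qed
    then have "p \<in> I" using poly_mapping_sum_single[of p] by simp
    then show "f \<in> P" unfolding p I_def by simp
  qed
  then show False using P unfolding proj_space_def by blast
qed

end

context transport
begin

text \<open>The minor for \<open>i\<close> and \<open>j\<close> is 4 (c_i d_j - c_j d_i) x_i x_j. If
  all minors vanish at a point, at most one coordinate survives there, and the first quadric then
  reduces to c_j x_j^2, which kills that coordinate too.\<close>

lemma smooth_quad:
  assumes cd: "\<And>i j. i \<le> 4 \<Longrightarrow> j \<le> 4 \<Longrightarrow> i \<noteq> j \<Longrightarrow> c i * d j - c j * d i \<noteq> 0" and c: "\<And>i. i \<le> 4 \<Longrightarrow> c i \<noteq> 0"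
  shows "smooth_intersection2 k 4 (\<Phi> (quad c)) (\<Phi> (quad d))"
  unfolding smooth_intersection2_def Let_def
proof (intro ballI, rule ccontr)
  fix P assume "P \<in> zero_locus k 4 {\<Phi> (quad c), \<Phi> (quad d)}"
  then have pt: "P \<in> proj_space k 4" "\<Phi> (quad c) \<in> P" unfolding zero_locus_def by auto
  interpret proj_point \<phi> 4 P by unfold_locales (rule pt)
  assume "\<not> (\<exists>i\<le>4. \<exists>j\<le>4. partial_deriv k i (\<Phi> (quad c)) \<otimes>\<^bsub>S 4\<^esub> partial_deriv k j (\<Phi> (quad d)) \<ominus>\<^bsub>S 4\<^esub>
    partial_deriv k j (\<Phi> (quad c)) \<otimes>\<^bsub>S 4\<^esub> partial_deriv k i (\<Phi> (quad d)) \<notin> P)"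
  then have minor: "partial_deriv k i (\<Phi> (quad c)) \<otimes>\<^bsub>S 4\<^esub> partial_deriv k j (\<Phi> (quad d)) \<ominus>\<^bsub>S 4\<^esub>
    partial_deriv k j (\<Phi> (quad c)) \<otimes>\<^bsub>S 4\<^esub> partial_deriv k i (\<Phi> (quad d)) \<in> P" if "i \<le> 4" "j \<le> 4" for i j using that by blast
  have XX: "xv i \<in> I \<or> xv j \<in> I" if ij: "i \<le> 4" "j \<le> 4" "i \<noteq> j" for i j
  proof -
    have v: "Poly_Mapping.single {#i, j#} a \<in> vars_le 4" for a
      by (rule vars_le_single) (use ij in auto)
    have "partial_deriv k i (\<Phi> (quad c)) \<otimes>\<^bsub>S 4\<^esub> partial_deriv k j (\<Phi> (quad d)) = \<Phi> (Poly_Mapping.single {#i, j#} (2 * c i * (2 * d j)))"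
      "partial_deriv k j (\<Phi> (quad c)) \<otimes>\<^bsub>S 4\<^esub> partial_deriv k i (\<Phi> (quad d)) = \<Phi> (Poly_Mapping.single {#i, j#} (2 * c j * (2 * d i)))"
      unfolding partial_deriv_quad[OF ij(1)] partial_deriv_quad[OF ij(2)] Phi_mult[symmetric] mult_single
      by (simp_all add: add_mset_commute)
    then have "\<Phi> (Poly_Mapping.single {#i, j#} (2 * c i * (2 * d j)) - Poly_Mapping.single {#i, j#} (2 * c j * (2 * d i))) \<in> P"
      using minor[OF ij(1,2)] unfolding Phi_diff[OF v v, symmetric] by simp
    then have "Poly_Mapping.single {#i, j#} (2 * c i * (2 * d j) - 2 * c j * (2 * d i)) \<in> I"
      unfolding single_diff[symmetric] mem_P_iff[OF v] .
    moreover have "2 * c i * (2 * d j) - 2 * c j * (2 * d i) \<noteq> 0"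
    proof -
      have "2 * c i * (2 * d j) - 2 * c j * (2 * d i) = 4 * (c i * d j - c j * d i)" by (simp add: algebra_simps)
      then show ?thesis using cd[OF ij] by simp
    qed
    ultimately have "Poly_Mapping.single {#i, j#} 1 \<in> I" by (rule single_mem_I_cancel)
    then have "xv i * xv j \<in> I" unfolding xv_def by (simp add: mult_single add_mset_commute)
    then show ?thesis using I_prime xv_vars ij by blast
  qed
  obtain j where j: "j \<le> 4" "xv j \<notin> I" using exists_xv_notin by blast
  have "quad c = (\<Sum>i\<in>{..4} - {j}. Poly_Mapping.single {#i, i#} (c i)) + Poly_Mapping.single {#j, j#} (c j)"
    unfolding quad_def using j by (subst sum.remove[of _ j]) (auto simp: add.commute)
  moreover have "(\<Sum>i\<in>{..4} - {j}. Poly_Mapping.single {#i, i#} (c i)) \<in> I"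
  proof (rule I_sum)
    fix i assume i: "i \<in> {..4} - {j}"
    then have "xv i \<in> I" using XX[of i j] j by auto
    then have "Poly_Mapping.single {#i#} (c i) * xv i \<in> I" using i by (intro I_mult vars_le_single) auto
    then show "Poly_Mapping.single {#i, i#} (c i) \<in> I" unfolding xv_def by (simp add: mult_single)
  qed
  moreover have "quad c \<in> I" using pt(2) mem_P_iff quad_vars by blast
  ultimately have "Poly_Mapping.single {#j, j#} (c j) \<in> I" using I_diff by (metis add_diff_cancel_left')
  then have "Poly_Mapping.single {#j, j#} 1 \<in> I" using c[OF j(1)] by (rule single_mem_I_cancel)
  then have "xv j * xv j \<in> I" unfolding xv_def by (simp add: mult_single)
  then show False using I_prime xv_vars j by blast
qed

end

section \<open>Residue fields of points\<close>

lemma (in scalars) emb_combination_eq_0: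
  assumes y: "y \<in> carrier R" "y \<notin> K" and eq: "\<iota> u \<oplus> \<iota> v \<otimes> y = \<zero>"
  shows "u = 0 \<and> v = 0"
proof -
  have "v = 0"
  proof (rule ccontr)
    assume v: "v \<noteq> 0"
    have "\<iota> v \<otimes> y = \<ominus> \<iota> u" using eq y(1) by (metis emb_closed m_closed minus_equality a_comm minus_minus)
    then have "\<iota> (inverse v) \<otimes> (\<iota> v \<otimes> y) = \<iota> (inverse v) \<otimes> \<iota> (- u)" by (simp add: emb_uminus)
    then have "\<iota> (inverse v * v) \<otimes> y = \<iota> (inverse v * - u)" using y(1) by (simp only: emb_mult m_assoc emb_closed)
    then have "y = \<iota> (inverse v * - u)" using v y(1) by (simp add: emb_1)
    then show False using y(2) unfolding K_def by blast
  qed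
  then have "\<iota> u = \<zero>" using eq y(1) by (simp add: emb_0)
  then show ?thesis using \<open>v = 0\<close> emb_eq_0 by blast
qed

context proj_point
begin

definition hf :: "('k mpoly \<times> 'k mpoly) set" where
  "hf = {(f, g). f \<in> vars_le n \<and> g \<in> vars_le n \<and> g \<notin> I \<and> (\<exists>d. homog d f \<and> homog d g)}"

definition fr :: "'k mpoly \<Rightarrow> 'k mpoly \<Rightarrow> ('b mpolynomial \<times> 'b mpolynomial) set" where
  "fr f g = frac_class k n P (\<Phi> f) (\<Phi> g)"

abbreviation "pr \<equiv> \<lambda>(f, g). (\<Phi> f, \<Phi> g)"

lemma hfD: "(f, g) \<in> hf \<Longrightarrow> f \<in> vars_le n" "(f, g) \<in> hf \<Longrightarrow> g \<in> vars_le n" "(f, g) \<in> hf \<Longrightarrow> g \<notin> I"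
  unfolding hf_def by auto

lemma hfI: "f \<in> vars_le n \<Longrightarrow> g \<in> vars_le n \<Longrightarrow> g \<notin> I \<Longrightarrow> homog d f \<Longrightarrow> homog d g \<Longrightarrow> (f, g) \<in> hf"
  unfolding hf_def by auto

lemma hom_fracs_eq: "hom_fracs k n P = pr ` hf"
proof
  show "pr ` hf \<subseteq> hom_fracs k n P"
    unfolding hom_fracs_def hf_def by (auto simp: mem_P_iff)
  show "hom_fracs k n P \<subseteq> pr ` hf"
  proof
    fix x assume "x \<in> hom_fracs k n P"
    then obtain f g d where x: "x = (f, g)" "f \<in> carrier (S n)" "g \<in> carrier (S n)" "g \<notin> P"
      "homogeneous_poly k d f" "homogeneous_poly k d g" unfolding hom_fracs_def by auto
    obtain f' g' where fg: "f = \<Phi> f'" "g = \<Phi> g'" "f' \<in> vars_le n" "g' \<in> vars_le n" using x unfolding carrier_S by blast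
    then have "(f', g') \<in> hf" using x by (intro hfI[of _ _ d]) (auto simp: mem_P_iff)
    then show "x \<in> pr ` hf" unfolding x fg by (intro image_eqI[of _ _ "(f', g')"]) auto
  qed
qed

lemma fr_eq: 
  assumes "f \<in> vars_le n" "g \<in> vars_le n"
  shows "fr f g = pr ` {(f', g') \<in> hf. f * g' - f' * g \<in> I}"
proof -
  have "\<Phi> f \<otimes>\<^bsub>S n\<^esub> \<Phi> g' \<ominus>\<^bsub>S n\<^esub> \<Phi> f' \<otimes>\<^bsub>S n\<^esub> \<Phi> g \<in> P \<longleftrightarrow> f * g' - f' * g \<in> I" if "(f', g') \<in> hf" for f' g'
  proof -
    have v: "f * g' \<in> vars_le n" "f' * g \<in> vars_le n" using assms hfD[OF that] by (auto intro: vars_le_mult)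
    then have "f * g' - f' * g \<in> vars_le n" using vars_le_add[OF v(1) vars_le_uminus[OF v(2)]] by simp
    then show ?thesis using v by (simp add: Phi_mult[symmetric] Phi_diff mem_P_iff)
  qed
  then show ?thesis unfolding fr_def frac_class_def hom_fracs_eq by (auto simp: image_iff) force+
qed

lemma fr_eqI:
  assumes h: "(f, g) \<in> hf" "(f', g') \<in> hf" and e: "f * g' - f' * g \<in> I"
  shows "fr f g = fr f' g'"
proof -
  have sub: "f' * b - a * g' \<in> I" if h: "(f, g) \<in> hf" "(f', g') \<in> hf" "(a, b) \<in> hf" and e: "f * g' - f' * g \<in> I" "f * b - a * g \<in> I"
    for f g f' g' a b
  proof -
    \<comment> \<open>Transitivity of equality of fractions: the combination is \<open>g\<close>
      times the wanted element, and \<open>g\<close> is cancelled since the ideal is prime.\<close>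
    have "g' * (f * b - a * g) - b * (f * g' - f' * g) \<in> I"
      by (intro I_diff I_mult e) (use hfD h in auto)
    moreover have "g' * (f * b - a * g) - b * (f * g' - f' * g) = g * (f' * b - a * g')" by (simp add: algebra_simps)
    moreover have "f' * b - a * g' \<in> vars_le n"
      using vars_le_add[of "f' * b" n "- (a * g')"] hfD[OF h(2)] hfD[OF h(3)] by (simp add: vars_le_mult vars_le_uminus)
    ultimately show ?thesis using I_prime[of g "f' * b - a * g'"] hfD[OF h(1)] by auto
  qed
  have e': "f' * g - f * g' \<in> I" using I_uminus[OF e] by simp
  have "{(a, b) \<in> hf. f * b - a * g \<in> I} = {(a, b) \<in> hf. f' * b - a * g' \<in> I}"
    using sub[OF h(1,2) _ e] sub[OF h(2,1) _ e'] by auto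
  then show ?thesis using fr_eq hfD[OF h(1)] hfD[OF h(2)] by simp
qed

lemma fr_eqD:
  assumes h: "(f, g) \<in> hf" "(f', g') \<in> hf" and e: "fr f g = fr f' g'"
  shows "f * g' - f' * g \<in> I"
proof -
  have "(\<Phi> f', \<Phi> g') \<in> fr f' g'" using fr_eq[of f' g'] hfD[OF h(2)] h(2) by (auto simp: image_iff intro!: bexI[of _ "(f', g')"])
  then have "(\<Phi> f', \<Phi> g') \<in> fr f g" using e by simp
  then show ?thesis using fr_eq[of f g] hfD[OF h(1)] by (auto simp: image_iff)
qed

lemma hf_mult: "(f, g) \<in> hf \<Longrightarrow> (f', g') \<in> hf \<Longrightarrow> (f * f', g * g') \<in> hf"
  unfolding hf_def using I_prime by (auto intro: vars_le_mult homog_mult)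

lemma hf_add: "(f, g) \<in> hf \<Longrightarrow> (f', g') \<in> hf \<Longrightarrow> (f * g' + f' * g, g * g') \<in> hf"
proof -
  assume h: "(f, g) \<in> hf" "(f', g') \<in> hf"
  then obtain d d' where d: "homog d f" "homog d g" "homog d' f'" "homog d' g'" unfolding hf_def by auto
  have "homog (d + d') (f' * g)" using homog_mult[OF d(3,2)] by (simp add: add.commute)
  then have "homog (d + d') (f * g' + f' * g)" using homog_mult[OF d(1,4)] by (intro homog_add)
  then show ?thesis using h hfD[OF h(1)] hfD[OF h(2)] I_prime homog_mult[OF d(2,4)]
    by (intro hfI[of _ _ "d + d'"] vars_le_add vars_le_mult) auto
qed

text \<open>A nonzero denominator has only one degree, so both numerators share it and can be added
  without squaring the denominator.\<close>

lemma hf_same_denominator: "(f, g) \<in> hf \<Longrightarrow> (f', g) \<in> hf \<Longrightarrow> homog d g \<Longrightarrow> g \<noteq> 0 \<Longrightarrow> (f + f', g) \<in> hf"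
proof -
  assume h: "(f, g) \<in> hf" "(f', g) \<in> hf" "homog d g" "g \<noteq> 0"
  obtain m where m: "lookup g m \<noteq> 0" using h(4) by (metis lookup_zero poly_mapping_eqI)
  have "homog d f" "homog d f'" using h m unfolding hf_def homog_def by auto
  then show ?thesis using h hfD[OF h(1)] hfD[OF h(2)] by (intro hfI[of _ _ d] vars_le_add homog_add) auto
qed

lemma hf_simps [simp]: "(0, 1) \<in> hf" "(1, 1) \<in> hf"
  using I_1 by (auto intro!: hfI[of _ _ 0])

abbreviation "L \<equiv> residue_field k n P"

lemma L_carrier: "carrier L = {fr f g |f g. (f, g) \<in> hf}"
  unfolding residue_field_def Let_def hom_fracs_eq fr_def by (auto, force)

lemma L_carrierI [intro]: "(f, g) \<in> hf \<Longrightarrow> fr f g \<in> carrier L"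
  unfolding L_carrier by blast

text \<open>The operations of the residue field are unions over representatives; this reduces them
  to one class once independence of the representatives is known.\<close>

lemma UN_pairs_const:
  assumes "A \<noteq> {}" "B \<noteq> {}" "\<And>x y x' y'. (x, y) \<in> A \<Longrightarrow> (x', y') \<in> B \<Longrightarrow> F x y x' y' = C"
  shows "(\<Union>(x, y)\<in>A. \<Union>(x', y')\<in>B. F x y x' y') = C"
proof -
  have "(\<Union>(x', y')\<in>B. F x y x' y') = C" if "(x, y) \<in> A" for x y
    using assms(2,3) that by fastforce
  then have "(\<Union>(x, y)\<in>A. \<Union>(x', y')\<in>B. F x y x' y') = (\<Union>p\<in>A. C)"
  proof (intro SUP_cong refl)
    fix p assume "p \<in> A"
    then show "(case p of (x, y) \<Rightarrow> \<Union>(x', y')\<in>B. F x y x' y') = C"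
      using \<open>\<And>x y. (x, y) \<in> A \<Longrightarrow> (\<Union>(x', y')\<in>B. F x y x' y') = C\<close> by (cases p) simp
  qed
  then show ?thesis using assms(1) by simp
qed

lemma fr_self: "(f, g) \<in> hf \<Longrightarrow> (\<Phi> f, \<Phi> g) \<in> fr f g"
  using fr_eq[of f g] hfD[of f g] by (auto simp: image_iff intro!: bexI[of _ "(f, g)"])

lemma fr_memE:
  assumes "(x, y) \<in> fr f g" "(f, g) \<in> hf"
  obtains a b where "x = \<Phi> a" "y = \<Phi> b" "(a, b) \<in> hf" "f * b - a * g \<in> I"
  using assms fr_eq[of f g] hfD[OF assms(2)] by auto

lemma L_mult:
  assumes h: "(f, g) \<in> hf" "(f', g') \<in> hf"
  shows "fr f g \<otimes>\<^bsub>L\<^esub> fr f' g' = fr (f * f') (g * g')"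
proof -
  have "fr f g \<otimes>\<^bsub>L\<^esub> fr f' g' = (\<Union>(x, y)\<in>fr f g. \<Union>(x', y')\<in>fr f' g'. frac_class k n P (x \<otimes>\<^bsub>S n\<^esub> x') (y \<otimes>\<^bsub>S n\<^esub> y'))"
    unfolding residue_field_def Let_def by simp
  also have "\<dots> = fr (f * f') (g * g')"
  proof (rule UN_pairs_const)
    fix x y x' y' assume "(x, y) \<in> fr f g" "(x', y') \<in> fr f' g'"
    then obtain a b c d where *: "x = \<Phi> a" "y = \<Phi> b" "(a, b) \<in> hf" "f * b - a * g \<in> I"
      "x' = \<Phi> c" "y' = \<Phi> d" "(c, d) \<in> hf" "f' * d - c * g' \<in> I" using fr_memE h by metis
    have "(f' * d) * (f * b - a * g) + (a * g) * (f' * d - c * g') \<in> I"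
      by (intro I_add I_mult vars_le_mult *) (use hfD h * in blast)+
    moreover have "(f' * d) * (f * b - a * g) + (a * g) * (f' * d - c * g') = f * f' * (b * d) - a * c * (g * g')"
      by (simp add: algebra_simps)
    ultimately have "fr (f * f') (g * g') = fr (a * c) (b * d)" using hf_mult h * by (intro fr_eqI) auto
    then show "frac_class k n P (x \<otimes>\<^bsub>S n\<^esub> x') (y \<otimes>\<^bsub>S n\<^esub> y') = fr (f * f') (g * g')"
      unfolding * by (simp add: fr_def Phi_mult[symmetric])
  qed (use fr_self h in blast)+
  finally show ?thesis .
qed

lemma L_add:
  assumes h: "(f, g) \<in> hf" "(f', g') \<in> hf"
  shows "fr f g \<oplus>\<^bsub>L\<^esub> fr f' g' = fr (f * g' + f' * g) (g * g')"
proof -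
  have "fr f g \<oplus>\<^bsub>L\<^esub> fr f' g' = (\<Union>(x, y)\<in>fr f g. \<Union>(x', y')\<in>fr f' g'.
    frac_class k n P ((x \<otimes>\<^bsub>S n\<^esub> y') \<oplus>\<^bsub>S n\<^esub> (x' \<otimes>\<^bsub>S n\<^esub> y)) (y \<otimes>\<^bsub>S n\<^esub> y'))"
    unfolding residue_field_def Let_def by simp
  also have "\<dots> = fr (f * g' + f' * g) (g * g')"
  proof (rule UN_pairs_const)
    fix x y x' y' assume "(x, y) \<in> fr f g" "(x', y') \<in> fr f' g'"
    then obtain a b c d where *: "x = \<Phi> a" "y = \<Phi> b" "(a, b) \<in> hf" "f * b - a * g \<in> I"
      "x' = \<Phi> c" "y' = \<Phi> d" "(c, d) \<in> hf" "f' * d - c * g' \<in> I" using fr_memE h by metis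
    have "(d * g') * (f * b - a * g) + (b * g) * (f' * d - c * g') \<in> I"
      by (intro I_add I_mult vars_le_mult *) (use hfD h * in blast)+
    moreover have "(d * g') * (f * b - a * g) + (b * g) * (f' * d - c * g') = (f * g' + f' * g) * (b * d) - (a * d + c * b) * (g * g')"
      by (simp add: algebra_simps)
    ultimately have "fr (f * g' + f' * g) (g * g') = fr (a * d + c * b) (b * d)" using hf_add hf_mult h * by (intro fr_eqI) auto
    then show "frac_class k n P ((x \<otimes>\<^bsub>S n\<^esub> y') \<oplus>\<^bsub>S n\<^esub> (x' \<otimes>\<^bsub>S n\<^esub> y)) (y \<otimes>\<^bsub>S n\<^esub> y') = fr (f * g' + f' * g) (g * g')"
      unfolding * by (simp add: fr_def Phi_mult[symmetric] Phi_add[symmetric])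
  qed (use fr_self h in blast)+
  finally show ?thesis .
qed

lemma L_one: "\<one>\<^bsub>L\<^esub> = fr 1 1" and L_zero: "\<zero>\<^bsub>L\<^esub> = fr 0 1"
  unfolding residue_field_def Let_def fr_def by (simp_all add: Phi_1[of n] Phi_0[of n])

lemma fr_eqI': "(f, g) \<in> hf \<Longrightarrow> (f', g') \<in> hf \<Longrightarrow> f * g' = f' * g \<Longrightarrow> fr f g = fr f' g'"
  by (rule fr_eqI) auto

lemma field_L: "field L"
proof -
  have "cring L"
  proof (rule cringI)
    show "abelian_group L"
    proof (rule abelian_groupI)
      fix x y z assume "x \<in> carrier L" "y \<in> carrier L" "z \<in> carrier L"
      then obtain a b c d e f where *: "x = fr a b" "y = fr c d" "z = fr e f" "(a, b) \<in> hf" "(c, d) \<in> hf" "(e, f) \<in> hf"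
        unfolding L_carrier by blast
      show "x \<oplus>\<^bsub>L\<^esub> y \<in> carrier L" unfolding * using * by (simp add: L_add hf_add L_carrierI)
      show "(x \<oplus>\<^bsub>L\<^esub> y) \<oplus>\<^bsub>L\<^esub> z = x \<oplus>\<^bsub>L\<^esub> (y \<oplus>\<^bsub>L\<^esub> z)"
        unfolding *(1-3) L_add[OF *(4,5)] L_add[OF *(5,6)] L_add[OF hf_add[OF *(4,5)] *(6)] L_add[OF *(4) hf_add[OF *(5,6)]]
        by (simp add: algebra_simps)
      show "x \<oplus>\<^bsub>L\<^esub> y = y \<oplus>\<^bsub>L\<^esub> x" unfolding * using * by (simp add: L_add algebra_simps)
    next
      show "\<zero>\<^bsub>L\<^esub> \<in> carrier L" unfolding L_zero by auto
      fix x assume "x \<in> carrier L"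
      then obtain a b where *: "x = fr a b" "(a, b) \<in> hf" unfolding L_carrier by blast
      show "\<zero>\<^bsub>L\<^esub> \<oplus>\<^bsub>L\<^esub> x = x" unfolding * L_zero using * by (simp add: L_add)
      have n: "(- a, b) \<in> hf" using * unfolding hf_def by (auto intro: vars_le_uminus homog_uminus)
      have "fr (- a) b \<oplus>\<^bsub>L\<^esub> x = \<zero>\<^bsub>L\<^esub>"
        unfolding *(1) L_zero L_add[OF n *(2)] by (rule fr_eqI'[OF hf_add[OF n *(2)]]) simp_all
      then show "\<exists>y\<in>carrier L. y \<oplus>\<^bsub>L\<^esub> x = \<zero>\<^bsub>L\<^esub>" using n by blast
    qed
    show "comm_monoid L"
    proof (rule comm_monoidI)
      fix x y z assume "x \<in> carrier L" "y \<in> carrier L" "z \<in> carrier L"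
      then obtain a b c d e f where *: "x = fr a b" "y = fr c d" "z = fr e f" "(a, b) \<in> hf" "(c, d) \<in> hf" "(e, f) \<in> hf"
        unfolding L_carrier by blast
      show "x \<otimes>\<^bsub>L\<^esub> y \<in> carrier L" unfolding * using * by (simp add: L_mult hf_mult L_carrierI)
      show "(x \<otimes>\<^bsub>L\<^esub> y) \<otimes>\<^bsub>L\<^esub> z = x \<otimes>\<^bsub>L\<^esub> (y \<otimes>\<^bsub>L\<^esub> z)"
        unfolding * using * by (simp add: L_mult hf_mult mult.assoc)
      show "x \<otimes>\<^bsub>L\<^esub> y = y \<otimes>\<^bsub>L\<^esub> x" unfolding * using * by (simp add: L_mult mult.commute)
    next
      show "\<one>\<^bsub>L\<^esub> \<in> carrier L" unfolding L_one by auto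
      fix x assume "x \<in> carrier L"
      then obtain a b where *: "x = fr a b" "(a, b) \<in> hf" unfolding L_carrier by blast
      show "\<one>\<^bsub>L\<^esub> \<otimes>\<^bsub>L\<^esub> x = x" unfolding * L_one using * by (simp add: L_mult)
    qed
    fix x y z assume "x \<in> carrier L" "y \<in> carrier L" "z \<in> carrier L"
    then obtain a b c d e f where *: "x = fr a b" "y = fr c d" "z = fr e f" "(a, b) \<in> hf" "(c, d) \<in> hf" "(e, f) \<in> hf"
      unfolding L_carrier by blast
    show "(x \<oplus>\<^bsub>L\<^esub> y) \<otimes>\<^bsub>L\<^esub> z = x \<otimes>\<^bsub>L\<^esub> z \<oplus>\<^bsub>L\<^esub> y \<otimes>\<^bsub>L\<^esub> z"
      unfolding * using * by (simp add: L_mult L_add hf_mult hf_add) (intro fr_eqI' hf_mult hf_add; simp add: algebra_simps)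
  qed
  then interpret cring L .
  show ?thesis
  proof (rule cring_fieldI2)
    show "\<zero>\<^bsub>L\<^esub> \<noteq> \<one>\<^bsub>L\<^esub>"
    proof
      assume "\<zero>\<^bsub>L\<^esub> = \<one>\<^bsub>L\<^esub>"
      then have "0 * 1 - 1 * 1 \<in> I" unfolding L_zero L_one by (intro fr_eqD) auto
      then have "- (0 * 1 - 1 * 1) \<in> I" by (rule I_uminus)
      then show False using I_1 by simp
    qed
    fix x assume x: "x \<in> carrier L" "x \<noteq> \<zero>\<^bsub>L\<^esub>"
    then obtain a b where *: "x = fr a b" "(a, b) \<in> hf" unfolding L_carrier by blast
    have "a \<notin> I"
    proof
      assume "a \<in> I"
      then have "fr a b = fr 0 1" using * by (intro fr_eqI) auto
      then show False using x unfolding * L_zero by simp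
    qed
    then have ba: "(b, a) \<in> hf" using *(2) unfolding hf_def by auto
    have "x \<otimes>\<^bsub>L\<^esub> fr b a = \<one>\<^bsub>L\<^esub>"
      unfolding *(1) L_one L_mult[OF *(2) ba] by (rule fr_eqI'[OF hf_mult[OF *(2) ba]]) simp_all
    then show "\<exists>y\<in>carrier L. x \<otimes>\<^bsub>L\<^esub> y = \<one>\<^bsub>L\<^esub>" using ba by blast
  qed
qed

definition emb :: "'k \<Rightarrow> ('b mpolynomial \<times> 'b mpolynomial) set" where
  "emb c = fr (Poly_Mapping.single {#} c) 1"

lemma emb_hf [simp]: "(Poly_Mapping.single {#} c, 1) \<in> hf"
  using I_1 by (intro hfI[of _ _ 0]) (auto intro: vars_le_single homog_single)

lemma scalars_L: "scalars L emb"
proof -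
  interpret field L by (rule field_L)
  show ?thesis
  proof
    fix a b
    show "emb a \<in> carrier L" unfolding emb_def by auto
    show "emb (a + b) = emb a \<oplus>\<^bsub>L\<^esub> emb b" unfolding emb_def by (simp add: L_add single_add)
    show "emb (a * b) = emb a \<otimes>\<^bsub>L\<^esub> emb b" unfolding emb_def by (simp add: L_mult mult_single)
    show "emb 1 = \<one>\<^bsub>L\<^esub>" unfolding emb_def L_one single_one[symmetric] by simp
  qed
qed

lemma residue_scalars_eq: "residue_scalars k n P = range emb"
  unfolding residue_scalars_def emb_def fr_def k_simps(1) image_image const_poly_Phi Phi_1[of n] ..

lemma fr_sum:
  assumes A: "finite A" "A \<noteq> {}" and h: "\<And>i. i \<in> A \<Longrightarrow> (f i, g) \<in> hf" and g: "homog d g" "g \<noteq> 0"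
    and y: "y \<in> carrier L" and e: "\<And>i. i \<in> A \<Longrightarrow> fr (f i) g = emb (u i) \<oplus>\<^bsub>L\<^esub> emb (v i) \<otimes>\<^bsub>L\<^esub> y"
  shows "(sum f A, g) \<in> hf \<and> fr (sum f A) g = emb (sum u A) \<oplus>\<^bsub>L\<^esub> emb (sum v A) \<otimes>\<^bsub>L\<^esub> y"
  using A h e
proof (induction A rule: finite_ne_induct)
  case (insert i A)
  interpret scalars L emb by (rule scalars_L)
  have IH: "(sum f A, g) \<in> hf" "fr (sum f A) g = emb (sum u A) \<oplus>\<^bsub>L\<^esub> emb (sum v A) \<otimes>\<^bsub>L\<^esub> y" using insert by auto
  have i: "(f i, g) \<in> hf" "fr (f i) g = emb (u i) \<oplus>\<^bsub>L\<^esub> emb (v i) \<otimes>\<^bsub>L\<^esub> y" using insert by auto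
  have s: "(f i + sum f A, g) \<in> hf" using hf_same_denominator[OF i(1) IH(1) g] .
  have "fr (f i + sum f A) g = fr (f i) g \<oplus>\<^bsub>L\<^esub> fr (sum f A) g"
    unfolding L_add[OF i(1) IH(1)] by (rule fr_eqI'[OF s hf_add[OF i(1) IH(1)]]) (simp add: algebra_simps)
  also have "\<dots> = emb (u i + sum u A) \<oplus>\<^bsub>L\<^esub> emb (v i + sum v A) \<otimes>\<^bsub>L\<^esub> y"
    unfolding i(2) IH(2) emb_add using y by (simp add: l_distr a_ac)
  finally show ?case using s insert.hyps by simp
qed simp

end

text \<open>Otherwise the residue field consists of the combinations of 1 and some \<open>y\<close>
  with scalar square. In a chart the coordinates of the point become p_i + q_i y, and comparing the
  components of the two equations contradicts \<open>no_quadratic_point\<close>.\<close>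

theorem four_dvd_residue_degree:
  fixes \<phi> :: "series \<Rightarrow> 'b"
  assumes inj: "inj \<phi>"
    and locus: "P \<in> zero_locus (transport.k \<phi>) 4 {transport.\<Phi> \<phi> (transport.quad tt), transport.\<Phi> \<phi> (transport.quad (\<lambda>i. of_nat i * tt i))}"
    and d: "residue_degree (transport.k \<phi>) 4 P d"
  shows "4 dvd d"
proof (rule ccontr)
  assume nd: "\<not> 4 dvd d"
  interpret transport \<phi> by unfold_locales (rule inj)
  have pt: "P \<in> proj_space k 4" using locus unfolding zero_locus_def by blast
  interpret proj_point \<phi> 4 P by unfold_locales (rule pt)
  interpret scalars L emb by (rule scalars_L)
  interpret odd_closed_scalars L emb
  proof unfold_locales
    fix p :: "series poly" assume "odd (Polynomial.degree p)"
    then show "\<exists>x. poly p x = 0" by (rule odd_degree_root)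
  qed
  have "\<Phi> (quad tt) \<in> P" "\<Phi> (quad (\<lambda>i. of_nat i * tt i)) \<in> P"
    using locus unfolding zero_locus_def by blast+
  then have quads: "quad tt \<in> I" "quad (\<lambda>i. of_nat i * tt i) \<in> I"
    by (simp_all only: mem_P_iff[OF quad_vars])
  have "dimension d K (carrier L)"
    using d unfolding residue_degree_def residue_scalars_eq K_def .
  then obtain y a where y: "y \<in> carrier L" "y \<otimes>\<^bsub>L\<^esub> y = emb a" "y \<in> K \<Longrightarrow> y = \<zero>\<^bsub>L\<^esub>"
    and gen: "\<And>z. z \<in> carrier L \<Longrightarrow> \<exists>p q. z = emb p \<oplus>\<^bsub>L\<^esub> emb q \<otimes>\<^bsub>L\<^esub> y"
    using degree_not_dvd_4[OF _ nd] by blast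
  obtain j where j: "j \<le> 4" "xv j \<notin> I" using exists_xv_notin by blast
  have z: "(xv i, xv j) \<in> hf" if "i \<le> 4" for i using that j by (intro hfI[of _ _ 1] xv_vars xv_homog)
  \<comment> \<open>In the rational case \<open>y\<close> is zero and its coefficient arbitrary; it
    is normalised to 0, so that coefficients can be compared in both cases.\<close>
  have "\<exists>p q. (y \<in> K \<longrightarrow> q = 0) \<and> fr (xv i) (xv j) = emb p \<oplus>\<^bsub>L\<^esub> emb q \<otimes>\<^bsub>L\<^esub> y" if i: "i \<le> 4" for i
  proof -
    obtain p q where pq: "fr (xv i) (xv j) = emb p \<oplus>\<^bsub>L\<^esub> emb q \<otimes>\<^bsub>L\<^esub> y" using gen z[OF i] by blast
    show ?thesis
    proof (cases "y \<in> K")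
      case True
      then have "fr (xv i) (xv j) = emb p \<oplus>\<^bsub>L\<^esub> emb 0 \<otimes>\<^bsub>L\<^esub> y" using pq y(3) by (simp add: emb_0)
      then show ?thesis by blast
    qed (use pq in blast)
  qed
  then obtain p q where q0: "\<And>i. i \<le> 4 \<Longrightarrow> y \<in> K \<Longrightarrow> q i = 0"
    and pq: "\<And>i. i \<le> 4 \<Longrightarrow> fr (xv i) (xv j) = emb (p i) \<oplus>\<^bsub>L\<^esub> emb (q i) \<otimes>\<^bsub>L\<^esub> y" by metis
  have zero: "u = 0 \<and> v = 0" if "emb u \<oplus>\<^bsub>L\<^esub> emb v \<otimes>\<^bsub>L\<^esub> y = \<zero>\<^bsub>L\<^esub>" "y \<in> K \<Longrightarrow> v = 0" for u v
  proof (cases "y \<in> K")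
    case True
    then have "emb u = \<zero>\<^bsub>L\<^esub>" using that y(3) by simp
    then show ?thesis using that(2)[OF True] emb_eq_0 by blast
  qed (use emb_combination_eq_0[OF y(1)] that in blast)
  have pj: "p j = 1 \<and> q j = 0"
  proof -
    have "fr (xv j) (xv j) = fr 1 1" using z[OF j(1)] by (intro fr_eqI') auto
    then have "emb (p j) \<oplus>\<^bsub>L\<^esub> emb (q j) \<otimes>\<^bsub>L\<^esub> y = \<one>\<^bsub>L\<^esub>" using pq[OF j(1)] by (simp add: L_one)
    then have "emb (- 1) \<oplus>\<^bsub>L\<^esub> (emb (p j) \<oplus>\<^bsub>L\<^esub> emb (q j) \<otimes>\<^bsub>L\<^esub> y) = \<zero>\<^bsub>L\<^esub>" by (simp add: emb_uminus emb_1 l_neg)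
    then have "emb (- 1 + p j) \<oplus>\<^bsub>L\<^esub> emb (q j) \<otimes>\<^bsub>L\<^esub> y = \<zero>\<^bsub>L\<^esub>" unfolding emb_add using y(1) by (simp add: a_assoc)
    then have "- 1 + p j = 0 \<and> q j = 0" using zero q0[OF j(1)] by blast
    then show ?thesis by simp
  qed
  let ?g = "xv j * xv j"
  have gI: "?g \<notin> I" using I_prime[OF xv_vars xv_vars] j by blast
  have g0: "?g \<noteq> 0" using gI I_0 by metis
  have hg: "homog 2 ?g" using homog_mult[OF xv_homog xv_homog] by (simp add: numeral_2_eq_2)
  \<comment> \<open>Dividing by the square of the chart coordinate turns the form into an element of
    the residue field. It vanishes there, so its components along 1 and \<open>y\<close> vanish; the
    second carries a factor 2, which is cancelled.\<close>
  have eqs: "(\<Sum>i\<le>4. c i * (p i * p i + a * (q i * q i))) = 0 \<and> (\<Sum>i\<le>4. c i * (p i * q i)) = 0" if c: "quad c \<in> I" for c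
  proof -
    have m: "(Poly_Mapping.single {#i, i#} (c i), ?g) \<in> hf" if "i \<le> 4" for i
      using that gI hg j by (intro hfI[of _ _ 2] vars_le_single vars_le_mult xv_vars homog_single) auto
    have t: "fr (Poly_Mapping.single {#i, i#} (c i)) ?g = emb (c i * (p i * p i + a * (q i * q i))) \<oplus>\<^bsub>L\<^esub> emb (2 * (c i * (p i * q i))) \<otimes>\<^bsub>L\<^esub> y"
      if i: "i \<le> 4" for i
    proof -
      have "Poly_Mapping.single {#i, i#} (c i) = Poly_Mapping.single {#} (c i) * (xv i * xv i)"
        unfolding xv_def by (simp add: mult_single)
      then have "fr (Poly_Mapping.single {#i, i#} (c i)) ?g = emb (c i) \<otimes>\<^bsub>L\<^esub> (fr (xv i) (xv j) \<otimes>\<^bsub>L\<^esub> fr (xv i) (xv j))"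
        unfolding emb_def using z[OF i] hf_mult[OF z[OF i] z[OF i]] by (simp add: L_mult)
      also have "\<dots> = emb (c i) \<otimes>\<^bsub>L\<^esub> (emb (p i) \<otimes>\<^bsub>L\<^esub> emb (p i) \<oplus>\<^bsub>L\<^esub> emb (q i) \<otimes>\<^bsub>L\<^esub> emb (q i) \<otimes>\<^bsub>L\<^esub> (y \<otimes>\<^bsub>L\<^esub> y)
        \<oplus>\<^bsub>L\<^esub> (emb (p i) \<otimes>\<^bsub>L\<^esub> emb (q i) \<oplus>\<^bsub>L\<^esub> emb (p i) \<otimes>\<^bsub>L\<^esub> emb (q i)) \<otimes>\<^bsub>L\<^esub> y)"
        unfolding pq[OF i] using y(1) by (simp add: l_distr r_distr m_ac a_ac)
      also have "\<dots> = emb (c i) \<otimes>\<^bsub>L\<^esub> (emb (p i * p i + q i * q i * a) \<oplus>\<^bsub>L\<^esub> emb (p i * q i + p i * q i) \<otimes>\<^bsub>L\<^esub> y)"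
        unfolding y(2) by (simp only: emb_add emb_mult)
      also have "\<dots> = emb (c i * (p i * p i + q i * q i * a)) \<oplus>\<^bsub>L\<^esub> emb (c i * (p i * q i + p i * q i)) \<otimes>\<^bsub>L\<^esub> y"
        unfolding emb_mult[of "c i"] using y(1) by (simp add: r_distr m_assoc)
      also have "c i * (p i * q i + p i * q i) = 2 * (c i * (p i * q i))" by (simp add: algebra_simps)
      also have "c i * (p i * p i + q i * q i * a) = c i * (p i * p i + a * (q i * q i))" by (simp add: algebra_simps)
      finally show ?thesis .
    qed
    have "(quad c, ?g) \<in> hf \<and> fr (quad c) ?g = emb (\<Sum>i\<le>4. c i * (p i * p i + a * (q i * q i))) \<oplus>\<^bsub>L\<^esub> emb (\<Sum>i\<le>4. 2 * (c i * (p i * q i))) \<otimes>\<^bsub>L\<^esub> y"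
      unfolding quad_def by (rule fr_sum[OF _ _ m hg g0 y(1) t]) auto
    moreover from this have "fr (quad c) ?g = \<zero>\<^bsub>L\<^esub>" unfolding L_zero using c by (intro fr_eqI) auto
    ultimately have "emb (\<Sum>i\<le>4. c i * (p i * p i + a * (q i * q i))) \<oplus>\<^bsub>L\<^esub> emb (\<Sum>i\<le>4. 2 * (c i * (p i * q i))) \<otimes>\<^bsub>L\<^esub> y = \<zero>\<^bsub>L\<^esub>" by simp
    moreover have "(\<Sum>i\<le>4. 2 * (c i * (p i * q i))) = 0" if "y \<in> K"
      by (intro sum.neutral) (use q0 that in auto)
    ultimately have "(\<Sum>i\<le>4. c i * (p i * p i + a * (q i * q i))) = 0 \<and> (\<Sum>i\<le>4. 2 * (c i * (p i * q i))) = 0" by (rule zero)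
    then show ?thesis by (simp add: sum_distrib_left[symmetric])
  qed
  show False
    using no_quadratic_point[of j p q a] j pj eqs[OF quads(1)] eqs[OF quads(2)] by (simp add: mult.assoc)
qed

section \<open>Evaluation at a point of degree 4\<close>

definition quad_ext :: "'a::field set \<Rightarrow> 'a \<Rightarrow> 'a set" where
  "quad_ext F x = {a + b * x |a b. a \<in> F \<and> b \<in> F}"

text \<open>Closure under division is left out: norms down to a smaller ring take the place of
  inverses.\<close>

definition subring_set :: "'a::field set \<Rightarrow> bool" where
  "subring_set F \<longleftrightarrow> 0 \<in> F \<and> 1 \<in> F \<and> (\<forall>a\<in>F. \<forall>b\<in>F. a + b \<in> F \<and> a * b \<in> F \<and> a - b \<in> F)"

lemma subring_setD:
  assumes "subring_set F"
  shows "0 \<in> F" "1 \<in> F" "a \<in> F \<Longrightarrow> b \<in> F \<Longrightarrow> a + b \<in> F" "a \<in> F \<Longrightarrow> b \<in> F \<Longrightarrow> a * b \<in> F" "a \<in> F \<Longrightarrow> b \<in> F \<Longrightarrow> a - b \<in> F"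
  using assms unfolding subring_set_def by auto

lemma quad_extI: "a \<in> F \<Longrightarrow> b \<in> F \<Longrightarrow> a + b * x \<in> quad_ext F x"
  unfolding quad_ext_def by blast

lemma subset_quad_ext: "subring_set F \<Longrightarrow> F \<subseteq> quad_ext F x"
  using quad_extI[of _ F 0 x] subring_setD(1)[of F] by auto

lemma mem_quad_ext: "subring_set F \<Longrightarrow> x \<in> quad_ext F x"
  using quad_extI[of 0 F 1 x] subring_setD(1,2)[of F] by auto

lemma subring_quad_ext:
  assumes F: "subring_set F" and x: "x * x \<in> F"
  shows "subring_set (quad_ext F x)"
  unfolding subring_set_def
proof (intro conjI ballI)
  note c = subring_setD[OF F]
  show "0 \<in> quad_ext F x" "1 \<in> quad_ext F x" using subset_quad_ext[OF F] c by auto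
  fix u v assume "u \<in> quad_ext F x" "v \<in> quad_ext F x"
  then obtain a b a' b' where u: "u = a + b * x" "a \<in> F" "b \<in> F" and v: "v = a' + b' * x" "a' \<in> F" "b' \<in> F"
    unfolding quad_ext_def by blast
  have "u + v = (a + a') + (b + b') * x" "u - v = (a - a') + (b - b') * x"
    "u * v = (a * a' + b * b' * (x * x)) + (a * b' + b * a') * x"
    unfolding u v by (simp_all add: algebra_simps)
  then show "u + v \<in> quad_ext F x" "u * v \<in> quad_ext F x" "u - v \<in> quad_ext F x"
    using quad_extI c u v x by metis+
qed

text \<open>Multiplying by the conjugate \<open>a - b x\<close> makes \<open>a + b x\<close> an element of \<open>F\<close>; if the conjugate vanishes, \<open>a + b x = 2 a\<close>.\<close>

lemma quad_ext_norm:
  assumes F: "subring_set F" and x: "x * x \<in> F"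
    and nrm: "\<And>a. a \<in> F \<Longrightarrow> a \<noteq> 0 \<Longrightarrow> \<exists>z\<in>F. a * z \<in> T \<and> a * z \<noteq> 0"
    and y: "y \<in> quad_ext F x" "y \<noteq> 0"
  shows "\<exists>z\<in>quad_ext F x. y * z \<in> T \<and> y * z \<noteq> 0"
proof -
  note c = subring_setD[OF F]
  note c' = subring_setD[OF subring_quad_ext[OF F x]]
  obtain a b where ab: "y = a + b * x" "a \<in> F" "b \<in> F" using y(1) unfolding quad_ext_def by blast
  define w where "w = a - b * x"
  have w: "w \<in> quad_ext F x" using quad_extI[OF ab(2) c(5)[OF c(1) ab(3)], of x] unfolding w_def by simp
  show ?thesis
  proof (cases "w = 0")
    case True
    then have "y = a + a" unfolding w_def ab by simp
    then have "y \<in> F" using c(3)[OF ab(2) ab(2)] by (simp only:)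
    then show ?thesis using nrm[of y] y(2) subset_quad_ext[OF F] by blast
  next
    case False
    have "y * w = a * a - b * b * (x * x)" unfolding w_def ab by (simp add: algebra_simps)
    then have "y * w \<in> F" using c ab x by simp
    moreover have "y * w \<noteq> 0" using False y(2) by simp
    ultimately obtain z where z: "z \<in> F" "y * w * z \<in> T" "y * w * z \<noteq> 0" using nrm by blast
    have "w * z \<in> quad_ext F x" using c'(4)[OF w] z(1) subset_quad_ext[OF F] by blast
    then show ?thesis using z by (intro bexI[of _ "w * z"]) (auto simp: mult.assoc)
  qed
qed

text \<open>
  The point is \<open>(1 : \<surd>-2 t\<^sub>1\<^sup>-\<^sup>1 : t\<^sub>2\<^sup>-\<^sup>1 : 0 : 0)\<close> over the extension \<open>double : k \<rightarrow> k\<close>, in which the \<open>t\<^sub>i\<close>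
  become squares.
\<close>

definition pt :: "nat \<Rightarrow> series" where
  "pt i = (if i = 0 then 1 else if i = 1 then single_series (- wt 1) (\<i> * complex_of_real (sqrt 2)) else if i = 2 then single_series (- wt 2) 1 else 0)"

definition doubles :: "series set" where "doubles = range double"

text \<open>Over the image of \<open>double\<close> this ring is spanned by 1, \<open>pt 1\<close>,
  \<open>pt 2\<close> and their product; it contains the values at the point of all homogeneous
  polynomials.\<close>

definition point_ring :: "series set" where "point_ring = quad_ext (quad_ext doubles (pt 1)) (pt 2)"

lemma subring_doubles: "subring_set doubles"
proof -
  have "double a - double b = double (a - b)" for a b
    using double_add[of "a - b" b] by (simp add: algebra_simps)
  then show ?thesis unfolding subring_set_def doubles_def
    by (auto simp: double_add[symmetric] double_mult[symmetric] intro: range_eqI[of _ double 0] range_eqI[of _ double 1])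
qed

lemma pt_1_square: "pt 1 * pt 1 = double (single_series (- wt 1) (- 2))"
  and pt_2_square: "pt 2 * pt 2 = double (single_series (- wt 2) 1)"
proof -
  have "complex_of_real (sqrt 2) * complex_of_real (sqrt 2) = 2" unfolding of_real_mult[symmetric] by simp
  moreover have "(\<i> * complex_of_real (sqrt 2)) * (\<i> * complex_of_real (sqrt 2)) = (\<i> * \<i>) * (complex_of_real (sqrt 2) * complex_of_real (sqrt 2))"
    by (simp only: mult_ac)
  ultimately have "(\<i> * complex_of_real (sqrt 2)) * (\<i> * complex_of_real (sqrt 2)) = - 2" by simp
  then have "single_series (- wt 1 + - wt 1) ((\<i> * complex_of_real (sqrt 2)) * (\<i> * complex_of_real (sqrt 2))) = single_series (2 * - wt 1) (- 2)"
    by (simp only: mult_2)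
  moreover have "pt 1 * pt 1 = single_series (- wt 1 + - wt 1) ((\<i> * complex_of_real (sqrt 2)) * (\<i> * complex_of_real (sqrt 2)))"
    unfolding pt_def by (subst single_mult[symmetric]) auto
  ultimately show "pt 1 * pt 1 = double (single_series (- wt 1) (- 2))" by (simp only: double_single exps_uminus wt_exps)
  show "pt 2 * pt 2 = double (single_series (- wt 2) 1)" unfolding pt_def by (simp add: single_mult double_single)
qed

lemma subring_point_ring: "subring_set point_ring"
  unfolding point_ring_def
proof (rule subring_quad_ext)
  show 1: "subring_set (quad_ext doubles (pt 1))" by (rule subring_quad_ext[OF subring_doubles]) (simp only: pt_1_square doubles_def rangeI)
  have "pt 2 * pt 2 \<in> doubles" by (simp only: pt_2_square doubles_def rangeI)
  then show "pt 2 * pt 2 \<in> quad_ext doubles (pt 1)" using subset_quad_ext[OF subring_doubles] by blast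
qed

lemma doubles_subset_point_ring: "doubles \<subseteq> point_ring"
proof -
  have "subring_set (quad_ext doubles (pt 1))" by (rule subring_quad_ext[OF subring_doubles]) (simp only: pt_1_square doubles_def rangeI)
  then show ?thesis unfolding point_ring_def using subset_quad_ext[OF subring_doubles] subset_quad_ext by blast
qed

lemma pt_point_ring: "pt i \<in> point_ring"
proof -
  have 1: "subring_set (quad_ext doubles (pt 1))" by (rule subring_quad_ext[OF subring_doubles]) (simp only: pt_1_square doubles_def rangeI)
  have "pt 1 \<in> point_ring" unfolding point_ring_def using mem_quad_ext[OF subring_doubles] subset_quad_ext[OF 1] by blast
  moreover have "pt 2 \<in> point_ring" unfolding point_ring_def using mem_quad_ext[OF 1] .
  moreover have "pt 0 \<in> point_ring" using subring_setD(2)[OF subring_point_ring] by (simp add: pt_def)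
  moreover have "pt i = 0" if "i \<noteq> 0" "i \<noteq> 1" "i \<noteq> 2" using that by (simp add: pt_def)
  ultimately show ?thesis using subring_setD(1)[OF subring_point_ring] by metis
qed

text \<open>Two successive norms remove \<open>pt 2\<close> and then \<open>pt 1\<close>. An inverse
  of \<open>y\<close> is thereby written as an element of the ring over an element coming from the
  base field.\<close>

lemma point_ring_norm:
  assumes "y \<in> point_ring" "y \<noteq> 0"
  shows "\<exists>z\<in>point_ring. \<exists>c. y * z = double c \<and> c \<noteq> 0"
proof -
  have s1: "pt 1 * pt 1 \<in> doubles" "pt 2 * pt 2 \<in> doubles" by (simp_all only: pt_1_square pt_2_square doubles_def rangeI)
  note 1 = subring_quad_ext[OF subring_doubles s1(1)]
  have s2: "pt 2 * pt 2 \<in> quad_ext doubles (pt 1)" using s1 subset_quad_ext[OF subring_doubles] by blast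
  have "\<exists>z\<in>doubles. a * z \<in> doubles \<and> a * z \<noteq> 0" if "a \<in> doubles" "a \<noteq> 0" for a
    using that subring_setD(2)[OF subring_doubles] by (intro bexI[of _ 1]) auto
  then have "\<exists>z\<in>quad_ext doubles (pt 1). a * z \<in> doubles \<and> a * z \<noteq> 0" if "a \<in> quad_ext doubles (pt 1)" "a \<noteq> 0" for a
    using quad_ext_norm[OF subring_doubles s1(1) _ that] by blast
  then have "\<exists>z\<in>point_ring. y * z \<in> doubles \<and> y * z \<noteq> 0"
    using quad_ext_norm[OF 1 s2 _ assms(1)[unfolded point_ring_def] assms(2)] unfolding point_ring_def by blast
  then obtain z c where z: "z \<in> point_ring" "y * z = double c" "y * z \<noteq> 0" unfolding doubles_def by blast
  then have "c \<noteq> 0" by auto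
  then show ?thesis using z by blast
qed

lemma point_ringE:
  assumes "y \<in> point_ring"
  obtains a b c d where "y = double a + double b * pt 1 + double c * pt 2 + double d * (pt 1 * pt 2)"
  using assms unfolding point_ring_def quad_ext_def doubles_def by (auto simp: algebra_simps)

definition xm :: "nat multiset \<Rightarrow> series" where "xm m = prod_mset (image_mset pt m)"

lemma xm_simps [simp]: "xm {#} = 1" "xm (add_mset i m) = pt i * xm m" "xm (a + b) = xm a * xm b"
  unfolding xm_def by simp_all

lemma xm_point_ring: "xm m \<in> point_ring"
proof (induction m)
  case empty
  then show ?case using subring_setD(2)[OF subring_point_ring] by simp
next
  case (add i m)
  then show ?case using subring_setD(4)[OF subring_point_ring pt_point_ring] by simp
qed

text \<open>Each variable is sent to its coordinate at the point times a new variable, and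
  coefficients pass through \<open>double\<close>. The new variable records the degree, so that the
  kernel is a homogeneous ideal.\<close>

definition ev :: "series mpoly \<Rightarrow> series poly" where
  "ev p = (\<Sum>m\<in>Poly_Mapping.keys p. Polynomial.monom (double (lookup p m) * xm m) (size m))"

lemma ev_superset:
  assumes "finite A" "Poly_Mapping.keys p \<subseteq> A"
  shows "ev p = (\<Sum>m\<in>A. Polynomial.monom (double (lookup p m) * xm m) (size m))"
  unfolding ev_def by (rule sum.mono_neutral_left[OF assms]) (auto simp: in_keys_iff)

lemma ev_add: "ev (p + q) = ev p + ev q"
proof -
  define A where "A = Poly_Mapping.keys p \<union> Poly_Mapping.keys q"
  have A: "finite A" "Poly_Mapping.keys p \<subseteq> A" "Poly_Mapping.keys q \<subseteq> A" "Poly_Mapping.keys (p + q) \<subseteq> A"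
    unfolding A_def using keys_add[of p q] by auto
  show ?thesis unfolding ev_superset[OF A(1,2)] ev_superset[OF A(1,3)] ev_superset[OF A(1,4)]
    by (simp add: lookup_add double_add sum.distrib[symmetric] distrib_right add_monom)
qed

lemma ev_0 [simp]: "ev 0 = 0"
  unfolding ev_def by simp

lemma ev_sum: "ev (sum f A) = (\<Sum>i\<in>A. ev (f i))"
  by (induction A rule: infinite_finite_induct) (auto simp: ev_add)

lemma ev_single [simp]: "ev (Poly_Mapping.single m c) = Polynomial.monom (double c * xm m) (size m)"
  by (subst ev_superset[of "{m}"]) auto

lemma ev_mult: "ev (p * q) = ev p * ev q"
proof -
  have "p * q = (\<Sum>a\<in>Poly_Mapping.keys p. \<Sum>b\<in>Poly_Mapping.keys q. Poly_Mapping.single (a + b) (lookup p a * lookup q b))"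
    by (subst (1) poly_mapping_sum_single[of p], subst (1) poly_mapping_sum_single[of q])
      (simp add: sum_product mult_single)
  then have "ev (p * q) = (\<Sum>a\<in>Poly_Mapping.keys p. \<Sum>b\<in>Poly_Mapping.keys q.
    Polynomial.monom (double (lookup p a) * xm a) (size a) * Polynomial.monom (double (lookup q b) * xm b) (size b))"
    by (simp add: ev_sum double_mult mult_monom mult_ac)
  then show ?thesis unfolding ev_def sum_product .
qed

lemma ev_uminus: "ev (- p) = - ev p"
  using ev_add[of "- p" p] by (simp add: eq_neg_iff_add_eq_0)

lemma ev_diff: "ev (p - q) = ev p - ev q"
  using ev_add[of p "- q"] by (simp add: ev_uminus)

lemma ev_homog:
  assumes "homog d p"
  shows "\<exists>y\<in>point_ring. ev p = Polynomial.monom y d"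
proof -
  define y where "y = (\<Sum>m\<in>Poly_Mapping.keys p. double (lookup p m) * xm m)"
  have "ev p = (\<Sum>m\<in>Poly_Mapping.keys p. Polynomial.monom (double (lookup p m) * xm m) d)"
    unfolding ev_def using assms unfolding homog_def by (intro sum.cong refl) (auto simp: in_keys_iff)
  then have "ev p = Polynomial.monom y d" unfolding y_def by (simp add: monom_sum)
  moreover have "y \<in> point_ring" unfolding y_def
  proof -
    have "(\<Sum>m\<in>A. double (lookup p m) * xm m) \<in> point_ring" if "finite A" for A
      using that
    proof (induction A rule: finite_induct)
      case (insert m A)
      have "double (lookup p m) \<in> point_ring" using doubles_subset_point_ring unfolding doubles_def by blast
      then show ?case using insert subring_setD(3,4)[OF subring_point_ring] xm_point_ring by simp
    qed (use subring_setD(1)[OF subring_point_ring] in simp)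
    then show "(\<Sum>m\<in>Poly_Mapping.keys p. double (lookup p m) * xm m) \<in> point_ring" by simp
  qed
  ultimately show ?thesis by blast
qed

text \<open>As \<open>pt 0 = 1\<close>, the four monomials x_0^2, x_0 x_1, x_0 x_2, x_1 x_2 evaluate
  to the four spanning elements of \<open>point_ring\<close>.\<close>

lemma point_ring_ev:
  assumes "y \<in> point_ring"
  obtains a b c d where "ev (Poly_Mapping.single {#0, 0#} a + Poly_Mapping.single {#0, 1#} b + Poly_Mapping.single {#0, 2#} c + Poly_Mapping.single {#1, 2#} d) = Polynomial.monom y 2"
proof -
  obtain a b c d where y: "y = double a + double b * pt 1 + double c * pt 2 + double d * (pt 1 * pt 2)" using point_ringE[OF assms] .
  have "pt 0 = 1" by (simp add: pt_def)
  then have "ev (Poly_Mapping.single {#0, 0#} a + Poly_Mapping.single {#0, 1#} b + Poly_Mapping.single {#0, 2#} c + Poly_Mapping.single {#1, 2#} d) = Polynomial.monom y 2"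
    unfolding y by (simp add: ev_add add_monom numeral_2_eq_2)
  then show ?thesis by (rule that)
qed

lemma (in scalars) Span_dimension_le:
  assumes "set Us \<subseteq> carrier R"
  shows "\<exists>m\<le>length Us. dimension m K (Span K Us)"
  using assms
proof (induction Us)
  case Nil
  then show ?case by (intro exI[of _ 0]) auto
next
  case (Cons u Us)
  then obtain m where m: "m \<le> length Us" "dimension m K (Span K Us)" by auto
  show ?case
  proof (cases "u \<in> Span K Us")
    case True
    have "Span K (u # Us) = Span K Us"
    proof
      show "Span K (u # Us) \<subseteq> Span K Us"
        using mono_Span_subset[OF subfield_K, of "u # Us" Us] True Span_base_incl[OF subfield_K, of Us] Cons.prems by auto
      show "Span K Us \<subseteq> Span K (u # Us)" using mono_Span[OF subfield_K, of Us u] Cons.prems by auto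
    qed
    then show ?thesis using m by (intro exI[of _ m]) auto
  next
    case False
    then have "dimension (Suc m) K (Span K (u # Us))" using Suc_dim[of u "Span K Us" m K] m Cons.prems by auto
    then show ?thesis using m by (intro exI[of _ "Suc m"]) auto
  qed
qed

section \<open>The index\<close>

lift_definition hpart :: "nat \<Rightarrow> 'c::zero mpoly \<Rightarrow> 'c mpoly" is
  "\<lambda>d f m. if size m = d then f m else 0"
  by (erule finite_subset[rotated]) auto

lemma lookup_hpart: "lookup (hpart d f) m = (if size m = d then lookup f m else 0)"
  by transfer simp

lemma hpart_vars: "f \<in> vars_le n \<Longrightarrow> hpart d f \<in> vars_le n"
  unfolding vars_le_def by (auto simp: lookup_hpart split: if_splits)

lemma hpart_homog: "homog d (hpart d f)"
  unfolding homog_def by (auto simp: lookup_hpart)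

lemma ev_hpart: "ev (hpart d p) = Polynomial.monom (Polynomial.coeff (ev p) d) d"
proof (rule Polynomial.poly_eqI)
  fix i
  have "Poly_Mapping.keys (hpart d p) \<subseteq> Poly_Mapping.keys p" by (auto simp: in_keys_iff lookup_hpart split: if_splits)
  then have e: "ev (hpart d p) = (\<Sum>m\<in>Poly_Mapping.keys p. Polynomial.monom (double (lookup (hpart d p) m) * xm m) (size m))"
    by (intro ev_superset) auto
  show "Polynomial.coeff (ev (hpart d p)) i = Polynomial.coeff (Polynomial.monom (Polynomial.coeff (ev p) d) d) i"
    unfolding e unfolding ev_def
    by (auto simp: Polynomial.coeff_sum lookup_hpart intro!: sum.cong sum.neutral)
qed

lemma pt_0 [simp]: "pt 0 = 1"
  by (simp add: pt_def)

lemma xm_replicate_0: "xm (replicate_mset n 0) = 1"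
  by (induction n) auto

section \<open>The closed point of degree 4 and the index of the surface\<close>

locale series_transport = transport \<phi> for \<phi> :: "series \<Rightarrow> 'b"
begin

definition P0 :: "'b mpolynomial set" where "P0 = \<Phi> ` {p \<in> vars_le 4. ev p = 0}"

lemma mem_P0: "p \<in> vars_le 4 \<Longrightarrow> \<Phi> p \<in> P0 \<longleftrightarrow> ev p = 0"
  unfolding P0_def by auto

text \<open>\<open>P0\<close> is the kernel of the evaluation, a ring homomorphism into the domain
  \<open>series poly\<close>.\<close>

lemma primeideal_P0: "primeideal P0 (S 4)"
proof (rule primeidealI2)
  interpret S: cring "S 4" by (rule cring_S)
  show "cring (S 4)" by (rule cring_S)
  show "additive_subgroup P0 (S 4)"
  proof (rule additive_subgroup.intro, rule S.add.subgroupI)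
    show "P0 \<subseteq> carrier (S 4)" unfolding P0_def carrier_S by auto
    have "\<Phi> 0 \<in> P0" by (simp add: mem_P0)
    then show "P0 \<noteq> {}" by blast
    fix a b assume "a \<in> P0" "b \<in> P0"
    then obtain p q where *: "a = \<Phi> p" "p \<in> vars_le 4" "ev p = 0" "b = \<Phi> q" "q \<in> vars_le 4" "ev q = 0" unfolding P0_def by blast
    show "\<ominus>\<^bsub>S 4\<^esub> a \<in> P0" unfolding * using * by (simp add: Phi_uminus mem_P0 vars_le_uminus ev_uminus)
    show "a \<oplus>\<^bsub>S 4\<^esub> b \<in> P0" unfolding * Phi_add[symmetric] using * by (simp add: mem_P0 vars_le_add ev_add)
  qed
  fix a x assume "a \<in> P0" "x \<in> carrier (S 4)"
  then obtain p q where *: "a = \<Phi> p" "p \<in> vars_le 4" "ev p = 0" "x = \<Phi> q" "q \<in> vars_le 4" unfolding P0_def carrier_S by blast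
  show "x \<otimes>\<^bsub>S 4\<^esub> a \<in> P0" "a \<otimes>\<^bsub>S 4\<^esub> x \<in> P0"
    unfolding * Phi_mult[symmetric] using * by (simp_all add: mem_P0 vars_le_mult ev_mult)
next
  have "ev 1 = 1" using ev_single[of "{#}" 1] by (simp add: monom_0 one_pCons)
  then have "\<Phi> 1 \<notin> P0" by (simp add: mem_P0)
  moreover have "\<Phi> 1 \<in> carrier (S 4)" by simp
  ultimately show "carrier (S 4) \<noteq> P0" by blast
  fix a b assume ab: "a \<in> carrier (S 4)" "b \<in> carrier (S 4)" "a \<otimes>\<^bsub>S 4\<^esub> b \<in> P0"
  then obtain p q where *: "a = \<Phi> p" "p \<in> vars_le 4" "b = \<Phi> q" "q \<in> vars_le 4" unfolding carrier_S by blast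
  then have "ev p * ev q = 0" using ab(3) by (simp add: Phi_mult[symmetric] mem_P0 vars_le_mult ev_mult)
  then show "a \<in> P0 \<or> b \<in> P0" using * by (simp add: mem_P0)
qed

lemma homogeneous_part_Phi: "homogeneous_part k d (\<Phi> p) = \<Phi> (hpart d p)"
  unfolding homogeneous_part_def \<Phi>_def by (auto simp: lookup_hpart)

lemma P0_proj: "P0 \<in> proj_space k 4"
  unfolding proj_space_def
proof (intro CollectI conjI ballI allI)
  show "primeideal P0 (S 4)" by (rule primeideal_P0)
  show "homogeneous_part k d f \<in> P0" if f: "f \<in> P0" for f d
  proof -
    obtain p where p: "f = \<Phi> p" "p \<in> vars_le 4" "ev p = 0" using f unfolding P0_def by blast
    show ?thesis unfolding p homogeneous_part_Phi using p by (simp add: mem_P0 hpart_vars ev_hpart)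
  qed
  have v: "Poly_Mapping.single {#0#} (1::series) \<in> vars_le 4" by (rule vars_le_single) simp
  have "\<Phi> (Poly_Mapping.single {#0#} 1) \<in> irrelevant_ideal k 4"
    unfolding irrelevant_ideal_def
  proof (intro CollectI conjI)
    show "\<Phi> (Poly_Mapping.single {#0#} 1) \<in> carrier (S 4)" using v by simp
    show "\<Phi> (Poly_Mapping.single {#0#} 1) {#} = \<zero>\<^bsub>k\<^esub>" by (simp add: \<Phi>_def lookup_single when_def)
  qed
  moreover have "\<Phi> (Poly_Mapping.single {#0#} 1) \<notin> P0" using v by (simp add: mem_P0)
  ultimately show "\<not> irrelevant_ideal k 4 \<subseteq> P0" by blast
qed

lemma ev_quad: "ev (quad c) = Polynomial.monom (\<Sum>i\<le>4. double (c i) * (pt i * pt i)) 2"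
  unfolding quad_def by (simp add: ev_sum monom_sum numeral_2_eq_2)

text \<open>The terms of the first quadric at the point are 1, -2, 1, 0, 0. This second difference
  sums to 0 with the constant weights of the first equation and with the weights 0, 1, 2, 3, 4 of
  the second.\<close>

lemma double_tt_pt:
  "double (tt 0) * (pt 0 * pt 0) = 1" "double (tt 1) * (pt 1 * pt 1) = - 2" "double (tt 2) * (pt 2 * pt 2) = 1"
proof -
  have "single_series 0 1 = 1" by (simp add: one_series_def)
  moreover have "wt 0 = 0" by (simp add: wt_def)
  ultimately show "double (tt 0) * (pt 0 * pt 0) = 1" unfolding tt_def by simp
  have t: "tt i * single_series (- wt i) c = single_series 0 c" for i c
    unfolding tt_def by (simp add: single_mult)
  have "double (single_series 0 (- 2)) = - 2"
  proof -
    have "single_series 0 (- 2) = - 2"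
    proof (rule series_eqI)
      fix x
      have "nth (- 2 :: series) x = - (nth (of_nat 2) x)" by (metis nth_simps(3) of_nat_numeral)
      then show "nth (single_series 0 (- 2)) x = nth (- 2) x" unfolding nth_of_nat by simp
    qed
    moreover have "double (single_series 0 (- 2)) = single_series 0 (- 2)" using double_single[of 0 "- 2"] by simp
    ultimately show ?thesis by simp
  qed
  then show "double (tt 1) * (pt 1 * pt 1) = - 2" unfolding pt_1_square double_mult[symmetric] t by simp
  show "double (tt 2) * (pt 2 * pt 2) = 1" unfolding pt_2_square double_mult[symmetric] t by (simp add: one_series_def[symmetric])
qed

lemma double_of_nat: "double (of_nat n) = of_nat n"
  by (induction n) (auto simp: double_add)

lemma P0_locus: "P0 \<in> zero_locus k 4 {\<Phi> (quad tt), \<Phi> (quad (\<lambda>i. of_nat i * tt i))}"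
proof -
  have pt34: "pt 3 = 0" "pt 4 = 0" by (simp_all add: pt_def)
  have set: "{..4} = {0, 1, 2, 3, 4::nat}" by auto
  have s: "(\<Sum>i\<le>4. c i * (double (tt i) * (pt i * pt i))) = c 0 - 2 * c 1 + c 2" for c :: "nat \<Rightarrow> series"
    unfolding set by (simp add: double_tt_pt pt34 del: One_nat_def pt_0)
  have "ev (quad tt) = 0" unfolding ev_quad using s[of "\<lambda>_. 1"] by simp
  moreover have "ev (quad (\<lambda>i. of_nat i * tt i)) = 0"
    unfolding ev_quad using s[of of_nat] by (simp add: double_mult double_of_nat mult.assoc)
  ultimately show ?thesis unfolding zero_locus_def using P0_proj mem_P0 quad_vars by auto
qed

lemma quad_form_vars:
  "Poly_Mapping.single {#0, 0#} a + Poly_Mapping.single {#0, 1#} b + Poly_Mapping.single {#0, 2#} c + Poly_Mapping.single {#1, 2#} d \<in> vars_le 4"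
  by (intro vars_le_add vars_le_single) auto

text \<open>A larger homogeneous prime contains a form of degree \<open>d\<close> with nonzero
  value; multiplied by a quadratic form for the norm, it agrees modulo \<open>P0\<close> with a
  scalar times x_0^(d+2), so x_0 lies in the prime. Each square x_i^2 is a scalar multiple of x_0^2
  modulo \<open>P0\<close>, so all variables lie in it, which no point allows.\<close>

lemma P0_maximal:
  assumes Q: "Q \<in> proj_space k 4" "P0 \<subseteq> Q"
  shows "Q = P0"
proof (rule antisym[OF _ Q(2)], rule ccontr)
  interpret Q: proj_point \<phi> 4 Q by unfold_locales (rule Q)
  assume "\<not> Q \<subseteq> P0"
  then obtain f where f: "f \<in> Q" "f \<notin> P0" by blast
  have "Q \<subseteq> carrier (S 4)" using primeideal.axioms(1)[OF Q.primeideal_P] by (simp add: ideal.Icarr subsetI)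
  then obtain p where p: "f = \<Phi> p" "p \<in> vars_le 4" using f unfolding carrier_S by blast
  have sub: "r \<in> Q.I" if "r \<in> vars_le 4" "ev r = 0" for r
    using that Q(2) mem_P0 Q.mem_P_iff by blast
  have "ev p \<noteq> 0" using f p mem_P0 by simp
  then obtain d where d: "Polynomial.coeff (ev p) d \<noteq> 0" by (metis leading_coeff_0_iff)
  have "\<Phi> (hpart d p) \<in> Q"
    using Q(1) f(1) unfolding proj_space_def p homogeneous_part_Phi[symmetric] by blast
  then have hI: "hpart d p \<in> Q.I" using Q.mem_P_iff[OF hpart_vars[OF p(2)]] by simp
  obtain y where y: "y \<in> point_ring" "ev (hpart d p) = Polynomial.monom y d" using ev_homog[OF hpart_homog] by blast
  have "y \<noteq> 0" using y(2) d unfolding ev_hpart by auto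
  then obtain z c where z: "z \<in> point_ring" "y * z = double c" "c \<noteq> 0" using point_ring_norm[OF y(1)] by blast
  obtain g where g: "g \<in> vars_le 4" "ev g = Polynomial.monom z 2" using point_ring_ev[OF z(1)] quad_form_vars by metis
  define X0 :: "series \<Rightarrow> series mpoly" where "X0 c = Poly_Mapping.single (replicate_mset (d + 2) 0) c" for c
  have X0: "X0 c \<in> vars_le 4" for c unfolding X0_def by (rule vars_le_single) auto
  have gI: "g * hpart d p \<in> Q.I" by (rule Q.I_mult[OF hI g(1)])
  have "g * hpart d p - X0 c \<in> vars_le 4"
    using vars_le_add[OF Q.I_vars[OF gI] vars_le_uminus[OF X0]] by simp
  moreover have "ev (g * hpart d p - X0 c) = 0"
    unfolding ev_diff ev_mult y g X0_def using z by (simp add: mult_monom xm_replicate_0 mult.commute add.commute)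
  ultimately have "g * hpart d p - X0 c \<in> Q.I" by (rule sub)
  then have "X0 c \<in> Q.I" using Q.I_diff[OF gI] by fastforce
  then have "X0 1 \<in> Q.I" using Q.single_mem_I_cancel z(3) unfolding X0_def by blast
  moreover have "Q.xv 0 \<in> Q.I" if "Poly_Mapping.single (replicate_mset n 0) 1 \<in> Q.I" for n
    using that
  proof (induction n)
    case 0
    then show ?case using Q.I_1 by simp
  next
    case (Suc n)
    have "Poly_Mapping.single (replicate_mset (Suc n) 0) 1 = Q.xv 0 * Poly_Mapping.single (replicate_mset n 0) 1"
      unfolding Q.xv_def by (simp add: mult_single)
    moreover have "Poly_Mapping.single (replicate_mset n 0) 1 \<in> vars_le 4" by (rule vars_le_single) auto
    ultimately show ?case using Q.I_prime[OF Q.xv_vars[of 0]] Suc by fastforce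
  qed
  ultimately have x0: "Q.xv 0 \<in> Q.I" unfolding X0_def by blast
  have sq: "Q.xv i \<in> Q.I" if i: "i \<le> 4" and e: "pt i * pt i = double a" for i a
  proof -
    define r where "r = Q.xv i * Q.xv i - Poly_Mapping.single {#0#} a * Q.xv 0"
    have v: "Q.xv i * Q.xv i \<in> vars_le 4" "Poly_Mapping.single {#0#} a * Q.xv 0 \<in> vars_le 4"
      using i by (intro vars_le_mult vars_le_single Q.xv_vars; simp)+
    have "r \<in> vars_le 4" unfolding r_def using vars_le_add[OF v(1) vars_le_uminus[OF v(2)]] by simp
    moreover have "ev r = 0" unfolding r_def ev_diff ev_mult Q.xv_def using e by (simp add: mult_monom)
    ultimately have "r \<in> Q.I" by (rule sub)
    moreover have "Poly_Mapping.single {#0#} a * Q.xv 0 \<in> Q.I" by (rule Q.I_mult[OF x0]) (simp add: vars_le_single)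
    ultimately have "r + Poly_Mapping.single {#0#} a * Q.xv 0 \<in> Q.I" by (rule Q.I_add)
    then have "Q.xv i * Q.xv i \<in> Q.I" unfolding r_def by simp
    then show ?thesis using Q.I_prime[OF Q.xv_vars Q.xv_vars] i by blast
  qed
  have "Q.xv i \<in> Q.I" if i: "i \<le> 4" for i
  proof -
    consider "i = 0" | "i = 1" | "i = 2" | "i = 3 \<or> i = 4" using i by linarith
    then show ?thesis
    proof cases
      case 4
      then have "pt i * pt i = double 0" by (auto simp: pt_def)
      then show ?thesis by (rule sq[OF i])
    qed (use x0 sq[OF i] pt_1_square pt_2_square in auto)
  qed
  then show False using Q.exists_xv_notin by blast
qed

lemma P0_closed: "P0 \<in> closed_points k 4 {\<Phi> (quad tt), \<Phi> (quad (\<lambda>i. of_nat i * tt i))}"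
proof -
  have "zero_locus k 4 P0 = {P0}" unfolding zero_locus_def using P0_maximal P0_proj by auto
  moreover have "P0 \<subseteq> carrier (S 4)" unfolding P0_def carrier_S by auto
  ultimately show ?thesis unfolding closed_points_def using P0_locus by blast
qed

text \<open>The fractions 1, x_1/x_0, x_2/x_0 and x_1 x_2/x_0^2 span the residue field, so its
  degree is at most 4; it is positive and, as the point lies on the surface, divisible by 4. The
  independence of the four fractions is thus a consequence.\<close>

lemma P0_degree: "residue_degree k 4 P0 4"
proof -
  interpret P: proj_point \<phi> 4 P0 by unfold_locales (rule P0_proj)
  interpret L: scalars P.L P.emb by (rule P.scalars_L)
  have memI: "p \<in> P.I \<longleftrightarrow> ev p = 0" if "p \<in> vars_le 4" for p
    using P.mem_P_iff[OF that] mem_P0[OF that] by simp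
  define s where "s m = Poly_Mapping.single m (1::series)" for m :: "nat multiset"
  have sv: "s {#i, j#} \<in> vars_le 4" if "i \<le> 4" "j \<le> 4" for i j unfolding s_def by (rule vars_le_single) (use that in auto)
  have s0: "s {#0, 0#} \<notin> P.I" using memI[OF sv[of 0 0]] by (simp add: s_def)
  have sh: "homog 2 (s {#i, j#})" for i j unfolding s_def by (rule homog_single) simp
  have h: "(s {#i, j#}, s {#0, 0#}) \<in> P.hf" if "i \<le> 4" "j \<le> 4" for i j
    using that s0 by (intro P.hfI[of _ _ 2] sv sh) auto
  define B where "B i j = P.fr (s {#i, j#}) (s {#0, 0#})" for i j
  have Bc: "B i j \<in> carrier P.L" if "i \<le> 4" "j \<le> 4" for i j unfolding B_def using h[OF that] by (rule P.L_carrierI)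
  define Us where "Us = [B 0 0, B 0 1, B 0 2, B 1 2]"
  have Us: "set Us \<subseteq> carrier P.L" unfolding Us_def using Bc by auto
  have "carrier P.L \<subseteq> L.Span L.K Us"
  proof
    fix u assume "u \<in> carrier P.L"
    then obtain f g where fg: "u = P.fr f g" "(f, g) \<in> P.hf" unfolding P.L_carrier by blast
    then obtain d where d: "homog d f" "homog d g" unfolding P.hf_def by blast
    obtain x where x: "x \<in> point_ring" "ev f = Polynomial.monom x d" using ev_homog[OF d(1)] by blast
    obtain y where y: "y \<in> point_ring" "ev g = Polynomial.monom y d" using ev_homog[OF d(2)] by blast
    have "y \<noteq> 0" using P.hfD[OF fg(2)] memI y(2) by auto
    then obtain z c where z: "z \<in> point_ring" "y * z = double c" "c \<noteq> 0" using point_ring_norm[OF y(1)] by blast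
    have cc: "double (inverse c) * double c = 1" using z(3) by (simp add: double_mult[symmetric])
    \<comment> \<open>This is the quotient of the values \<open>x\<close> and \<open>y\<close>:
      \<open>z\<close> is the norm multiplier of \<open>y\<close>, so y z is a scalar and can be
      inverted inside the image of \<open>double\<close>.\<close>
    define w where "w = double (inverse c) * (x * z)"
    have "double (inverse c) \<in> point_ring" using doubles_subset_point_ring unfolding doubles_def by blast
    then have "w \<in> point_ring" unfolding w_def using subring_setD(4)[OF subring_point_ring] x z by blast
    then obtain a b c' d' where q: "ev (Poly_Mapping.single {#0, 0#} a + Poly_Mapping.single {#0, 1#} b + Poly_Mapping.single {#0, 2#} c' + Poly_Mapping.single {#1, 2#} d') = Polynomial.monom w 2"
      by (rule point_ring_ev)
    define q :: "series mpoly" where "q = Poly_Mapping.single {#0, 0#} a + Poly_Mapping.single {#0, 1#} b + Poly_Mapping.single {#0, 2#} c' + Poly_Mapping.single {#1, 2#} d'"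
    have qv: "q \<in> vars_le 4" unfolding q_def by (rule quad_form_vars)
    have qh: "homog 2 q" unfolding q_def by (intro homog_add homog_single) auto
    have qhf: "(q, s {#0, 0#}) \<in> P.hf" using qv qh sv s0 sh by (intro P.hfI[of _ _ 2]) auto
    have "u = P.fr q (s {#0, 0#})" unfolding fg(1)
    proof (rule P.fr_eqI[OF fg(2) qhf])
      have wy: "w * y = x"
      proof -
        have "w * y = (double (inverse c) * (y * z)) * x" unfolding w_def by (simp add: mult_ac)
        then show ?thesis unfolding z(2) cc by simp
      qed
      have "ev (f * s {#0, 0#} - q * g) = 0"
        unfolding ev_diff ev_mult x(2) y(2) q[folded q_def] s_def using wy by (simp add: mult_monom add.commute numeral_2_eq_2)
      moreover have "f * s {#0, 0#} - q * g \<in> vars_le 4"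
      proof -
        have v: "f * s {#0, 0#} \<in> vars_le 4" "q * g \<in> vars_le 4" using P.hfD[OF fg(2)] qv sv by (auto intro: vars_le_mult)
        show ?thesis using vars_le_add[OF v(1) vars_le_uminus[OF v(2)]] by simp
      qed
      ultimately show "f * s {#0, 0#} - q * g \<in> P.I" using memI by blast
    qed
    also have "\<dots> = P.emb a \<otimes>\<^bsub>P.L\<^esub> B 0 0 \<oplus>\<^bsub>P.L\<^esub> (P.emb b \<otimes>\<^bsub>P.L\<^esub> B 0 1 \<oplus>\<^bsub>P.L\<^esub> (P.emb c' \<otimes>\<^bsub>P.L\<^esub> B 0 2 \<oplus>\<^bsub>P.L\<^esub> P.emb d' \<otimes>\<^bsub>P.L\<^esub> B 1 2))"
    proof -
      define G where "G = s {#0, 0#}"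
      have sc: "P.emb e \<otimes>\<^bsub>P.L\<^esub> B i j = P.fr (Poly_Mapping.single {#i, j#} e) G \<and> (Poly_Mapping.single {#i, j#} e, G) \<in> P.hf" if "i \<le> 4" "j \<le> 4" for e i j
      proof -
        have "Poly_Mapping.single {#} e * s {#i, j#} = Poly_Mapping.single {#i, j#} e" unfolding s_def by (simp add: mult_single)
        then show ?thesis unfolding P.emb_def B_def P.L_mult[OF P.emb_hf h[OF that]] G_def
          using P.hf_mult[OF P.emb_hf h[OF that], of e] by simp
      qed
      have G: "homog 2 G" "G \<noteq> 0" using sh s0 P.I_0 unfolding G_def by auto
      have ad: "P.fr f G \<oplus>\<^bsub>P.L\<^esub> P.fr f' G = P.fr (f + f') G \<and> (f + f', G) \<in> P.hf" if "(f, G) \<in> P.hf" "(f', G) \<in> P.hf" for f f'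
      proof -
        have "(f + f', G) \<in> P.hf" using P.hf_same_denominator[OF that G] .
        moreover from this have "P.fr (f * G + f' * G) (G * G) = P.fr (f + f') G"
          by (intro P.fr_eqI' P.hf_add that) (simp_all add: algebra_simps)
        ultimately show ?thesis unfolding P.L_add[OF that] by simp
      qed
      have "P.emb a \<otimes>\<^bsub>P.L\<^esub> B 0 0 \<oplus>\<^bsub>P.L\<^esub> P.emb b \<otimes>\<^bsub>P.L\<^esub> B 0 1 \<oplus>\<^bsub>P.L\<^esub> P.emb c' \<otimes>\<^bsub>P.L\<^esub> B 0 2 \<oplus>\<^bsub>P.L\<^esub> P.emb d' \<otimes>\<^bsub>P.L\<^esub> B 1 2 = P.fr q G"
        unfolding q_def using sc ad by simp
      then show ?thesis unfolding G_def using Bc by (simp add: L.a_assoc)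
    qed
    also have "\<dots> \<in> L.Span L.K Us"
      unfolding L.Span_mem_iff_length_version[OF L.subfield_K Us]
      by (intro exI[of _ "[P.emb a, P.emb b, P.emb c', P.emb d']"]) (use Bc in \<open>auto simp: L.K_def Us_def\<close>)
    finally show "u \<in> L.Span L.K Us" .
  qed
  moreover have "L.Span L.K Us \<subseteq> carrier P.L" using L.Span_in_carrier[OF L.K_subset Us] .
  ultimately have sp: "L.Span L.K Us = carrier P.L" by blast
  have len: "length Us = 4" by (simp add: Us_def)
  obtain m where m: "m \<le> 4" "L.dimension m L.K (carrier P.L)" using L.Span_dimension_le[OF Us] unfolding sp len by blast
  have res: "residue_degree k 4 P0 m" using m(2) unfolding residue_degree_def P.residue_scalars_eq L.K_def .
  have "4 dvd m" using four_dvd_residue_degree[OF inj_phi P0_locus res] .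
  moreover have "m \<noteq> 0"
  proof
    assume "m = 0"
    then have "carrier P.L = {\<zero>\<^bsub>P.L\<^esub>}" using L.dimension_zero[OF L.subfield_K] m(2) by blast
    then show False using L.one_closed L.one_not_zero by blast
  qed
  ultimately have "m = 4" using m(1) by (metis dvd_imp_le le_antisym gr0I)
  then show ?thesis using res by simp
qed

lemma index_eq_4: "proj_index k 4 {\<Phi> (quad tt), \<Phi> (quad (\<lambda>i. of_nat i * tt i))} = 4"
proof -
  let ?D = "{d. \<exists>P\<in>closed_points k 4 {\<Phi> (quad tt), \<Phi> (quad (\<lambda>i. of_nat i * tt i))}. residue_degree k 4 P d}"
  have "4 \<in> ?D" using P0_closed P0_degree by blast
  then have "Gcd ?D dvd 4" by (rule Gcd_dvd)
  moreover have "4 dvd Gcd ?D"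
  proof (rule Gcd_greatest)
    fix d assume "d \<in> ?D"
    then obtain P where "P \<in> zero_locus k 4 {\<Phi> (quad tt), \<Phi> (quad (\<lambda>i. of_nat i * tt i))}" "residue_degree k 4 P d"
      unfolding closed_points_def by blast
    then show "4 dvd d" using four_dvd_residue_degree[OF inj_phi] by blast
  qed
  ultimately show ?thesis unfolding proj_index_def using dvd_antisym by blast
qed

lemma del_pezzo4_tt: "del_pezzo4 k (\<Phi> (quad tt)) (\<Phi> (quad (\<lambda>i. of_nat i * tt i)))"
  unfolding del_pezzo4_def
proof (intro conjI)
  show "quadric_form k 4 (\<Phi> (quad tt))" by (rule quadric_form_quad[of 0]) auto
  show "quadric_form k 4 (\<Phi> (quad (\<lambda>i. of_nat i * tt i)))" by (rule quadric_form_quad[of 1]) auto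
  show "complete_intersection2 k 4 (\<Phi> (quad tt)) (\<Phi> (quad (\<lambda>i. of_nat i * tt i)))"
    by (rule complete_intersection_quad) auto
  show "smooth_intersection2 k 4 (\<Phi> (quad tt)) (\<Phi> (quad (\<lambda>i. of_nat i * tt i)))"
  proof (rule smooth_quad)
    fix i j :: nat assume "i \<noteq> j"
    have "tt i * (of_nat j * tt j) - tt j * (of_nat i * tt i) = (of_nat j - of_nat i) * (tt i * tt j)" by (simp add: algebra_simps)
    then show "tt i * (of_nat j * tt j) - tt j * (of_nat i * tt i) \<noteq> 0" using \<open>i \<noteq> j\<close> by simp
  qed simp
qed

end

theorem theorem7p6:
  shows "\<exists>(k :: complex ring) q1 q2.
           field k \<and> char_zero k \<and> del_pezzo4 k q1 q2 \<and> proj_index k 4 {q1, q2} = 4"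
proof -
  obtain \<phi> :: "series \<Rightarrow> complex" where "inj \<phi>" using ex_inj_series_complex by blast
  then interpret series_transport \<phi> by unfold_locales
  show ?thesis using field_k char_zero_k del_pezzo4_tt index_eq_4 by blast
qed

end
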